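(* Let $(R,\mathfrak m,k)$ be a regular local ring (respectively, a standard graded polynomial ring over a field $k$ with homogeneous maximal ideal $\mathfrak m$), let $I\subset R$ be any proper ideal, and let $\mathfrak a$ be a complete intersection ideal (i.e. an ideal generated by a regular sequence) with $\mathfrak a\subseteq \mathfrak m I$ (ideals are homogeneous in the graded case). Assume that the minimal number of generators satisfies $\mu(\mathfrak a)\ge 4$. Then $R/\mathfrak a I$ is not a Golod ring.
   Context: Let $(A,\mathfrak n,k)$ be a local ring, or a standard graded $k$-algebra with homogeneous maximal ideal $\mathfrak n$. Let $K^A$ be the Koszul complex over $A$ on a minimal set of generators of $\mathfrak n$; it is a DG-algebra with $H_0(K^A)\cong k$. For a homogeneous element $a$ of a DG-algebra put $\overline a:=(-1)^{|a|+1}a$, where $|a|$ is the homological degree. A DG-algebra $B$ with $H_0(B)\cong k$ admits a trivial Massey operation if for some homogeneous $k$-basis $\mathcal B=\{h_\lambda\}_{\lambda\in\Lambda}$ of $H_{\ge 1}(B)$ there is a function $\nu:\coprod_{i=1}^\infty \mathcal B^i\to B$ such that $\nu(h_\lambda)=z_\lambda$ is a cycle with homology class $[z_\lambda]=h_\lambda$, and $d\nu(h_{\lambda_1},\dots,h_{\lambda_p})=\sum_{j=1}^{p-1}\overline{\nu(h_{\lambda_1},\dots,h_{\lambda_j})}\,\nu(h_{\lambda_{j+1}},\dots,h_{\lambda_p})$ for all $p\ge 2$. The ring $A$ is called Golod if $K^A$ admits a trivial Massey operation. *)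

theory Defs
  imports "HOL-Algebra.Algebra" "HOL-Library.Poly_Mapping" "HOL-Library.Extended_Nat"
begin

section \<open>Differential graded algebras and trivial Massey operations\<close>

text \<open>A DG-algebra is a ring together with its homogeneous pieces \<open>B\<^sub>i\<close> (\<open>i \<ge> 0\<close>) and a
  differential lowering the homological degree by one.\<close>

record 'b dga = "'b ring" +
  piece :: "nat \<Rightarrow> 'b set"
  diff :: "'b \<Rightarrow> 'b"

definition dg_cycles :: "('b, 'm) dga_scheme \<Rightarrow> 'b set"
  where "dg_cycles B = {z \<in> carrier B. diff B z = \<zero>\<^bsub>B\<^esub>}"

definition dg_boundaries :: "('b, 'm) dga_scheme \<Rightarrow> 'b set"
  where "dg_boundaries B = diff B ` carrier B"

text \<open>The homology algebra \<open>H(B)\<close>, its homogeneous pieces, and \<open>H\<^bsub>\<ge>1\<^esub>(B)\<close>.\<close>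

definition dg_homology :: "('b, 'm) dga_scheme \<Rightarrow> 'b set ring"
  where "dg_homology B = (B\<lparr>carrier := dg_cycles B\<rparr>) Quot (dg_boundaries B)"

definition homology_class :: "('b, 'm) dga_scheme \<Rightarrow> 'b \<Rightarrow> 'b set"
  where "homology_class B z = dg_boundaries B +>\<^bsub>B\<^esub> z"

definition homology_piece :: "('b, 'm) dga_scheme \<Rightarrow> nat \<Rightarrow> 'b set set"
  where "homology_piece B i = homology_class B ` (dg_cycles B \<inter> piece B i)"

definition homology_pos :: "('b, 'm) dga_scheme \<Rightarrow> 'b set set"
  where "homology_pos B =
    {finsum (dg_homology B) c {1..N} | c N. \<forall>i\<in>{1..N}. c i \<in> homology_piece B i}"

text \<open>The field \<open>k \<cong> H\<^sub>0(B)\<close> is the degree-zero part of the ring \<open>H(B)\<close>, and \<open>H\<^bsub>\<ge>1\<^esub>(B)\<close> is a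
  vector space over it through the multiplication of \<open>H(B)\<close>. The library notions of span and
  independence concern finite lists of vectors; a basis may be infinite.\<close>

definition homogeneous_basis :: "('b, 'm) dga_scheme \<Rightarrow> 'b set set \<Rightarrow> bool"
  where "homogeneous_basis B \<B> \<longleftrightarrow>
    \<B> \<subseteq> (\<Union>i\<in>{1..}. homology_piece B i) \<and>
    (\<forall>hs. distinct hs \<and> set hs \<subseteq> \<B> \<longrightarrow>
        ring.independent (dg_homology B) (homology_piece B 0) hs) \<and>
    homology_pos B = (\<Union>hs\<in>lists \<B>. ring.Span (dg_homology B) (homology_piece B 0) hs)"

text \<open>For \<open>a \<noteq> 0\<close> homogeneous the degree is the unique \<open>i\<close> with \<open>a \<in> B\<^sub>i\<close>; the degree given to
  \<open>0\<close> does not matter below. \<open>dg_bar B a\<close> is \<open>(-1)\<^bsup>|a|+1\<^esup> a\<close>.\<close>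

definition hdegree :: "('b, 'm) dga_scheme \<Rightarrow> 'b \<Rightarrow> nat"
  where "hdegree B a = (LEAST i. a \<in> piece B i)"

definition dg_bar :: "('b, 'm) dga_scheme \<Rightarrow> 'b \<Rightarrow> 'b"
  where "dg_bar B a = (\<ominus>\<^bsub>B\<^esub> \<one>\<^bsub>B\<^esub>) [^]\<^bsub>B\<^esub> (hdegree B a + 1) \<otimes>\<^bsub>B\<^esub> a"

text \<open>\<open>\<nu>\<close> is a function on nonempty lists of basis elements. Its values have to be homogeneous
  for the bar to apply to them.\<close>

definition trivial_massey_operation ::
    "('b, 'm) dga_scheme \<Rightarrow> 'b set set \<Rightarrow> ('b set list \<Rightarrow> 'b) \<Rightarrow> bool"
  where "trivial_massey_operation B \<B> \<nu> \<longleftrightarrow>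
    (\<forall>hs. hs \<noteq> [] \<and> set hs \<subseteq> \<B> \<longrightarrow> \<nu> hs \<in> (\<Union>i. piece B i)) \<and>
    (\<forall>h\<in>\<B>. \<nu> [h] \<in> dg_cycles B \<and> homology_class B (\<nu> [h]) = h) \<and>
    (\<forall>hs. 2 \<le> length hs \<and> set hs \<subseteq> \<B> \<longrightarrow>
        diff B (\<nu> hs) =
          (\<Oplus>\<^bsub>B\<^esub>j\<in>{1..<length hs}. dg_bar B (\<nu> (take j hs)) \<otimes>\<^bsub>B\<^esub> \<nu> (drop j hs)))"

definition admits_trivial_massey_operation :: "('b, 'm) dga_scheme \<Rightarrow> bool"
  where "admits_trivial_massey_operation B \<longleftrightarrow>
    (\<exists>\<B> \<nu>. homogeneous_basis B \<B> \<and> trivial_massey_operation B \<B> \<nu>)"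


section \<open>The Koszul complex\<close>

text \<open>The Koszul complex on \<open>x\<^sub>0, \<dots>, x\<^bsub>n-1\<^esub>\<close> is the exterior algebra on \<open>e\<^sub>0, \<dots>, e\<^bsub>n-1\<^esub>\<close> with
  \<open>d e\<^sub>i = x\<^sub>i\<close>. An element is given by its coefficients with respect to the basis
  \<open>e\<^sub>S = e\<^bsub>i\<^sub>1\<^esub> \<and> \<dots> \<and> e\<^bsub>i\<^sub>p\<^esub>\<close>, \<open>S = {i\<^sub>1 < \<dots> < i\<^sub>p} \<subseteq> {..<n}\<close>. For disjoint \<open>S\<close>, \<open>T\<close>,
  \<open>e\<^sub>S \<and> e\<^sub>T = (-1)\<^bsup>inversions S T\<^esup> e\<^bsub>S \<union> T\<^esub>\<close>, and
  \<open>d e\<^sub>T = (\<Sum>i\<in>T. (-1)\<^bsup>inversions {i} (T - {i})\<^esup> x\<^sub>i e\<^bsub>T - {i}\<^esub>)\<close>.\<close>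

definition inversions :: "nat set \<Rightarrow> nat set \<Rightarrow> nat"
  where "inversions S T = card {(s, t). s \<in> S \<and> t \<in> T \<and> t < s}"

definition koszul_sign :: "('a, 'm) ring_scheme \<Rightarrow> nat set \<Rightarrow> nat set \<Rightarrow> 'a"
  where "koszul_sign A S T = (\<ominus>\<^bsub>A\<^esub> \<one>\<^bsub>A\<^esub>) [^]\<^bsub>A\<^esub> inversions S T"

definition koszul :: "('a, 'm) ring_scheme \<Rightarrow> 'a list \<Rightarrow> (nat set \<Rightarrow> 'a) dga"
  where "koszul A xs = (let V = {..<length xs} in
   \<lparr> carrier = Pow V \<rightarrow>\<^sub>E carrier A,
     monoid.mult = (\<lambda>f g. \<lambda>S\<in>Pow V.
       \<Oplus>\<^bsub>A\<^esub>T\<in>Pow S. koszul_sign A T (S - T) \<otimes>\<^bsub>A\<^esub> (f T \<otimes>\<^bsub>A\<^esub> g (S - T))),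
     one = (\<lambda>S\<in>Pow V. if S = {} then \<one>\<^bsub>A\<^esub> else \<zero>\<^bsub>A\<^esub>),
     ring.zero = (\<lambda>S\<in>Pow V. \<zero>\<^bsub>A\<^esub>),
     ring.add = (\<lambda>f g. \<lambda>S\<in>Pow V. f S \<oplus>\<^bsub>A\<^esub> g S),
     piece = (\<lambda>p. {f \<in> Pow V \<rightarrow>\<^sub>E carrier A. \<forall>S\<in>Pow V. card S \<noteq> p \<longrightarrow> f S = \<zero>\<^bsub>A\<^esub>}),
     diff = (\<lambda>f. \<lambda>S\<in>Pow V.
       \<Oplus>\<^bsub>A\<^esub>i\<in>V - S. koszul_sign A {i} S \<otimes>\<^bsub>A\<^esub> (xs ! i \<otimes>\<^bsub>A\<^esub> f (insert i S))) \<rparr>)"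


section \<open>Rings and ideals\<close>

definition local_ring :: "('a, 'm) ring_scheme \<Rightarrow> bool"
  where "local_ring R \<longleftrightarrow> cring R \<and> noetherian_ring R \<and> (\<exists>!m. maximalideal m R)"

definition max_ideal :: "('a, 'm) ring_scheme \<Rightarrow> 'a set"
  where "max_ideal R = (THE m. maximalideal m R)"

text \<open>The least number of generators, for finitely generated ideals.\<close>

definition num_generators :: "('a, 'm) ring_scheme \<Rightarrow> 'a set \<Rightarrow> nat"
  where "num_generators R I =
    (LEAST n. \<exists>S \<subseteq> carrier R. finite S \<and> card S = n \<and> Idl\<^bsub>R\<^esub> S = I)"

definition minimal_generators :: "('a, 'm) ring_scheme \<Rightarrow> 'a set \<Rightarrow> 'a list \<Rightarrow> bool"
  where "minimal_generators R I xs \<longleftrightarrow>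
    distinct xs \<and> set xs \<subseteq> carrier R \<and> Idl\<^bsub>R\<^esub> (set xs) = I \<and>
    (\<forall>S. S \<subset> set xs \<longrightarrow> Idl\<^bsub>R\<^esub> S \<noteq> I)"

definition krull_dim :: "('a, 'm) ring_scheme \<Rightarrow> enat"
  where "krull_dim R =
    Sup {enat n | n. \<exists>P. (\<forall>i\<le>n. primeideal (P i) R) \<and> (\<forall>i<n. P i \<subset> P (Suc i))}"

definition regular_local_ring :: "('a, 'm) ring_scheme \<Rightarrow> bool"
  where "regular_local_ring R \<longleftrightarrow>
    local_ring R \<and> krull_dim R = enat (num_generators R (max_ideal R))"

definition regular_sequence :: "('a, 'm) ring_scheme \<Rightarrow> 'a list \<Rightarrow> bool"
  where "regular_sequence R xs \<longleftrightarrow>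
    set xs \<subseteq> carrier R \<and> Idl\<^bsub>R\<^esub> (set xs) \<noteq> carrier R \<and>
    (\<forall>i<length xs. \<forall>r\<in>carrier R.
        xs ! i \<otimes>\<^bsub>R\<^esub> r \<in> Idl\<^bsub>R\<^esub> (set (take i xs)) \<longrightarrow> r \<in> Idl\<^bsub>R\<^esub> (set (take i xs)))"

definition complete_intersection_ideal :: "('a, 'm) ring_scheme \<Rightarrow> 'a set \<Rightarrow> bool"
  where "complete_intersection_ideal R I \<longleftrightarrow>
    (\<exists>xs. regular_sequence R xs \<and> I = Idl\<^bsub>R\<^esub> (set xs))"


section \<open>Graded rings\<close>

text \<open>A grading of a ring is given by its homogeneous pieces \<open>gr d\<close>, \<open>d \<ge> 0\<close>.\<close>

definition irrelevant_ideal :: "('a, 'm) ring_scheme \<Rightarrow> (nat \<Rightarrow> 'a set) \<Rightarrow> 'a set"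
  where "irrelevant_ideal R gr = Idl\<^bsub>R\<^esub> (\<Union>d\<in>{1..}. gr d)"

definition homogeneous_ideal :: "('a, 'm) ring_scheme \<Rightarrow> (nat \<Rightarrow> 'a set) \<Rightarrow> 'a set \<Rightarrow> bool"
  where "homogeneous_ideal R gr I \<longleftrightarrow> (\<exists>S \<subseteq> (\<Union>d. gr d). I = Idl\<^bsub>R\<^esub> S)"

definition quotient_grading ::
    "('a, 'm) ring_scheme \<Rightarrow> (nat \<Rightarrow> 'a set) \<Rightarrow> 'a set \<Rightarrow> nat \<Rightarrow> 'a set set"
  where "quotient_grading R gr J d = (\<lambda>r. J +>\<^bsub>R\<^esub> r) ` gr d"

text \<open>The polynomial ring \<open>k[x\<^sub>0, \<dots>, x\<^bsub>n-1\<^esub>]\<close>, where \<open>k\<close> is the field of the type \<open>'k\<close>, with its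
  standard grading. A monomial is its finitely supported exponent vector.\<close>

definition std_poly_ring :: "nat \<Rightarrow> ((nat \<Rightarrow>\<^sub>0 nat) \<Rightarrow>\<^sub>0 'k::field) ring"
  where "std_poly_ring n =
   \<lparr> carrier = {p. \<forall>m\<in>Poly_Mapping.keys p. Poly_Mapping.keys m \<subseteq> {..<n}},
     monoid.mult = (*), one = 1, ring.zero = 0, ring.add = (+) \<rparr>"

definition std_poly_grading :: "nat \<Rightarrow> nat \<Rightarrow> ((nat \<Rightarrow>\<^sub>0 nat) \<Rightarrow>\<^sub>0 'k::field) set"
  where "std_poly_grading n d =
    {p \<in> carrier (std_poly_ring n). \<forall>m\<in>Poly_Mapping.keys p.
        (\<Sum>i\<in>Poly_Mapping.keys m. Poly_Mapping.lookup m i) = d}"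


section \<open>Golod rings\<close>

text \<open>Up to isomorphism the Koszul complex does not depend on the choice of the minimal
  (homogeneous, in the graded case) generators, so Golodness may be tested on any of them.\<close>

definition golod_local :: "('a, 'm) ring_scheme \<Rightarrow> bool"
  where "golod_local A \<longleftrightarrow>
    (\<exists>xs. minimal_generators A (max_ideal A) xs \<and>
          admits_trivial_massey_operation (koszul A xs))"

definition golod_graded :: "('a, 'm) ring_scheme \<Rightarrow> (nat \<Rightarrow> 'a set) \<Rightarrow> bool"
  where "golod_graded A gr \<longleftrightarrow>
    (\<exists>xs. minimal_generators A (irrelevant_ideal A gr) xs \<and> set xs \<subseteq> (\<Union>d. gr d) \<and>
          admits_trivial_massey_operation (koszul A xs))"

end

theory Submission
  imports Defs
begin

text \<open>Write \<open>\<aa> = (f\<^sub>0, \<dots>, f\<^bsub>c-1\<^esub>)\<close> with \<open>c \<ge> 4\<close> and \<open>J = \<aa> I\<close>. Let \<open>x\<close> lift a minimal system of generators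
  of the maximal ideal of \<open>R/J\<close>. By Nakayama there is \<open>u \<in> 1 + I\<close> with \<open>u f\<^sub>i \<in> (x) I\<close>, so \<open>u f\<^sub>i = d z\<^sub>i\<close>
  for some \<open>z\<^sub>i \<in> K\<^sub>1(x; R)\<close> with coefficients in \<open>I\<close>. Then \<open>d (z\<^sub>i z\<^sub>j) = u f\<^sub>i z\<^sub>j - u f\<^sub>j z\<^sub>i\<close> has coefficients in \<open>J\<close>,
  and so \<open>z\<^sub>3 z\<^sub>2\<close> and \<open>z\<^sub>1 z\<^sub>0\<close> are cycles over \<open>R/J\<close>. A trivial Massey operation would make their product a boundary,
  hence \<open>z\<^sub>3 z\<^sub>2 z\<^sub>1 z\<^sub>0\<close> a boundary modulo \<open>\<aa>\<close>. Applying \<open>d\<close> and using that syzygies of a regular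
  sequence have coefficients in \<open>\<aa>\<close>, the factors \<open>z\<^sub>i\<close> can be removed one at a time, until a power of \<open>u\<close> lies in the maximal
  ideal.\<close>

section \<open>Signs and sums over subsets\<close>

text \<open>The bound 4 is two times two. A single z_i is a cycle only modulo \<aa>, since its
  differential is u f_i. A product of two of them is a cycle modulo \<aa> I, because each term of
  its differential multiplies an element of \<aa> by coefficients in I; this is why the z_i are
  lifted with coefficients in I. Vanishing of a product of two such positive-degree classes
  therefore involves four members of the sequence.

  The multiplier u is forced by the passage to the quotient: the lifted list x generates the maximal
  ideal only together with J, so f_i lies in (x) I only up to an error in I \<aa>, and f_i itself
  need not be a boundary. In the polynomial ring u need not be invertible, so it is carried along
  instead of cancelled. Being congruent to 1 modulo I, and hence modulo the maximal ideal, is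
  enough: no power of it can lie there.

  The boundary equation over R/J is used only modulo the larger ideal \<aa>, since that is the ideal
  in which syzygies of the sequence have their coefficients.\<close>

lemma finite_inversions:
  "finite S \<Longrightarrow> finite T \<Longrightarrow> finite {(s, t). s \<in> S \<and> t \<in> T \<and> t < s}"
  by (rule finite_subset[of _ "S \<times> T"]) auto

lemma inversions_Un_left:
  assumes "finite S" "finite S'" "finite T" "S \<inter> S' = {}"
  shows "inversions (S \<union> S') T = inversions S T + inversions S' T"
proof -
  have "{(s, t). s \<in> S \<union> S' \<and> t \<in> T \<and> t < s} =
      {(s, t). s \<in> S \<and> t \<in> T \<and> t < s} \<union> {(s, t). s \<in> S' \<and> t \<in> T \<and> t < s}" (is "_ = ?A \<union> ?B")
    by blast
  moreover have "card \<dots> = inversions S T + inversions S' T"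
    unfolding inversions_def
  proof (rule card_Un_disjoint)
    show "?A \<inter> ?B = {}" using assms(4) by blast
  qed (rule finite_inversions; rule assms)+
  ultimately show ?thesis
    unfolding inversions_def by (rule trans[OF arg_cong[of _ _ card]])
qed

lemma inversions_Un_right:
  assumes "finite S" "finite T" "finite T'" "T \<inter> T' = {}"
  shows "inversions S (T \<union> T') = inversions S T + inversions S T'"
proof -
  have "{(s, t). s \<in> S \<and> t \<in> T \<union> T' \<and> t < s} =
      {(s, t). s \<in> S \<and> t \<in> T \<and> t < s} \<union> {(s, t). s \<in> S \<and> t \<in> T' \<and> t < s}" (is "_ = ?A \<union> ?B")
    by blast
  moreover have "card \<dots> = inversions S T + inversions S T'"
    unfolding inversions_def
  proof (rule card_Un_disjoint)
    show "?A \<inter> ?B = {}" using assms(4) by blast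
  qed (rule finite_inversions; rule assms)+
  ultimately show ?thesis
    unfolding inversions_def by (rule trans[OF arg_cong[of _ _ card]])
qed

lemma inversions_empty [simp]: "inversions {} T = 0" "inversions S {} = 0"
  by (simp_all add: inversions_def)

lemma inversions_insert_left:
  "finite S \<Longrightarrow> finite T \<Longrightarrow> i \<notin> S \<Longrightarrow> inversions (insert i S) T = inversions {i} T + inversions S T"
  using inversions_Un_left[of "{i}" S T] by simp

lemma inversions_insert_right:
  "finite S \<Longrightarrow> finite T \<Longrightarrow> i \<notin> T \<Longrightarrow> inversions S (insert i T) = inversions S {i} + inversions S T"
  using inversions_Un_right[of S "{i}" T] by simp

text \<open>Each element of T lies strictly below or strictly above i. This produces the sign
  (-1)^|T| when e_i is moved past e_T.\<close>

lemma inversions_singleton_add: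
  assumes "finite T" "i \<notin> T"
  shows "inversions {i} T + inversions T {i} = card T"
proof -
  have a: "{(s, t). s \<in> {i} \<and> t \<in> T \<and> t < s} = Pair i ` {t \<in> T. t < i}"
    by auto
  have "inj_on (Pair i) {t \<in> T. t < i}" by (simp add: inj_on_def)
  then have 1: "inversions {i} T = card {t \<in> T. t < i}"
    unfolding inversions_def a by (rule card_image)
  have b: "{(s, t). s \<in> T \<and> t \<in> {i} \<and> t < s} = (\<lambda>t. (t, i)) ` {t \<in> T. i < t}"
    by auto
  have "inj_on (\<lambda>t. (t, i)) {t \<in> T. i < t}" by (simp add: inj_on_def)
  then have 2: "inversions T {i} = card {t \<in> T. i < t}"
    unfolding inversions_def b by (rule card_image)
  have "{t \<in> T. t < i} \<inter> {t \<in> T. i < t} = {}"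
    by (simp add: set_eq_iff)
  then have 3: "card ({t \<in> T. t < i} \<union> {t \<in> T. i < t}) = card {t \<in> T. t < i} + card {t \<in> T. i < t}"
    by (intro card_Un_disjoint finite_Collect_conjI disjI1) (use assms(1) in simp_all)
  have 4: "{t \<in> T. t < i} \<union> {t \<in> T. i < t} = T"
  proof (intro equalityI subsetI)
    fix t assume "t \<in> T"
    then have "t < i \<or> i < t" using assms(2) by (cases "t = i") (simp_all, arith)
    then show "t \<in> {t \<in> T. t < i} \<union> {t \<in> T. i < t}" using \<open>t \<in> T\<close> by simp
  qed auto
  show ?thesis using 1 2 3 unfolding 4 by linarith
qed

context cring
begin

text \<open>Keeping only the exponent turns a product of Koszul signs into a sum of inversion
  counts.\<close>

definition sg :: "nat \<Rightarrow> 'a"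
  where "sg n = (\<ominus> \<one>) [^] n"

lemma sg_closed [simp, intro]: "sg n \<in> carrier R"
  by (simp add: sg_def)

lemma sg_0 [simp]: "sg 0 = \<one>"
  by (simp add: sg_def)

lemma sg_add: "sg (m + n) = sg m \<otimes> sg n"
  by (simp add: sg_def nat_pow_mult)

lemma sg_Suc: "sg (Suc n) = \<ominus> sg n"
  unfolding sg_def nat_pow_Suc by (subst r_minus) auto

lemma sg_cases: "sg n = \<one> \<or> sg n = \<ominus> \<one>"
proof (induct n)
  case (Suc n)
  then show ?case by (elim disjE) (simp_all add: sg_Suc)
qed simp

lemma sg_mult_self: "sg n \<otimes> sg n = \<one>"
proof -
  have "(\<ominus> \<one>) \<otimes> (\<ominus> \<one>) = \<one>" by algebra
  then show ?thesis using sg_cases[of n] by (elim disjE) simp_all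
qed

lemma sg_even: "even n \<Longrightarrow> sg n = \<one>"
  by (elim evenE) (simp add: mult_2 sg_add sg_mult_self)

text \<open>Reduces an identity of signs to a parity claim about inversion counts, which linear
  arithmetic decides.\<close>

lemma sg_cong:
  assumes "even (m + n)"
  shows "sg m = sg n"
proof -
  have "sg m = sg m \<otimes> (sg n \<otimes> sg n)" by (simp add: sg_mult_self)
  also have "\<dots> = sg (m + n) \<otimes> sg n" unfolding sg_add by (rule m_assoc[symmetric]) auto
  finally show ?thesis using sg_even[OF assms] by simp
qed

lemma koszul_sign_eq: "koszul_sign R S T = sg (inversions S T)"
  by (simp add: koszul_sign_def sg_def)

lemma finsum_congI:
  assumes "\<And>x. x \<in> S \<Longrightarrow> G x \<in> carrier R" "\<And>x. x \<in> S \<Longrightarrow> F x = G x"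
  shows "(\<Oplus>x\<in>S. F x) = (\<Oplus>x\<in>S. G x)"
  by (rule finsum_cong'[OF refl]) (use assms in auto)

lemma finsum_rdistr_add:
  assumes "finite S" "a \<in> carrier R" "\<And>x. x \<in> S \<Longrightarrow> F x \<in> carrier R" "\<And>x. x \<in> S \<Longrightarrow> G x \<in> carrier R"
  shows "a \<otimes> ((\<Oplus>x\<in>S. F x) \<oplus> (\<Oplus>x\<in>S. G x)) = (\<Oplus>x\<in>S. a \<otimes> F x) \<oplus> (\<Oplus>x\<in>S. a \<otimes> G x)"
proof -
  have F: "F \<in> S \<rightarrow> carrier R" and G: "G \<in> S \<rightarrow> carrier R" using assms by auto
  show ?thesis
    using finsum_rdistr[OF assms(1,2) F] finsum_rdistr[OF assms(1,2) G] F G assms(2)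
    by (simp add: r_distr finsum_closed)
qed

text \<open>Subsets are sorted by whether they contain i. In a product of Koszul elements this
  decides which factor receives e_i.\<close>

lemma finsum_Pow_insert:
  assumes "finite S" "i \<notin> S" "\<And>T. T \<subseteq> insert i S \<Longrightarrow> F T \<in> carrier R"
  shows "(\<Oplus>T\<in>Pow (insert i S). F T) = (\<Oplus>T\<in>Pow S. F T) \<oplus> (\<Oplus>T\<in>Pow S. F (insert i T))"
proof -
  have "(\<Oplus>T\<in>Pow (insert i S). F T) = (\<Oplus>T\<in>Pow S. F T) \<oplus> (\<Oplus>T\<in>insert i ` Pow S. F T)"
    unfolding Pow_insert by (rule finsum_Un_disjoint) (use assms in \<open>auto intro!: assms(3)\<close>)
  also have "(\<Oplus>T\<in>insert i ` Pow S. F T) = (\<Oplus>T\<in>Pow S. F (insert i T))"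
  proof (rule finsum_reindex)
    show "F \<in> insert i ` Pow S \<rightarrow> carrier R" using assms(3) by (auto intro!: assms(3) insert_mono)
    show "inj_on (insert i) (Pow S)"
      by (rule inj_on_inverseI[of _ "\<lambda>T. T - {i}"]) (use assms(2) in auto)
  qed
  finally show ?thesis .
qed

text \<open>Both sides run over the ordered partitions of S into three possibly empty blocks U, W,
  Y; they differ only in which block is split off first.\<close>

lemma finsum_Pow_assoc:
  assumes "finite S"
    "\<And>U W Y. U \<subseteq> S \<Longrightarrow> W \<subseteq> S \<Longrightarrow> Y \<subseteq> S \<Longrightarrow> F U W Y \<in> carrier R"
  shows "(\<Oplus>T\<in>Pow S. \<Oplus>U\<in>Pow T. F U (T - U) (S - T)) =
    (\<Oplus>U\<in>Pow S. \<Oplus>W\<in>Pow (S - U). F U W (S - U - W))"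
  using assms
proof (induct S arbitrary: F rule: finite_induct)
  case empty
  then show ?case by (simp add: finsum_insert)
next
  case (insert i S)
  have C: "U \<subseteq> insert i S \<Longrightarrow> W \<subseteq> insert i S \<Longrightarrow> Y \<subseteq> insert i S \<Longrightarrow> F U W Y \<in> carrier R" for U W Y
    using insert.prems by blast
  have fin: "finite T" if "T \<subseteq> S" for T using that insert.hyps(1) finite_subset by auto
  have ni: "i \<notin> T" if "T \<subseteq> S" for T using that insert.hyps(2) by auto
  have e1: "insert i T - U = insert i (T - U)" if "T \<subseteq> S" "U \<subseteq> S" for T U
    using that insert.hyps(2) by auto
  have e2: "insert i T - insert i U = T - U" if "T \<subseteq> S" for T U
    using that insert.hyps(2) by auto
  have e3: "T - insert i U = T - U" if "T \<subseteq> S" for T U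
    using that insert.hyps(2) by auto
  \<comment> \<open>The new element i joins the third, second or first block in \<open>?A\<close>,
    \<open>?B\<close>, \<open>?C\<close> respectively. The primed sums are the same for the other
    order of summation.\<close>
  let ?A = "\<Oplus>T\<in>Pow S. \<Oplus>U\<in>Pow T. F U (T - U) (insert i (S - T))"
  let ?B = "\<Oplus>T\<in>Pow S. \<Oplus>U\<in>Pow T. F U (insert i (T - U)) (S - T)"
  let ?C = "\<Oplus>T\<in>Pow S. \<Oplus>U\<in>Pow T. F (insert i U) (T - U) (S - T)"
  let ?A' = "\<Oplus>U\<in>Pow S. \<Oplus>W\<in>Pow (S - U). F U W (insert i (S - U - W))"
  let ?B' = "\<Oplus>U\<in>Pow S. \<Oplus>W\<in>Pow (S - U). F U (insert i W) (S - U - W)"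
  let ?C' = "\<Oplus>U\<in>Pow S. \<Oplus>W\<in>Pow (S - U). F (insert i U) W (S - U - W)"
  have cl: "?A \<in> carrier R" "?B \<in> carrier R" "?C \<in> carrier R"
    "?A' \<in> carrier R" "?B' \<in> carrier R" "?C' \<in> carrier R"
    by (auto intro!: finsum_closed C)
  have "(\<Oplus>T\<in>Pow (insert i S). \<Oplus>U\<in>Pow T. F U (T - U) (insert i S - T)) =
    (\<Oplus>T\<in>Pow S. \<Oplus>U\<in>Pow T. F U (T - U) (insert i S - T)) \<oplus>
    (\<Oplus>T\<in>Pow S. \<Oplus>U\<in>Pow (insert i T). F U (insert i T - U) (insert i S - insert i T))"
    by (rule finsum_Pow_insert) (use insert.hyps in \<open>auto intro!: finsum_closed C\<close>)
  also have "(\<Oplus>T\<in>Pow S. \<Oplus>U\<in>Pow T. F U (T - U) (insert i S - T)) = ?A"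
    by (rule finsum_congI) (auto simp: e1 intro!: finsum_closed C)
  also have "(\<Oplus>T\<in>Pow S. \<Oplus>U\<in>Pow (insert i T). F U (insert i T - U) (insert i S - insert i T)) =
    (\<Oplus>T\<in>Pow S. (\<Oplus>U\<in>Pow T. F U (insert i (T - U)) (S - T)) \<oplus>
       (\<Oplus>U\<in>Pow T. F (insert i U) (T - U) (S - T)))"
  proof (rule finsum_congI)
    fix T assume T: "T \<in> Pow S"
    have "(\<Oplus>U\<in>Pow (insert i T). F U (insert i T - U) (S - T)) =
      (\<Oplus>U\<in>Pow T. F U (insert i T - U) (S - T)) \<oplus>
      (\<Oplus>U\<in>Pow T. F (insert i U) (insert i T - insert i U) (S - T))"
      by (rule finsum_Pow_insert) (use T ni fin in \<open>auto intro!: C\<close>)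
    also have "(\<Oplus>U\<in>Pow T. F U (insert i T - U) (S - T)) = (\<Oplus>U\<in>Pow T. F U (insert i (T - U)) (S - T))"
    proof (rule finsum_congI)
      fix U assume "U \<in> Pow T"
      then have "insert i T - U = insert i (T - U)" using T e1 by blast
      then show "F U (insert i T - U) (S - T) = F U (insert i (T - U)) (S - T)" by (simp only:)
    qed (use T in \<open>auto intro!: C\<close>)
    also have "(\<Oplus>U\<in>Pow T. F (insert i U) (insert i T - insert i U) (S - T)) =
       (\<Oplus>U\<in>Pow T. F (insert i U) (T - U) (S - T))"
    proof (rule finsum_congI)
      fix U assume "U \<in> Pow T"
      then have "insert i T - insert i U = T - U" using T e2 by blast
      then show "F (insert i U) (insert i T - insert i U) (S - T) = F (insert i U) (T - U) (S - T)" by (simp only:)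
    qed (use T in \<open>auto intro!: C\<close>)
    finally show "(\<Oplus>U\<in>Pow (insert i T). F U (insert i T - U) (insert i S - insert i T)) =
      (\<Oplus>U\<in>Pow T. F U (insert i (T - U)) (S - T)) \<oplus> (\<Oplus>U\<in>Pow T. F (insert i U) (T - U) (S - T))"
      by (simp only: e2[OF subset_refl])
  qed (auto intro!: finsum_closed C a_closed)
  also have "\<dots> = ?B \<oplus> ?C"
    by (rule finsum_addf) (auto intro!: finsum_closed C)
  finally have L: "(\<Oplus>T\<in>Pow (insert i S). \<Oplus>U\<in>Pow T. F U (T - U) (insert i S - T)) = ?A \<oplus> (?B \<oplus> ?C)" .
  have "(\<Oplus>U\<in>Pow (insert i S). \<Oplus>W\<in>Pow (insert i S - U). F U W (insert i S - U - W)) =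
    (\<Oplus>U\<in>Pow S. \<Oplus>W\<in>Pow (insert i S - U). F U W (insert i S - U - W)) \<oplus>
    (\<Oplus>U\<in>Pow S. \<Oplus>W\<in>Pow (insert i S - insert i U). F (insert i U) W (insert i S - insert i U - W))"
    by (rule finsum_Pow_insert) (use insert.hyps in \<open>auto intro!: finsum_closed C\<close>)
  also have "(\<Oplus>U\<in>Pow S. \<Oplus>W\<in>Pow (insert i S - insert i U). F (insert i U) W (insert i S - insert i U - W)) = ?C'"
    by (simp only: e2[OF subset_refl])
  also have "(\<Oplus>U\<in>Pow S. \<Oplus>W\<in>Pow (insert i S - U). F U W (insert i S - U - W)) =
    (\<Oplus>U\<in>Pow S. (\<Oplus>W\<in>Pow (S - U). F U W (insert i (S - U - W))) \<oplus>
       (\<Oplus>W\<in>Pow (S - U). F U (insert i W) (S - U - W)))"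
  proof (rule finsum_congI)
    fix U assume U: "U \<in> Pow S"
    have d: "insert i S - U = insert i (S - U)" by (rule e1) (use U in auto)
    have "(\<Oplus>W\<in>Pow (insert i (S - U)). F U W (insert i (S - U) - W)) =
      (\<Oplus>W\<in>Pow (S - U). F U W (insert i (S - U) - W)) \<oplus>
      (\<Oplus>W\<in>Pow (S - U). F U (insert i W) (insert i (S - U) - insert i W))"
      by (rule finsum_Pow_insert) (use U insert.hyps in \<open>auto intro!: C\<close>)
    also have "(\<Oplus>W\<in>Pow (S - U). F U W (insert i (S - U) - W)) = (\<Oplus>W\<in>Pow (S - U). F U W (insert i (S - U - W)))"
    proof (rule finsum_congI)
      fix W assume "W \<in> Pow (S - U)"
      then have "insert i (S - U) - W = insert i (S - U - W)" by (intro e1) auto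
      then show "F U W (insert i (S - U) - W) = F U W (insert i (S - U - W))" by (simp only:)
    qed (use U in \<open>auto intro!: C\<close>)
    also have "(\<Oplus>W\<in>Pow (S - U). F U (insert i W) (insert i (S - U) - insert i W)) =
       (\<Oplus>W\<in>Pow (S - U). F U (insert i W) (S - U - W))"
    proof (rule finsum_congI)
      fix W assume "W \<in> Pow (S - U)"
      then have "insert i (S - U) - insert i W = S - U - W" by (intro e2) auto
      then show "F U (insert i W) (insert i (S - U) - insert i W) = F U (insert i W) (S - U - W)" by (simp only:)
    qed (use U in \<open>auto intro!: C\<close>)
    finally show "(\<Oplus>W\<in>Pow (insert i S - U). F U W (insert i S - U - W)) =
      (\<Oplus>W\<in>Pow (S - U). F U W (insert i (S - U - W))) \<oplus> (\<Oplus>W\<in>Pow (S - U). F U (insert i W) (S - U - W))"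
      by (simp only: d)
  qed (auto intro!: finsum_closed C a_closed)
  also have "\<dots> = ?A' \<oplus> ?B'"
    by (rule finsum_addf) (auto intro!: finsum_closed C)
  finally have M: "(\<Oplus>U\<in>Pow (insert i S). \<Oplus>W\<in>Pow (insert i S - U). F U W (insert i S - U - W)) =
    (?A' \<oplus> ?B') \<oplus> ?C'" .
  \<comment> \<open>F is generalised in the induction, so the hypothesis applies to F with i already
    inserted into one of its arguments.\<close>
  have eA: "?A = ?A'"
    by (rule insert.hyps(3)[of "\<lambda>U W Y. F U W (insert i Y)"]) (auto intro!: C)
  have eB: "?B = ?B'"
    by (rule insert.hyps(3)[of "\<lambda>U W Y. F U (insert i W) Y"]) (auto intro!: C)
  have eC: "?C = ?C'"
    by (rule insert.hyps(3)[of "\<lambda>U W Y. F (insert i U) W Y"]) (auto intro!: C)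
  show ?case
    unfolding L M eA eB eC by (rule a_assoc[symmetric]) (rule cl)+
qed

end

section \<open>The Koszul complex as a ring\<close>

locale koszul_complex = cring A for A (structure) +
  fixes xs :: "'a list"
  assumes xs_closed: "set xs \<subseteq> carrier A"
begin

definition V :: "nat set" where "V = {..<length xs}"

abbreviation K :: "(nat set \<Rightarrow> 'a) dga" where "K \<equiv> koszul A xs"

lemma finite_V [simp]: "finite V"
  by (simp add: V_def)

lemma finite_subset_V: "S \<subseteq> V \<Longrightarrow> finite S"
  using finite_V finite_subset by blast

lemma xs_nth [simp]: "i \<in> V \<Longrightarrow> xs ! i \<in> carrier A"
  using xs_closed nth_mem by (fastforce simp: V_def)

lemma koszul_carrier: "carrier K = Pow V \<rightarrow>\<^sub>E carrier A"
  by (simp add: koszul_def V_def Let_def)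

lemma koszul_mult: "f \<otimes>\<^bsub>K\<^esub> g = (\<lambda>S\<in>Pow V.
    \<Oplus>T\<in>Pow S. koszul_sign A T (S - T) \<otimes> (f T \<otimes> g (S - T)))"
  by (simp add: koszul_def V_def Let_def)

lemma koszul_one: "\<one>\<^bsub>K\<^esub> = (\<lambda>S\<in>Pow V. if S = {} then \<one> else \<zero>)"
  by (simp add: koszul_def V_def Let_def)

lemma koszul_zero: "\<zero>\<^bsub>K\<^esub> = (\<lambda>S\<in>Pow V. \<zero>)"
  by (simp add: koszul_def V_def Let_def)

lemma koszul_add: "f \<oplus>\<^bsub>K\<^esub> g = (\<lambda>S\<in>Pow V. f S \<oplus> g S)"
  by (simp add: koszul_def V_def Let_def)

lemma koszul_piece: "piece K p = {f \<in> carrier K. \<forall>S\<in>Pow V. card S \<noteq> p \<longrightarrow> f S = \<zero>}"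
  by (simp add: koszul_def V_def Let_def)

lemma koszul_diff: "diff K f = (\<lambda>S\<in>Pow V.
    \<Oplus>i\<in>V - S. koszul_sign A {i} S \<otimes> (xs ! i \<otimes> f (insert i S)))"
  by (simp add: koszul_def V_def Let_def)

lemma koszul_sign_closed [simp]: "koszul_sign A S T \<in> carrier A"
  by (simp add: koszul_sign_eq)

lemma coeff_closed: "f \<in> carrier K \<Longrightarrow> S \<subseteq> V \<Longrightarrow> f S \<in> carrier A"
  by (auto simp: koszul_carrier)

lemma koszul_carrierI:
  "(\<And>S. S \<subseteq> V \<Longrightarrow> F S \<in> carrier A) \<Longrightarrow> (\<lambda>S\<in>Pow V. F S) \<in> carrier K"
  by (auto simp: koszul_carrier)

lemma koszul_ext:
  assumes "f \<in> carrier K" "g \<in> carrier K" "\<And>S. S \<subseteq> V \<Longrightarrow> f S = g S"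
  shows "f = g"
  using assms unfolding koszul_carrier by (rule PiE_ext) auto

lemma koszul_mult_coeff:
  "S \<subseteq> V \<Longrightarrow> (f \<otimes>\<^bsub>K\<^esub> g) S = (\<Oplus>T\<in>Pow S. koszul_sign A T (S - T) \<otimes> (f T \<otimes> g (S - T)))"
  by (simp add: koszul_mult)

lemma koszul_add_coeff: "S \<subseteq> V \<Longrightarrow> (f \<oplus>\<^bsub>K\<^esub> g) S = f S \<oplus> g S"
  by (simp add: koszul_add)

lemma koszul_zero_coeff: "S \<subseteq> V \<Longrightarrow> \<zero>\<^bsub>K\<^esub> S = \<zero>"
  by (simp add: koszul_zero)

lemma koszul_one_coeff: "S \<subseteq> V \<Longrightarrow> \<one>\<^bsub>K\<^esub> S = (if S = {} then \<one> else \<zero>)"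
  by (simp add: koszul_one)

lemma koszul_mult_closed:
  assumes "f \<in> carrier K" "g \<in> carrier K"
  shows "f \<otimes>\<^bsub>K\<^esub> g \<in> carrier K"
  unfolding koszul_mult
  by (rule koszul_carrierI, rule finsum_closed) (auto intro!: m_closed coeff_closed[OF assms(1)] coeff_closed[OF assms(2)])

lemma koszul_mult_assoc:
  assumes f: "f \<in> carrier K" and g: "g \<in> carrier K" and h: "h \<in> carrier K"
  shows "f \<otimes>\<^bsub>K\<^esub> g \<otimes>\<^bsub>K\<^esub> h = f \<otimes>\<^bsub>K\<^esub> (g \<otimes>\<^bsub>K\<^esub> h)"
proof (rule koszul_ext)
  fix S assume S: "S \<subseteq> V"
  \<comment> \<open>The exponent counts the inversions between all three pairs of blocks, which does
    not depend on the bracketing; each side of the associative law is reduced to sums of F.\<close>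
  define F where "F U W Y = sg (inversions U W + inversions U Y + inversions W Y) \<otimes> (f U \<otimes> (g W \<otimes> h Y))"
    for U W Y
  have fin: "finite T" if "T \<subseteq> S" for T using that S finite_subset_V by blast
  have cl: "f U \<in> carrier A" "g U \<in> carrier A" "h U \<in> carrier A" if "U \<subseteq> S" for U
    using that S f g h coeff_closed by auto
  have F: "F U W Y \<in> carrier A" if "U \<subseteq> S" "W \<subseteq> S" "Y \<subseteq> S" for U W Y
    unfolding F_def using cl that by simp
  have "(f \<otimes>\<^bsub>K\<^esub> g \<otimes>\<^bsub>K\<^esub> h) S = (\<Oplus>T\<in>Pow S. \<Oplus>U\<in>Pow T. F U (T - U) (S - T))"
    unfolding koszul_mult_coeff[OF S]
  proof (rule finsum_congI)
    fix T assume "T \<in> Pow S"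
    then have T: "T \<subseteq> S" by simp
    have "koszul_sign A T (S - T) \<otimes> ((f \<otimes>\<^bsub>K\<^esub> g) T \<otimes> h (S - T)) =
       koszul_sign A T (S - T) \<otimes> h (S - T) \<otimes> (\<Oplus>U\<in>Pow T. koszul_sign A U (T - U) \<otimes> (f U \<otimes> g (T - U)))"
      using T S cl by (subst koszul_mult_coeff) (auto intro!: finsum_closed m_closed m_comm m_lcomm simp: m_ac subset_iff)
    also have "\<dots> = (\<Oplus>U\<in>Pow T. koszul_sign A T (S - T) \<otimes> h (S - T) \<otimes> (koszul_sign A U (T - U) \<otimes> (f U \<otimes> g (T - U))))"
      by (rule finsum_rdistr) (use T fin cl in \<open>auto intro!: m_closed cl simp: subset_iff\<close>)
    also have "\<dots> = (\<Oplus>U\<in>Pow T. F U (T - U) (S - T))"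
    proof (rule finsum_congI)
      fix U assume "U \<in> Pow T"
      then have U: "U \<subseteq> T" by simp
      have "inversions T (S - T) = inversions U (S - T) + inversions (T - U) (S - T)"
        using inversions_Un_left[of U "T - U" "S - T"] U T fin by (simp add: Un_absorb1)
      moreover have "f U \<in> carrier A" "g (T - U) \<in> carrier A" "h (S - T) \<in> carrier A"
        using U T by (auto intro!: cl)
      ultimately show "koszul_sign A T (S - T) \<otimes> h (S - T) \<otimes> (koszul_sign A U (T - U) \<otimes> (f U \<otimes> g (T - U))) =
        F U (T - U) (S - T)"
        unfolding F_def koszul_sign_eq by (simp add: sg_add m_ac)
    qed (use T in \<open>auto intro!: F\<close>)
    finally show "koszul_sign A T (S - T) \<otimes> ((f \<otimes>\<^bsub>K\<^esub> g) T \<otimes> h (S - T)) = (\<Oplus>U\<in>Pow T. F U (T - U) (S - T))" .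
  qed (auto intro!: finsum_closed F)
  also have "\<dots> = (\<Oplus>U\<in>Pow S. \<Oplus>W\<in>Pow (S - U). F U W (S - U - W))"
    by (rule finsum_Pow_assoc) (use fin F in auto)
  also have "\<dots> = (f \<otimes>\<^bsub>K\<^esub> (g \<otimes>\<^bsub>K\<^esub> h)) S"
    unfolding koszul_mult_coeff[OF S]
  proof (rule finsum_congI[symmetric])
    fix U assume "U \<in> Pow S"
    then have U: "U \<subseteq> S" by simp
    have "koszul_sign A U (S - U) \<otimes> (f U \<otimes> (g \<otimes>\<^bsub>K\<^esub> h) (S - U)) =
       koszul_sign A U (S - U) \<otimes> f U \<otimes> (\<Oplus>W\<in>Pow (S - U). koszul_sign A W (S - U - W) \<otimes> (g W \<otimes> h (S - U - W)))"
      using U S cl by (subst koszul_mult_coeff) (auto intro!: finsum_closed m_closed m_assoc[symmetric] simp: subset_iff)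
    also have "\<dots> = (\<Oplus>W\<in>Pow (S - U). koszul_sign A U (S - U) \<otimes> f U \<otimes> (koszul_sign A W (S - U - W) \<otimes> (g W \<otimes> h (S - U - W))))"
      by (rule finsum_rdistr) (use U fin cl in \<open>auto intro!: m_closed cl simp: subset_iff\<close>)
    also have "\<dots> = (\<Oplus>W\<in>Pow (S - U). F U W (S - U - W))"
    proof (rule finsum_congI)
      fix W assume "W \<in> Pow (S - U)"
      then have W: "W \<subseteq> S - U" by simp
      have "inversions U (S - U) = inversions U W + inversions U (S - U - W)"
        using inversions_Un_right[of U W "S - U - W"] W fin[OF U] fin[of W] fin[of S]
        by (simp add: Un_absorb1 Diff_subset subset_trans[of W "S - U" S])
      moreover have "f U \<in> carrier A" "g W \<in> carrier A" "h (S - U - W) \<in> carrier A"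
        using U W by (auto intro!: cl)
      ultimately show "koszul_sign A U (S - U) \<otimes> f U \<otimes> (koszul_sign A W (S - U - W) \<otimes> (g W \<otimes> h (S - U - W))) =
        F U W (S - U - W)"
        unfolding F_def koszul_sign_eq by (simp add: sg_add m_ac)
    qed (use U in \<open>auto intro!: F\<close>)
    finally show "koszul_sign A U (S - U) \<otimes> (f U \<otimes> (g \<otimes>\<^bsub>K\<^esub> h) (S - U)) = (\<Oplus>W\<in>Pow (S - U). F U W (S - U - W))" .
  qed (auto intro!: finsum_closed F)
  finally show "(f \<otimes>\<^bsub>K\<^esub> g \<otimes>\<^bsub>K\<^esub> h) S = (f \<otimes>\<^bsub>K\<^esub> (g \<otimes>\<^bsub>K\<^esub> h)) S" .
qed (use f g h koszul_mult_closed in auto)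

definition scalar :: "'a \<Rightarrow> nat set \<Rightarrow> 'a"
  where "scalar r = (\<lambda>S\<in>Pow V. if S = {} then r else \<zero>)"

lemma scalar_closed [simp]: "r \<in> carrier A \<Longrightarrow> scalar r \<in> carrier K"
  unfolding scalar_def by (rule koszul_carrierI) auto

lemma scalar_coeff: "S \<subseteq> V \<Longrightarrow> scalar r S = (if S = {} then r else \<zero>)"
  by (simp add: scalar_def)

lemma scalar_mult_coeff:
  assumes "r \<in> carrier A" "f \<in> carrier K" "S \<subseteq> V"
  shows "(scalar r \<otimes>\<^bsub>K\<^esub> f) S = r \<otimes> f S"
proof -
  have cl: "f U \<in> carrier A" if "U \<subseteq> S" for U
    using that assms coeff_closed by auto
  have "(scalar r \<otimes>\<^bsub>K\<^esub> f) S = (\<Oplus>T\<in>Pow S. if {} = T then r \<otimes> f (S - T) else \<zero>)"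
    unfolding koszul_mult_coeff[OF assms(3)]
  proof (rule finsum_congI)
    fix T assume "T \<in> Pow S"
    then have "f (S - T) \<in> carrier A" "T \<subseteq> V" using cl assms(3) by auto
    then show "koszul_sign A T (S - T) \<otimes> (scalar r T \<otimes> f (S - T)) = (if {} = T then r \<otimes> f (S - T) else \<zero>)"
      using assms(1) by (auto simp: scalar_coeff koszul_sign_eq)
  qed (use assms cl in auto)
  also have "\<dots> = r \<otimes> f (S - {})"
    by (rule finsum_singleton) (use assms cl finite_subset_V in auto)
  finally show ?thesis by simp
qed

lemma mult_scalar_coeff:
  assumes "r \<in> carrier A" "f \<in> carrier K" "S \<subseteq> V"
  shows "(f \<otimes>\<^bsub>K\<^esub> scalar r) S = r \<otimes> f S"
proof -
  have cl: "f U \<in> carrier A" if "U \<subseteq> S" for U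
    using that assms coeff_closed by auto
  have "(f \<otimes>\<^bsub>K\<^esub> scalar r) S = (\<Oplus>T\<in>Pow S. if S = T then r \<otimes> f T else \<zero>)"
    unfolding koszul_mult_coeff[OF assms(3)]
  proof (rule finsum_congI)
    fix T assume T: "T \<in> Pow S"
    then have "f T \<in> carrier A" "S - T \<subseteq> V" "S - T = {} \<longleftrightarrow> S = T" using cl assms(3) by auto
    then show "koszul_sign A T (S - T) \<otimes> (f T \<otimes> scalar r (S - T)) = (if S = T then r \<otimes> f T else \<zero>)"
      using assms(1) by (simp add: scalar_coeff koszul_sign_eq m_comm)
  qed (use assms cl in auto)
  also have "\<dots> = r \<otimes> f S"
    by (rule finsum_singleton) (use assms cl finite_subset_V in auto)
  finally show ?thesis .
qed

lemma koszul_one_scalar: "\<one>\<^bsub>K\<^esub> = scalar \<one>"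
  by (simp add: koszul_one scalar_def)

lemma scalar_comm:
  assumes "r \<in> carrier A" "f \<in> carrier K"
  shows "scalar r \<otimes>\<^bsub>K\<^esub> f = f \<otimes>\<^bsub>K\<^esub> scalar r"
  using assms by (intro koszul_ext) (auto intro!: koszul_mult_closed simp: scalar_mult_coeff mult_scalar_coeff)

lemma koszul_ring: "ring K"
proof (rule ringI)
  show "abelian_group K"
  proof (rule abelian_groupI)
    fix f assume f: "f \<in> carrier K"
    have "(\<lambda>S\<in>Pow V. \<ominus> f S) \<in> carrier K"
      using f by (intro koszul_carrierI) (auto intro: coeff_closed)
    moreover have "(\<lambda>S\<in>Pow V. \<ominus> f S) \<oplus>\<^bsub>K\<^esub> f = \<zero>\<^bsub>K\<^esub>"
      unfolding koszul_add koszul_zero using f by (intro restrict_ext) (auto simp: coeff_closed l_neg)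
    ultimately show "\<exists>g\<in>carrier K. g \<oplus>\<^bsub>K\<^esub> f = \<zero>\<^bsub>K\<^esub>" by blast
    show "\<zero>\<^bsub>K\<^esub> \<oplus>\<^bsub>K\<^esub> f = f"
    proof (rule koszul_ext)
      show "\<zero>\<^bsub>K\<^esub> \<oplus>\<^bsub>K\<^esub> f \<in> carrier K"
        unfolding koszul_add koszul_zero by (rule koszul_carrierI) (simp add: coeff_closed f)
    qed (simp_all add: f koszul_add koszul_zero coeff_closed)
  next
    fix f g assume f: "f \<in> carrier K" "g \<in> carrier K"
    show "f \<oplus>\<^bsub>K\<^esub> g \<in> carrier K"
      unfolding koszul_add by (intro koszul_carrierI) (auto intro: coeff_closed f)
    show "f \<oplus>\<^bsub>K\<^esub> g = g \<oplus>\<^bsub>K\<^esub> f"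
      unfolding koszul_add by (intro restrict_ext) (auto intro!: a_comm coeff_closed f)
  next
    fix f g h assume f: "f \<in> carrier K" "g \<in> carrier K" "h \<in> carrier K"
    show "f \<oplus>\<^bsub>K\<^esub> g \<oplus>\<^bsub>K\<^esub> h = f \<oplus>\<^bsub>K\<^esub> (g \<oplus>\<^bsub>K\<^esub> h)"
      unfolding koszul_add by (intro restrict_ext) (auto intro!: a_assoc coeff_closed f)
  next
    show "\<zero>\<^bsub>K\<^esub> \<in> carrier K"
      unfolding koszul_zero by (rule koszul_carrierI) simp
  qed
  then interpret K: abelian_group K .
  show "monoid K"
  proof (rule monoidI)
    fix f assume f: "f \<in> carrier K"
    show "\<one>\<^bsub>K\<^esub> \<otimes>\<^bsub>K\<^esub> f = f" "f \<otimes>\<^bsub>K\<^esub> \<one>\<^bsub>K\<^esub> = f"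
      unfolding koszul_one_scalar using f coeff_closed[OF f]
      by (auto intro!: koszul_ext koszul_mult_closed simp: scalar_mult_coeff mult_scalar_coeff)
  qed (auto simp: koszul_one_scalar intro: koszul_mult_closed koszul_mult_assoc)
  fix f g h assume f: "f \<in> carrier K" and g: "g \<in> carrier K" and h: "h \<in> carrier K"
  show "(f \<oplus>\<^bsub>K\<^esub> g) \<otimes>\<^bsub>K\<^esub> h = f \<otimes>\<^bsub>K\<^esub> h \<oplus>\<^bsub>K\<^esub> g \<otimes>\<^bsub>K\<^esub> h"
  proof (rule koszul_ext)
    fix S assume S: "S \<subseteq> V"
    have cl: "f U \<in> carrier A" "g U \<in> carrier A" "h U \<in> carrier A" "U \<subseteq> V" if "U \<subseteq> S" for U
      using that S f g h coeff_closed by auto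
    have "((f \<oplus>\<^bsub>K\<^esub> g) \<otimes>\<^bsub>K\<^esub> h) S = (\<Oplus>T\<in>Pow S. koszul_sign A T (S - T) \<otimes> (f T \<otimes> h (S - T)) \<oplus>
        koszul_sign A T (S - T) \<otimes> (g T \<otimes> h (S - T)))"
      unfolding koszul_mult_coeff[OF S]
    proof (rule finsum_congI)
      fix T assume T: "T \<in> Pow S"
      show "koszul_sign A T (S - T) \<otimes> ((f \<oplus>\<^bsub>K\<^esub> g) T \<otimes> h (S - T)) =
        koszul_sign A T (S - T) \<otimes> (f T \<otimes> h (S - T)) \<oplus> koszul_sign A T (S - T) \<otimes> (g T \<otimes> h (S - T))"
        using T by (simp add: koszul_add_coeff cl l_distr r_distr Diff_subset)
    qed (auto intro!: a_closed m_closed cl)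
    also have "\<dots> = (f \<otimes>\<^bsub>K\<^esub> h \<oplus>\<^bsub>K\<^esub> g \<otimes>\<^bsub>K\<^esub> h) S"
      unfolding koszul_add_coeff[OF S] koszul_mult_coeff[OF S]
      by (rule finsum_addf) (auto intro!: m_closed cl)
    finally show "((f \<oplus>\<^bsub>K\<^esub> g) \<otimes>\<^bsub>K\<^esub> h) S = (f \<otimes>\<^bsub>K\<^esub> h \<oplus>\<^bsub>K\<^esub> g \<otimes>\<^bsub>K\<^esub> h) S" .
  qed (use f g h koszul_mult_closed in auto)
  show "h \<otimes>\<^bsub>K\<^esub> (f \<oplus>\<^bsub>K\<^esub> g) = h \<otimes>\<^bsub>K\<^esub> f \<oplus>\<^bsub>K\<^esub> h \<otimes>\<^bsub>K\<^esub> g"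
  proof (rule koszul_ext)
    fix S assume S: "S \<subseteq> V"
    have cl: "f U \<in> carrier A" "g U \<in> carrier A" "h U \<in> carrier A" "U \<subseteq> V" if "U \<subseteq> S" for U
      using that S f g h coeff_closed by auto
    have "(h \<otimes>\<^bsub>K\<^esub> (f \<oplus>\<^bsub>K\<^esub> g)) S = (\<Oplus>T\<in>Pow S. koszul_sign A T (S - T) \<otimes> (h T \<otimes> f (S - T)) \<oplus>
        koszul_sign A T (S - T) \<otimes> (h T \<otimes> g (S - T)))"
      unfolding koszul_mult_coeff[OF S]
    proof (rule finsum_congI)
      fix T assume T: "T \<in> Pow S"
      show "koszul_sign A T (S - T) \<otimes> (h T \<otimes> (f \<oplus>\<^bsub>K\<^esub> g) (S - T)) =
        koszul_sign A T (S - T) \<otimes> (h T \<otimes> f (S - T)) \<oplus> koszul_sign A T (S - T) \<otimes> (h T \<otimes> g (S - T))"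
        using T by (simp add: koszul_add_coeff cl l_distr r_distr Diff_subset)
    qed (auto intro!: a_closed m_closed cl)
    also have "\<dots> = (h \<otimes>\<^bsub>K\<^esub> f \<oplus>\<^bsub>K\<^esub> h \<otimes>\<^bsub>K\<^esub> g) S"
      unfolding koszul_add_coeff[OF S] koszul_mult_coeff[OF S]
      by (rule finsum_addf) (auto intro!: m_closed cl)
    finally show "(h \<otimes>\<^bsub>K\<^esub> (f \<oplus>\<^bsub>K\<^esub> g)) S = (h \<otimes>\<^bsub>K\<^esub> f \<oplus>\<^bsub>K\<^esub> h \<otimes>\<^bsub>K\<^esub> g) S" .
  qed (use f g h koszul_mult_closed in auto)
qed

end

section \<open>Contractions as skew derivations\<close>

context koszul_complex
begin

interpretation K: ring K by (rule koszul_ring)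

definition involution :: "(nat set \<Rightarrow> 'a) \<Rightarrow> nat set \<Rightarrow> 'a"
  where "involution f = (\<lambda>S\<in>Pow V. sg (card S) \<otimes> f S)"

text \<open>The interior product with the i-th dual basis vector. The Koszul differential is the
  combination of these contractions with coefficients \<open>xs ! i\<close>, so its Leibniz rule and
  d d = 0 reduce to statements about one or two indices.\<close>

definition partial :: "nat \<Rightarrow> (nat set \<Rightarrow> 'a) \<Rightarrow> nat set \<Rightarrow> 'a"
  where "partial i f = (\<lambda>S\<in>Pow V. if i \<in> S then \<zero> else koszul_sign A {i} S \<otimes> f (insert i S))"

lemma involution_closed [simp]: "f \<in> carrier K \<Longrightarrow> involution f \<in> carrier K"
  unfolding involution_def by (rule koszul_carrierI) (simp add: coeff_closed)

lemma partial_closed [simp]: "i \<in> V \<Longrightarrow> f \<in> carrier K \<Longrightarrow> partial i f \<in> carrier K"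
  unfolding partial_def by (rule koszul_carrierI) (simp add: coeff_closed)

text \<open>The contraction either hits the first factor or passes it, at the cost of one sign for
  each basis vector passed.\<close>

lemma partial_mult:
  assumes i: "i \<in> V" and f: "f \<in> carrier K" and g: "g \<in> carrier K" and S: "S \<subseteq> V"
  shows "partial i (f \<otimes>\<^bsub>K\<^esub> g) S = (partial i f \<otimes>\<^bsub>K\<^esub> g) S \<oplus> (involution f \<otimes>\<^bsub>K\<^esub> partial i g) S"
proof -
  have cl: "f U \<in> carrier A" "g U \<in> carrier A" if "U \<subseteq> V" for U
    using that f g coeff_closed by auto
  have pcl: "partial i f U \<in> carrier A" "partial i g U \<in> carrier A" "involution f U \<in> carrier A" if "U \<subseteq> V" for U
    using that i f g by (auto intro!: coeff_closed)
  have sub: "insert i U \<subseteq> V" if "U \<subseteq> V" for U using i that by simp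
  define c where "c T U = koszul_sign A T U" for T U
  have c [simp]: "c T U \<in> carrier A" for T U by (simp add: c_def)
  have fV: "finite U" if "U \<subseteq> V" for U using that by (rule finite_subset_V)
  show ?thesis
  proof (cases "i \<in> S")
    \<comment> \<open>The terms of the product at \<open>insert i S\<close> are split by the factor
      that holds e_i. If it is the second one, e_i has to pass e_T, which accounts for
      \<open>involution f\<close>.\<close>
    case False
    have sd: "S - T \<subseteq> V" "insert i (S - T) \<subseteq> V" "finite T" "finite (S - T)" "T \<subseteq> V" "insert i T \<subseteq> V" "i \<notin> T" "i \<notin> S - T"
      if "T \<in> Pow S" for T using that S i False fV by auto
    have "partial i (f \<otimes>\<^bsub>K\<^esub> g) S = c {i} S \<otimes> (f \<otimes>\<^bsub>K\<^esub> g) (insert i S)"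
      using S False by (simp add: partial_def c_def)
    also have "(f \<otimes>\<^bsub>K\<^esub> g) (insert i S) =
       (\<Oplus>T\<in>Pow S. c T (insert i S - T) \<otimes> (f T \<otimes> g (insert i S - T))) \<oplus>
       (\<Oplus>T\<in>Pow S. c (insert i T) (insert i S - insert i T) \<otimes> (f (insert i T) \<otimes> g (insert i S - insert i T)))"
      unfolding koszul_mult_coeff[OF sub[OF S]] c_def[symmetric]
      by (rule finsum_Pow_insert) (use S i False fV in \<open>auto intro!: cl m_closed\<close>)
    also have "c {i} S \<otimes> \<dots> =
       (\<Oplus>T\<in>Pow S. c {i} S \<otimes> (c T (insert i S - T) \<otimes> (f T \<otimes> g (insert i S - T)))) \<oplus>
       (\<Oplus>T\<in>Pow S. c {i} S \<otimes> (c (insert i T) (insert i S - insert i T) \<otimes> (f (insert i T) \<otimes> g (insert i S - insert i T))))"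
      by (rule finsum_rdistr_add) (use S i fV sd in \<open>auto intro!: cl m_closed\<close>)
    also have "(\<Oplus>T\<in>Pow S. c {i} S \<otimes> (c T (insert i S - T) \<otimes> (f T \<otimes> g (insert i S - T)))) = (involution f \<otimes>\<^bsub>K\<^esub> partial i g) S"
      unfolding koszul_mult_coeff[OF S]
    proof (rule finsum_congI)
      fix T assume T: "T \<in> Pow S"
      have e: "insert i S - T = insert i (S - T)" using T False by auto
      have e2: "S = T \<union> (S - T)" using T by auto
      have s1: "inversions {i} S = inversions {i} T + inversions {i} (S - T)"
        by (subst e2, rule inversions_Un_right) (use sd[OF T] in auto)
      have s2: "inversions T (insert i (S - T)) = inversions T {i} + inversions T (S - T)"
        by (rule inversions_insert_right) (use sd[OF T] in auto)
      have s3: "inversions {i} T + inversions T {i} = card T"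
        by (rule inversions_singleton_add) (use sd[OF T] in auto)
      have "c {i} S \<otimes> c T (insert i S - T) = sg (inversions {i} S + inversions T (insert i (S - T)))"
        by (simp add: c_def koszul_sign_eq sg_add e)
      also have "\<dots> = sg (inversions T (S - T) + card T + inversions {i} (S - T))"
        by (rule sg_cong) (simp only: s1 s2 s3[symmetric], presburger)
      finally have sgn: "c {i} S \<otimes> c T (insert i S - T) = c T (S - T) \<otimes> sg (card T) \<otimes> c {i} (S - T)"
        by (simp add: c_def koszul_sign_eq sg_add)
      have fg: "f T \<in> carrier A" "g (insert i (S - T)) \<in> carrier A" using sd[OF T] cl by auto
      have "c {i} S \<otimes> (c T (insert i S - T) \<otimes> (f T \<otimes> g (insert i S - T))) =
        (c {i} S \<otimes> c T (insert i S - T)) \<otimes> (f T \<otimes> g (insert i (S - T)))"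
        using fg by (simp add: e m_assoc)
      also have "\<dots> = koszul_sign A T (S - T) \<otimes> (involution f T \<otimes> partial i g (S - T))"
        unfolding sgn using fg sd[OF T] by (simp add: involution_def partial_def c_def m_ac)
      finally show "c {i} S \<otimes> (c T (insert i S - T) \<otimes> (f T \<otimes> g (insert i S - T))) =
        koszul_sign A T (S - T) \<otimes> (involution f T \<otimes> partial i g (S - T))" .
    qed (use sd pcl in auto)
    also have "(\<Oplus>T\<in>Pow S. c {i} S \<otimes> (c (insert i T) (insert i S - insert i T) \<otimes> (f (insert i T) \<otimes> g (insert i S - insert i T)))) =
       (partial i f \<otimes>\<^bsub>K\<^esub> g) S"
      unfolding koszul_mult_coeff[OF S]
    proof (rule finsum_congI)
      fix T assume T: "T \<in> Pow S"
      have e: "insert i S - insert i T = S - T" using T False by auto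
      have e2: "S = T \<union> (S - T)" using T by auto
      have s1: "inversions {i} S = inversions {i} T + inversions {i} (S - T)"
        by (subst e2, rule inversions_Un_right) (use sd[OF T] in auto)
      have s2: "inversions (insert i T) (S - T) = inversions {i} (S - T) + inversions T (S - T)"
        by (rule inversions_insert_left) (use sd[OF T] in auto)
      have "c {i} S \<otimes> c (insert i T) (S - T) = sg (inversions {i} S + inversions (insert i T) (S - T))"
        by (simp add: c_def koszul_sign_eq sg_add)
      also have "\<dots> = sg (inversions T (S - T) + inversions {i} T)"
        by (rule sg_cong) (simp only: s1 s2, presburger)
      finally have sgn: "c {i} S \<otimes> c (insert i T) (S - T) = c T (S - T) \<otimes> c {i} T"
        by (simp add: c_def koszul_sign_eq sg_add)
      have fg: "f (insert i T) \<in> carrier A" "g (S - T) \<in> carrier A" using sd[OF T] cl by auto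
      have "c {i} S \<otimes> (c (insert i T) (insert i S - insert i T) \<otimes> (f (insert i T) \<otimes> g (insert i S - insert i T))) =
        (c {i} S \<otimes> c (insert i T) (S - T)) \<otimes> (f (insert i T) \<otimes> g (S - T))"
        unfolding e using fg by (simp add: m_assoc)
      also have "\<dots> = koszul_sign A T (S - T) \<otimes> (partial i f T \<otimes> g (S - T))"
        unfolding sgn using fg sd[OF T] by (simp add: partial_def c_def m_ac)
      finally show "c {i} S \<otimes> (c (insert i T) (insert i S - insert i T) \<otimes> (f (insert i T) \<otimes> g (insert i S - insert i T))) =
        koszul_sign A T (S - T) \<otimes> (partial i f T \<otimes> g (S - T))" .
    qed (use sd pcl cl in auto)
    finally show ?thesis
      using S i f g by (simp add: a_comm coeff_closed)
  next
    \<comment> \<open>A contraction has no component containing e_i, so the left side is zero. On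
      the right both products yield the same terms, with opposite signs because
      \<open>insert i T\<close> has one element more than T.\<close>
    case True
    define S0 where "S0 = S - {i}"
    have S0: "S = insert i S0" "i \<notin> S0" "S0 \<subseteq> V" "finite S0" using True S fV by (auto simp: S0_def)
    have sd: "S0 - T \<subseteq> V" "insert i (S0 - T) \<subseteq> V" "finite T" "finite (S0 - T)" "T \<subseteq> V" "insert i T \<subseteq> V" "i \<notin> T" "i \<notin> S0 - T"
      "insert i S0 - T = insert i (S0 - T)" "insert i S0 - insert i T = S0 - T"
      if "T \<in> Pow S0" for T using that S0 i fV by auto
    have "(partial i f \<otimes>\<^bsub>K\<^esub> g) S =
       (\<Oplus>T\<in>Pow S0. c T (insert i S0 - T) \<otimes> (partial i f T \<otimes> g (insert i S0 - T))) \<oplus>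
       (\<Oplus>T\<in>Pow S0. c (insert i T) (insert i S0 - insert i T) \<otimes> (partial i f (insert i T) \<otimes> g (insert i S0 - insert i T)))"
      unfolding S0(1) koszul_mult_coeff[OF S[unfolded S0(1)]] c_def[symmetric]
      by (rule finsum_Pow_insert) (use S0 i in \<open>auto intro!: cl pcl m_closed\<close>)
    also have "(\<Oplus>T\<in>Pow S0. c T (insert i S0 - T) \<otimes> (partial i f T \<otimes> g (insert i S0 - T))) =
      (\<Oplus>T\<in>Pow S0. sg (card T) \<otimes> c T (S0 - T) \<otimes> (f (insert i T) \<otimes> g (insert i (S0 - T))))" (is "_ = ?X")
    proof (rule finsum_congI)
      fix T assume T: "T \<in> Pow S0"
      have s2: "inversions T (insert i (S0 - T)) = inversions T {i} + inversions T (S0 - T)"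
        by (rule inversions_insert_right) (use sd[OF T] in auto)
      have s3: "inversions {i} T + inversions T {i} = card T"
        by (rule inversions_singleton_add) (use sd[OF T] in auto)
      have sgn: "c T (insert i (S0 - T)) \<otimes> c {i} T = sg (card T) \<otimes> c T (S0 - T)"
        unfolding c_def koszul_sign_eq sg_add[symmetric] s2 s3[symmetric] by (rule arg_cong[of _ _ sg]) simp
      have fg: "f (insert i T) \<in> carrier A" "g (insert i (S0 - T)) \<in> carrier A" using sd[OF T] cl by auto
      have "c T (insert i S0 - T) \<otimes> (partial i f T \<otimes> g (insert i S0 - T)) =
        (c T (insert i (S0 - T)) \<otimes> c {i} T) \<otimes> (f (insert i T) \<otimes> g (insert i (S0 - T)))"
        using fg sd[OF T] by (simp add: partial_def c_def m_ac)
      then show "c T (insert i S0 - T) \<otimes> (partial i f T \<otimes> g (insert i S0 - T)) =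
         sg (card T) \<otimes> c T (S0 - T) \<otimes> (f (insert i T) \<otimes> g (insert i (S0 - T)))"
        unfolding sgn .
    qed (use sd cl in auto)
    also have "(\<Oplus>T\<in>Pow S0. c (insert i T) (insert i S0 - insert i T) \<otimes> (partial i f (insert i T) \<otimes> g (insert i S0 - insert i T))) = (\<Oplus>T\<in>Pow S0. \<zero>)"
      by (rule finsum_congI) (use sd cl in \<open>auto simp: partial_def\<close>)
    finally have L: "(partial i f \<otimes>\<^bsub>K\<^esub> g) S = ?X \<oplus> (\<Oplus>T\<in>Pow S0. \<zero>)" .
    have "(involution f \<otimes>\<^bsub>K\<^esub> partial i g) S =
       (\<Oplus>T\<in>Pow S0. c T (insert i S0 - T) \<otimes> (involution f T \<otimes> partial i g (insert i S0 - T))) \<oplus>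
       (\<Oplus>T\<in>Pow S0. c (insert i T) (insert i S0 - insert i T) \<otimes> (involution f (insert i T) \<otimes> partial i g (insert i S0 - insert i T)))"
      unfolding S0(1) koszul_mult_coeff[OF S[unfolded S0(1)]] c_def[symmetric]
      by (rule finsum_Pow_insert) (use S0 i in \<open>auto intro!: cl pcl m_closed\<close>)
    also have "(\<Oplus>T\<in>Pow S0. c T (insert i S0 - T) \<otimes> (involution f T \<otimes> partial i g (insert i S0 - T))) = (\<Oplus>T\<in>Pow S0. \<zero>)"
      by (rule finsum_congI) (use sd pcl in \<open>auto simp: partial_def\<close>)
    also have "(\<Oplus>T\<in>Pow S0. c (insert i T) (insert i S0 - insert i T) \<otimes> (involution f (insert i T) \<otimes> partial i g (insert i S0 - insert i T))) =
      (\<Oplus>T\<in>Pow S0. \<ominus> (sg (card T) \<otimes> c T (S0 - T) \<otimes> (f (insert i T) \<otimes> g (insert i (S0 - T)))))" (is "_ = ?Y")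
    proof (rule finsum_congI)
      fix T assume T: "T \<in> Pow S0"
      have s2: "inversions (insert i T) (S0 - T) = inversions {i} (S0 - T) + inversions T (S0 - T)"
        by (rule inversions_insert_left) (use sd[OF T] in auto)
      have "c (insert i T) (S0 - T) \<otimes> sg (card (insert i T)) \<otimes> c {i} (S0 - T) =
         sg (inversions (insert i T) (S0 - T) + card (insert i T) + inversions {i} (S0 - T))"
        by (simp add: c_def koszul_sign_eq sg_add)
      also have "\<dots> = sg (Suc (card T + inversions T (S0 - T)))"
        unfolding s2 card_insert_disjoint[OF sd(3)[OF T] sd(7)[OF T]] by (rule sg_cong) presburger
      finally have sgn: "c (insert i T) (S0 - T) \<otimes> sg (card (insert i T)) \<otimes> c {i} (S0 - T) =
         \<ominus> (sg (card T) \<otimes> c T (S0 - T))"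
        by (simp add: c_def koszul_sign_eq sg_add sg_Suc)
      have fg: "f (insert i T) \<in> carrier A" "g (insert i (S0 - T)) \<in> carrier A" using sd[OF T] cl by auto
      have "c (insert i T) (insert i S0 - insert i T) \<otimes> (involution f (insert i T) \<otimes> partial i g (insert i S0 - insert i T)) =
        (c (insert i T) (S0 - T) \<otimes> sg (card (insert i T)) \<otimes> c {i} (S0 - T)) \<otimes> (f (insert i T) \<otimes> g (insert i (S0 - T)))"
        using fg sd[OF T] by (simp add: partial_def involution_def c_def m_ac)
      then show "c (insert i T) (insert i S0 - insert i T) \<otimes> (involution f (insert i T) \<otimes> partial i g (insert i S0 - insert i T)) =
         \<ominus> (sg (card T) \<otimes> c T (S0 - T) \<otimes> (f (insert i T) \<otimes> g (insert i (S0 - T))))"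
        unfolding sgn using fg by (simp add: l_minus)
    qed (use sd cl in auto)
    finally have M: "(involution f \<otimes>\<^bsub>K\<^esub> partial i g) S = (\<Oplus>T\<in>Pow S0. \<zero>) \<oplus> ?Y" .
    have XY: "?X \<oplus> ?Y = \<zero>"
    proof -
      have "?X \<oplus> ?Y = (\<Oplus>T\<in>Pow S0. sg (card T) \<otimes> c T (S0 - T) \<otimes> (f (insert i T) \<otimes> g (insert i (S0 - T))) \<oplus>
         \<ominus> (sg (card T) \<otimes> c T (S0 - T) \<otimes> (f (insert i T) \<otimes> g (insert i (S0 - T)))))"
        by (rule finsum_addf[symmetric]) (use sd cl in auto)
      also have "\<dots> = (\<Oplus>T\<in>Pow S0. \<zero>)"
        by (rule finsum_congI) (use sd cl in \<open>auto simp: r_neg\<close>)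
      finally show ?thesis by simp
    qed
    have "?X \<in> carrier A" "?Y \<in> carrier A" using sd cl by (auto intro!: finsum_closed)
    then show ?thesis
      unfolding L M using XY S True by (simp add: partial_def)
  qed
qed

end

section \<open>The Koszul complex as a DG-algebra\<close>

text \<open>Off-diagonal terms cancel in pairs; the induction removes the row and the column of one
  index. The diagonal needs its own assumption, since antisymmetry alone would only give that twice
  a diagonal term is zero.\<close>

lemma (in cring) finsum_antisym:
  assumes "finite S"
    "\<And>i j. i \<in> S \<Longrightarrow> j \<in> S \<Longrightarrow> a i j \<in> carrier R"
    "\<And>i. i \<in> S \<Longrightarrow> a i i = \<zero>"
    "\<And>i j. i \<in> S \<Longrightarrow> j \<in> S \<Longrightarrow> i \<noteq> j \<Longrightarrow> a i j \<oplus> a j i = \<zero>"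
  shows "(\<Oplus>i\<in>S. \<Oplus>j\<in>S. a i j) = \<zero>"
  using assms
proof (induct S rule: finite_induct)
  case (insert k S)
  have cl: "a i j \<in> carrier R" if "i \<in> insert k S" "j \<in> insert k S" for i j
    using insert.prems(1) that by blast
  have "(\<Oplus>i\<in>insert k S. \<Oplus>j\<in>insert k S. a i j) =
     (\<Oplus>j\<in>insert k S. a k j) \<oplus> (\<Oplus>i\<in>S. \<Oplus>j\<in>insert k S. a i j)"
    by (rule finsum_insert) (use insert.hyps in \<open>auto intro!: finsum_closed cl\<close>)
  also have "(\<Oplus>j\<in>insert k S. a k j) = a k k \<oplus> (\<Oplus>j\<in>S. a k j)"
    by (rule finsum_insert) (use insert.hyps in \<open>auto intro!: cl\<close>)
  also have "(\<Oplus>i\<in>S. \<Oplus>j\<in>insert k S. a i j) = (\<Oplus>i\<in>S. a i k \<oplus> (\<Oplus>j\<in>S. a i j))"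
  proof (rule finsum_congI)
    fix i assume "i \<in> S"
    then show "(\<Oplus>j\<in>insert k S. a i j) = a i k \<oplus> (\<Oplus>j\<in>S. a i j)"
      by (intro finsum_insert) (use insert.hyps in \<open>auto intro!: cl\<close>)
  qed (auto intro!: a_closed finsum_closed cl)
  also have "\<dots> = (\<Oplus>i\<in>S. a i k) \<oplus> (\<Oplus>i\<in>S. \<Oplus>j\<in>S. a i j)"
    by (rule finsum_addf) (auto intro!: finsum_closed cl)
  also have "(\<Oplus>i\<in>S. \<Oplus>j\<in>S. a i j) = \<zero>"
    by (rule insert.hyps(3)) (use insert.prems in auto)
  also have "a k k = \<zero>" using insert.prems by auto
  also have "\<zero> \<oplus> (\<Oplus>j\<in>S. a k j) \<oplus> ((\<Oplus>i\<in>S. a i k) \<oplus> \<zero>) = (\<Oplus>j\<in>S. a k j) \<oplus> (\<Oplus>i\<in>S. a i k)"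
    by (simp add: finsum_closed cl)
  also have "\<dots> = (\<Oplus>j\<in>S. a k j \<oplus> a j k)"
    by (rule finsum_addf[symmetric]) (auto intro!: cl)
  also have "\<dots> = (\<Oplus>j\<in>S. \<zero>)"
  proof (rule finsum_congI)
    fix j assume "j \<in> S"
    then show "a k j \<oplus> a j k = \<zero>" using insert.hyps(2) by (intro insert.prems(3)) auto
  qed simp
  finally show ?case by simp
qed simp

text \<open>The map \<open>\<sigma>\<close> stands for \<open>a \<mapsto> (-1)\<^bsup>|a|\<^esup> a\<close>, extended additively, so that the Leibniz rule needs no
  homogeneity.\<close>

locale dg_ring = ring B for B :: "('b, 'm) dga_scheme" (structure) +
  fixes \<sigma> :: "'b \<Rightarrow> 'b"
  assumes diff_closed [simp]: "a \<in> carrier B \<Longrightarrow> diff B a \<in> carrier B"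
    and \<sigma>_closed [simp]: "a \<in> carrier B \<Longrightarrow> \<sigma> a \<in> carrier B"
    and \<sigma>_zero [simp]: "\<sigma> \<zero> = \<zero>"
    and \<sigma>_\<sigma> [simp]: "a \<in> carrier B \<Longrightarrow> \<sigma> (\<sigma> a) = a"
    and diff_\<sigma>: "a \<in> carrier B \<Longrightarrow> diff B (\<sigma> a) = \<ominus> \<sigma> (diff B a)"
    and diff_add: "a \<in> carrier B \<Longrightarrow> b \<in> carrier B \<Longrightarrow> diff B (a \<oplus> b) = diff B a \<oplus> diff B b"
    and diff_one [simp]: "diff B \<one> = \<zero>"
    and diff_diff [simp]: "a \<in> carrier B \<Longrightarrow> diff B (diff B a) = \<zero>"
    and diff_mult: "a \<in> carrier B \<Longrightarrow> b \<in> carrier B \<Longrightarrow>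
      diff B (a \<otimes> b) = diff B a \<otimes> b \<oplus> \<sigma> a \<otimes> diff B b"
    and piece_closed: "piece B i \<subseteq> carrier B"
    and piece_zero: "\<zero> \<in> piece B i"
    and piece_0_central: "a \<in> piece B 0 \<Longrightarrow> b \<in> carrier B \<Longrightarrow> a \<otimes> b = b \<otimes> a"

context koszul_complex
begin

interpretation K: ring K by (rule koszul_ring)

lemma koszul_finsum_coeff:
  assumes "finite I" "\<And>i. i \<in> I \<Longrightarrow> F i \<in> carrier K" "S \<subseteq> V"
  shows "(\<Oplus>\<^bsub>K\<^esub>i\<in>I. F i) S = (\<Oplus>i\<in>I. F i S)"
  using assms(1,2)
proof (induct I rule: finite_induct)
  case empty
  then show ?case using assms(3) by (simp add: koszul_zero_coeff)
next
  case (insert i I)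
  have "(\<Oplus>\<^bsub>K\<^esub>i\<in>insert i I. F i) = F i \<oplus>\<^bsub>K\<^esub> (\<Oplus>\<^bsub>K\<^esub>i\<in>I. F i)"
    by (rule K.finsum_insert) (use insert in auto)
  moreover have "(\<Oplus>i\<in>insert i I. F i S) = F i S \<oplus> (\<Oplus>i\<in>I. F i S)"
    by (rule finsum_insert) (use insert assms(3) coeff_closed in auto)
  ultimately show ?case
    using insert assms(3) by (simp add: koszul_add_coeff)
qed

text \<open>Contraction by an index of S is zero at S, so the sum may run over all of V. An index
  set independent of S is what allows sums over i to be exchanged and compared.\<close>

lemma diff_coeff_partial:
  assumes f: "f \<in> carrier K" and S: "S \<subseteq> V"
  shows "diff K f S = (\<Oplus>i\<in>V. xs ! i \<otimes> partial i f S)"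
proof -
  have "diff K f S = (\<Oplus>i\<in>V - S. koszul_sign A {i} S \<otimes> (xs ! i \<otimes> f (insert i S)))"
    using S by (simp add: koszul_diff)
  also have "\<dots> = (\<Oplus>i\<in>V. xs ! i \<otimes> partial i f S)"
  proof (rule add.finprod_mono_neutral_cong_left)
    fix i assume i: "i \<in> V - S"
    then have "f (insert i S) \<in> carrier A" using S f by (intro coeff_closed) auto
    then show "koszul_sign A {i} S \<otimes> (xs ! i \<otimes> f (insert i S)) = xs ! i \<otimes> partial i f S"
      using i S by (simp add: partial_def m_ac)
  next
    show "(\<lambda>i. xs ! i \<otimes> partial i f S) \<in> V \<rightarrow> carrier A"
      using S f by (auto intro!: m_closed coeff_closed[OF partial_closed[OF _ f]])
  qed (use S in \<open>auto simp: partial_def\<close>)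
  finally show ?thesis .
qed

lemma koszul_diff_closed [simp]: 
  assumes f: "f \<in> carrier K"
  shows "diff K f \<in> carrier K"
  unfolding koszul_diff
  by (rule koszul_carrierI, rule finsum_closed) (auto intro!: m_closed coeff_closed[OF f])

lemma diff_eq_finsum:
  assumes f: "f \<in> carrier K"
  shows "diff K f = (\<Oplus>\<^bsub>K\<^esub>i\<in>V. scalar (xs ! i) \<otimes>\<^bsub>K\<^esub> partial i f)"
proof (rule koszul_ext)
  fix S assume S: "S \<subseteq> V"
  have "(\<Oplus>\<^bsub>K\<^esub>i\<in>V. scalar (xs ! i) \<otimes>\<^bsub>K\<^esub> partial i f) S = (\<Oplus>i\<in>V. (scalar (xs ! i) \<otimes>\<^bsub>K\<^esub> partial i f) S)"
    by (rule koszul_finsum_coeff) (use S f in auto)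
  also have "\<dots> = (\<Oplus>i\<in>V. xs ! i \<otimes> partial i f S)"
    by (rule finsum_congI) (use S f in \<open>auto simp: scalar_mult_coeff coeff_closed\<close>)
  finally show "diff K f S = (\<Oplus>\<^bsub>K\<^esub>i\<in>V. scalar (xs ! i) \<otimes>\<^bsub>K\<^esub> partial i f) S"
    using diff_coeff_partial[OF f S] by simp
qed (use f in \<open>auto intro!: K.finsum_closed\<close>)

text \<open>The skew derivation rule for each contraction, multiplied by \<open>xs ! i\<close> and
  summed over i. Scalars are central and can be moved past \<open>involution f\<close>.\<close>

lemma koszul_leibniz:
  assumes f: "f \<in> carrier K" and g: "g \<in> carrier K"
  shows "diff K (f \<otimes>\<^bsub>K\<^esub> g) = diff K f \<otimes>\<^bsub>K\<^esub> g \<oplus>\<^bsub>K\<^esub> involution f \<otimes>\<^bsub>K\<^esub> diff K g"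
proof -
  have cl: "partial i f \<in> carrier K" "partial i g \<in> carrier K" "scalar (xs ! i) \<in> carrier K" if "i \<in> V" for i
    using that f g by auto
  have inv: "involution f \<in> carrier K" using f by simp
  have "diff K (f \<otimes>\<^bsub>K\<^esub> g) = (\<Oplus>\<^bsub>K\<^esub>i\<in>V. scalar (xs ! i) \<otimes>\<^bsub>K\<^esub> partial i (f \<otimes>\<^bsub>K\<^esub> g))"
    using f g by (simp add: diff_eq_finsum)
  also have "\<dots> = (\<Oplus>\<^bsub>K\<^esub>i\<in>V. scalar (xs ! i) \<otimes>\<^bsub>K\<^esub> partial i f \<otimes>\<^bsub>K\<^esub> g \<oplus>\<^bsub>K\<^esub>
      involution f \<otimes>\<^bsub>K\<^esub> (scalar (xs ! i) \<otimes>\<^bsub>K\<^esub> partial i g))"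
  proof (rule K.finsum_cong'[OF refl])
    fix i assume i: "i \<in> V"
    have "partial i (f \<otimes>\<^bsub>K\<^esub> g) = partial i f \<otimes>\<^bsub>K\<^esub> g \<oplus>\<^bsub>K\<^esub> involution f \<otimes>\<^bsub>K\<^esub> partial i g"
      by (rule koszul_ext) (use i f g in \<open>auto simp: koszul_add_coeff partial_mult\<close>)
    then have "scalar (xs ! i) \<otimes>\<^bsub>K\<^esub> partial i (f \<otimes>\<^bsub>K\<^esub> g) =
      scalar (xs ! i) \<otimes>\<^bsub>K\<^esub> (partial i f \<otimes>\<^bsub>K\<^esub> g) \<oplus>\<^bsub>K\<^esub> scalar (xs ! i) \<otimes>\<^bsub>K\<^esub> (involution f \<otimes>\<^bsub>K\<^esub> partial i g)"
      using cl[OF i] f g inv by (simp add: K.r_distr)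
    also have "scalar (xs ! i) \<otimes>\<^bsub>K\<^esub> (involution f \<otimes>\<^bsub>K\<^esub> partial i g) = scalar (xs ! i) \<otimes>\<^bsub>K\<^esub> involution f \<otimes>\<^bsub>K\<^esub> partial i g"
      using cl[OF i] inv by (simp add: K.m_assoc)
    also have "scalar (xs ! i) \<otimes>\<^bsub>K\<^esub> involution f = involution f \<otimes>\<^bsub>K\<^esub> scalar (xs ! i)"
      using i inv by (intro scalar_comm) auto
    finally show "scalar (xs ! i) \<otimes>\<^bsub>K\<^esub> partial i (f \<otimes>\<^bsub>K\<^esub> g) = scalar (xs ! i) \<otimes>\<^bsub>K\<^esub> partial i f \<otimes>\<^bsub>K\<^esub> g \<oplus>\<^bsub>K\<^esub>
      involution f \<otimes>\<^bsub>K\<^esub> (scalar (xs ! i) \<otimes>\<^bsub>K\<^esub> partial i g)"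
      using cl[OF i] f g inv by (simp add: K.m_assoc)
  qed (use cl f g inv in auto)
  also have "\<dots> = (\<Oplus>\<^bsub>K\<^esub>i\<in>V. scalar (xs ! i) \<otimes>\<^bsub>K\<^esub> partial i f \<otimes>\<^bsub>K\<^esub> g) \<oplus>\<^bsub>K\<^esub>
      (\<Oplus>\<^bsub>K\<^esub>i\<in>V. involution f \<otimes>\<^bsub>K\<^esub> (scalar (xs ! i) \<otimes>\<^bsub>K\<^esub> partial i g))"
    by (rule K.finsum_addf) (use cl f g inv in auto)
  also have "(\<Oplus>\<^bsub>K\<^esub>i\<in>V. scalar (xs ! i) \<otimes>\<^bsub>K\<^esub> partial i f \<otimes>\<^bsub>K\<^esub> g) = diff K f \<otimes>\<^bsub>K\<^esub> g"
    unfolding diff_eq_finsum[OF f] by (rule K.finsum_ldistr[symmetric]) (use cl g in auto)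
  also have "(\<Oplus>\<^bsub>K\<^esub>i\<in>V. involution f \<otimes>\<^bsub>K\<^esub> (scalar (xs ! i) \<otimes>\<^bsub>K\<^esub> partial i g)) = involution f \<otimes>\<^bsub>K\<^esub> diff K g"
    unfolding diff_eq_finsum[OF g] by (rule K.finsum_rdistr[symmetric]) (use cl inv in auto)
  finally show ?thesis .
qed

text \<open>Exchanging the two contractions exchanges e_i and e_j: of the counts
  \<open>inversions {i} {j}\<close> and \<open>inversions {j} {i}\<close> exactly one is 1, and the
  other contributions to the exponents agree.\<close>

lemma partial_partial_antisym:
  assumes f: "f \<in> carrier K" and S: "S \<subseteq> V" and ij: "i \<in> V" "j \<in> V" "i \<noteq> j"
  shows "partial i (partial j f) S \<oplus> partial j (partial i f) S = \<zero>"
proof (cases "i \<in> S \<or> j \<in> S")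
  case True
  then show ?thesis using S ij by (auto simp: partial_def koszul_sign_eq)
next
  case False
  have fin: "finite S" using S by (rule finite_subset_V)
  have fc: "f (insert i (insert j S)) \<in> carrier A" using f S ij by (auto intro: coeff_closed)
  have s: "inversions {a} (insert b S) = inversions {a} {b} + inversions {a} S" if "b \<notin> S" for a b
    using that fin by (intro inversions_insert_right) auto
  have n: "inversions {j} {i} + inversions {i} {j} = 1"
    using inversions_singleton_add[of "{i}" j] ij by simp
  have "partial i (partial j f) S = sg (inversions {i} S + (inversions {j} {i} + inversions {j} S)) \<otimes> f (insert i (insert j S))"
    using False S ij fc by (simp add: partial_def koszul_sign_eq s sg_add m_assoc insert_commute)
  moreover have "partial j (partial i f) S = sg (inversions {j} S + (inversions {i} {j} + inversions {i} S)) \<otimes> f (insert i (insert j S))"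
    using False S ij fc by (simp add: partial_def koszul_sign_eq s sg_add m_assoc)
  moreover have "sg (inversions {j} S + (inversions {i} {j} + inversions {i} S)) =
      sg (Suc (inversions {i} S + (inversions {j} {i} + inversions {j} S)))"
    by (rule sg_cong) (use n in presburger)
  ultimately show ?thesis using fc by (simp add: sg_Suc l_minus r_neg)
qed

lemma koszul_diff_diff:
  assumes f: "f \<in> carrier K"
  shows "diff K (diff K f) = \<zero>\<^bsub>K\<^esub>"
proof (rule koszul_ext)
  fix S assume S: "S \<subseteq> V"
  have pp: "partial i (partial j f) S \<in> carrier A" if "i \<in> V" "j \<in> V" for i j
    using that f S by (intro coeff_closed) auto
  have "diff K (diff K f) S = (\<Oplus>i\<in>V. xs ! i \<otimes> partial i (diff K f) S)"
    using f S by (simp add: diff_coeff_partial)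
  also have "\<dots> = (\<Oplus>i\<in>V. \<Oplus>j\<in>V. xs ! i \<otimes> (xs ! j \<otimes> partial i (partial j f) S))"
  proof (rule finsum_congI)
    fix i assume i: "i \<in> V"
    have "partial i (diff K f) S = (\<Oplus>j\<in>V. xs ! j \<otimes> partial i (partial j f) S)"
    proof (cases "i \<in> S")
      case True
      have "(\<Oplus>j\<in>V. xs ! j \<otimes> partial i (partial j f) S) = (\<Oplus>j\<in>V. \<zero>)"
        by (rule finsum_congI) (use True S in \<open>auto simp: partial_def\<close>)
      then show ?thesis using True S by (simp add: partial_def)
    next
      case False
      have iS: "insert i S \<subseteq> V" using i S by simp
      have p: "partial j f (insert i S) \<in> carrier A" if "j \<in> V" for j
        using that f iS by (intro coeff_closed) auto
      have "partial i (diff K f) S = koszul_sign A {i} S \<otimes> (\<Oplus>j\<in>V. xs ! j \<otimes> partial j f (insert i S))"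
        using False S f by (simp add: partial_def[of i] diff_coeff_partial[OF f iS])
      also have "\<dots> = (\<Oplus>j\<in>V. koszul_sign A {i} S \<otimes> (xs ! j \<otimes> partial j f (insert i S)))"
        by (rule finsum_rdistr) (use p in auto)
      also have "\<dots> = (\<Oplus>j\<in>V. xs ! j \<otimes> partial i (partial j f) S)"
        by (rule finsum_congI) (use p False S in \<open>auto simp: partial_def[of i] m_ac\<close>)
      finally show ?thesis .
    qed
    moreover have "xs ! i \<otimes> (\<Oplus>j\<in>V. xs ! j \<otimes> partial i (partial j f) S) = (\<Oplus>j\<in>V. xs ! i \<otimes> (xs ! j \<otimes> partial i (partial j f) S))"
      by (rule finsum_rdistr) (use pp i in auto)
    ultimately show "xs ! i \<otimes> partial i (diff K f) S = (\<Oplus>j\<in>V. xs ! i \<otimes> (xs ! j \<otimes> partial i (partial j f) S))"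
      by simp
  qed (use pp in \<open>auto intro!: finsum_closed\<close>)
  also have "\<dots> = \<zero>"
  proof (rule finsum_antisym)
    fix i assume "i \<in> V"
    then show "xs ! i \<otimes> (xs ! i \<otimes> partial i (partial i f) S) = \<zero>"
      using S by (simp add: partial_def)
  next
    fix i j assume ij: "i \<in> V" "j \<in> V" "i \<noteq> j"
    have "xs ! i \<otimes> (xs ! j \<otimes> partial i (partial j f) S) \<oplus> xs ! j \<otimes> (xs ! i \<otimes> partial j (partial i f) S) =
      xs ! i \<otimes> (xs ! j \<otimes> (partial i (partial j f) S \<oplus> partial j (partial i f) S))"
      using ij pp by (simp add: r_distr m_lcomm)
    then show "xs ! i \<otimes> (xs ! j \<otimes> partial i (partial j f) S) \<oplus> xs ! j \<otimes> (xs ! i \<otimes> partial j (partial i f) S) = \<zero>"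
      using partial_partial_antisym[OF f S ij] ij by simp
  qed (use pp in auto)
  finally show "diff K (diff K f) S = \<zero>\<^bsub>K\<^esub> S" using S by (simp add: koszul_zero_coeff)
qed (use f in auto)

lemma koszul_diff_add:
  assumes f: "f \<in> carrier K" and g: "g \<in> carrier K"
  shows "diff K (f \<oplus>\<^bsub>K\<^esub> g) = diff K f \<oplus>\<^bsub>K\<^esub> diff K g"
proof (rule koszul_ext)
  fix S assume S: "S \<subseteq> V"
  have p: "partial i f S \<in> carrier A" "partial i g S \<in> carrier A" if "i \<in> V" for i
    using that f g S by (auto intro!: coeff_closed)
  have "diff K (f \<oplus>\<^bsub>K\<^esub> g) S = (\<Oplus>i\<in>V. xs ! i \<otimes> partial i f S \<oplus> xs ! i \<otimes> partial i g S)"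
    unfolding diff_coeff_partial[OF K.a_closed[OF f g] S]
  proof (rule finsum_congI)
    fix i assume i: "i \<in> V"
    have "partial i (f \<oplus>\<^bsub>K\<^esub> g) S = partial i f S \<oplus> partial i g S"
      using S i coeff_closed[OF f, of "insert i S"] coeff_closed[OF g, of "insert i S"]
      by (simp add: partial_def koszul_add_coeff r_distr)
    then show "xs ! i \<otimes> partial i (f \<oplus>\<^bsub>K\<^esub> g) S = xs ! i \<otimes> partial i f S \<oplus> xs ! i \<otimes> partial i g S"
      using p i by (simp add: r_distr)
  qed (use p in auto)
  also have "\<dots> = diff K f S \<oplus> diff K g S"
    unfolding diff_coeff_partial[OF f S] diff_coeff_partial[OF g S]
    by (rule finsum_addf) (use p in auto)
  finally show "diff K (f \<oplus>\<^bsub>K\<^esub> g) S = (diff K f \<oplus>\<^bsub>K\<^esub> diff K g) S"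
    using S by (simp add: koszul_add_coeff)
qed (use f g in auto)

lemma koszul_a_inv_coeff:
  assumes "f \<in> carrier K" "S \<subseteq> V"
  shows "(\<ominus>\<^bsub>K\<^esub> f) S = \<ominus> f S"
proof -
  have "(\<ominus>\<^bsub>K\<^esub> f) S \<oplus> f S = \<zero>"
    using K.l_neg[OF assms(1)] assms(2) by (metis koszul_add_coeff koszul_zero_coeff)
  then show ?thesis
    using assms coeff_closed[of "\<ominus>\<^bsub>K\<^esub> f" S] coeff_closed[of f S] minus_equality by (metis K.a_inv_closed)
qed

lemma koszul_dg_ring: "dg_ring K involution"
proof (intro dg_ring.intro koszul_ring dg_ring_axioms.intro)
  fix f assume f: "f \<in> carrier K"
  show "involution (involution f) = f"
    by (rule koszul_ext)
      (use f in \<open>auto simp: involution_def m_assoc[symmetric] sg_mult_self coeff_closed intro!: koszul_carrierI\<close>)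
  show "diff K (involution f) = \<ominus>\<^bsub>K\<^esub> involution (diff K f)"
  proof (rule koszul_ext)
    fix S assume S: "S \<subseteq> V"
    have "diff K (involution f) S = (\<Oplus>i\<in>V. (\<ominus> sg (card S)) \<otimes> (xs ! i \<otimes> partial i f S))"
      unfolding diff_coeff_partial[OF involution_closed[OF f] S]
    proof (rule finsum_congI)
      fix i assume i: "i \<in> V"
      show "xs ! i \<otimes> partial i (involution f) S = (\<ominus> sg (card S)) \<otimes> (xs ! i \<otimes> partial i f S)"
      proof (cases "i \<in> S")
        case False
        have "f (insert i S) \<in> carrier A" using f S i by (auto intro: coeff_closed)
        then show ?thesis
          using False S i finite_subset_V[OF S] by (simp add: partial_def involution_def sg_Suc l_minus r_minus m_ac)
      qed (use i S in \<open>simp add: partial_def\<close>)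
    qed (use S in \<open>auto intro!: a_inv_closed m_closed coeff_closed[OF partial_closed[OF _ f]]\<close>)
    also have "\<dots> = (\<ominus> sg (card S)) \<otimes> diff K f S"
      unfolding diff_coeff_partial[OF f S]
      by (rule finsum_rdistr[symmetric])
        (use S in \<open>auto intro!: a_inv_closed m_closed coeff_closed[OF partial_closed[OF _ f]]\<close>)
    also have "\<dots> = (\<ominus>\<^bsub>K\<^esub> involution (diff K f)) S"
      using f S koszul_a_inv_coeff[OF involution_closed[OF koszul_diff_closed[OF f]] S]
      by (simp add: involution_def coeff_closed l_minus)
    finally show "diff K (involution f) S = (\<ominus>\<^bsub>K\<^esub> involution (diff K f)) S" .
  qed (use f in auto)
next
  show "involution \<zero>\<^bsub>K\<^esub> = \<zero>\<^bsub>K\<^esub>"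
    unfolding involution_def koszul_zero by (rule restrict_ext) simp
  have "diff K \<one>\<^bsub>K\<^esub> S = \<zero>" if S: "S \<subseteq> V" for S
  proof -
    have "diff K \<one>\<^bsub>K\<^esub> S = (\<Oplus>i\<in>V. \<zero>)"
      unfolding diff_coeff_partial[OF K.one_closed S]
      by (rule finsum_congI) (use S in \<open>auto simp: partial_def koszul_one_coeff\<close>)
    then show ?thesis by simp
  qed
  then show "diff K \<one>\<^bsub>K\<^esub> = \<zero>\<^bsub>K\<^esub>"
    by (intro koszul_ext) (auto simp: koszul_zero_coeff)
next
  fix a b assume a: "a \<in> piece K 0" and b: "b \<in> carrier K"
  \<comment> \<open>The empty set is the only subset of V of cardinality 0, so degree-zero elements
    are scalars and hence central.\<close>
  have "a = scalar (a {})"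
  proof (rule koszul_ext)
    fix S assume "S \<subseteq> V"
    then show "a S = scalar (a {}) S" using a by (auto simp: koszul_piece scalar_coeff finite_subset_V)
  qed (use a in \<open>auto simp: koszul_piece intro!: scalar_closed coeff_closed\<close>)
  moreover have "a {} \<in> carrier A" using a by (auto simp: koszul_piece intro: coeff_closed)
  ultimately show "a \<otimes>\<^bsub>K\<^esub> b = b \<otimes>\<^bsub>K\<^esub> a"
    using scalar_comm[of "a {}" b] b by metis
next
  show "\<zero>\<^bsub>K\<^esub> \<in> piece K i" for i by (auto simp: koszul_piece koszul_zero_coeff)
qed (auto simp: koszul_diff_add koszul_diff_diff koszul_leibniz koszul_piece)

end

section \<open>Trivial Massey operations annihilate products of cycles\<close>

context dg_ring
begin

lemma diff_zero [simp]: "diff B \<zero> = \<zero>"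
  using diff_add[of \<zero> \<zero>] by (metis add.l_cancel_one' diff_closed l_zero zero_closed)

lemma diff_minus: "a \<in> carrier B \<Longrightarrow> diff B (\<ominus> a) = \<ominus> diff B a"
  using diff_add[of "\<ominus> a" a] by (simp add: l_neg minus_equality)

lemma dg_cycles_subring: "subring (dg_cycles B) B"
  by (rule subringI) (auto simp: dg_cycles_def diff_minus diff_mult diff_add)

lemma dg_boundaries_subset: "dg_boundaries B \<subseteq> dg_cycles B"
  by (auto simp: dg_boundaries_def dg_cycles_def)

lemma dg_boundaries_ideal: "ideal (dg_boundaries B) (B\<lparr>carrier := dg_cycles B\<rparr>)"
proof (rule idealI)
  show "ring (B\<lparr>carrier := dg_cycles B\<rparr>)"
    by (rule subring_is_ring[OF dg_cycles_subring])
  have Bd: "subgroup (dg_boundaries B) (add_monoid B)"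
  proof (rule add.subgroupI)
    show "dg_boundaries B \<subseteq> carrier B" "dg_boundaries B \<noteq> {}"
      by (auto simp: dg_boundaries_def)
  next
    fix a assume "a \<in> dg_boundaries B"
    then obtain u where u: "u \<in> carrier B" "a = diff B u" by (auto simp: dg_boundaries_def)
    have "\<ominus> a = diff B (\<ominus> u)" using u by (simp add: diff_minus)
    then show "\<ominus> a \<in> dg_boundaries B" unfolding dg_boundaries_def using u by blast
  next
    fix a b assume "a \<in> dg_boundaries B" "b \<in> dg_boundaries B"
    then obtain u v where u: "u \<in> carrier B" "a = diff B u" "v \<in> carrier B" "b = diff B v"
      by (auto simp: dg_boundaries_def)
    have "a \<oplus> b = diff B (u \<oplus> v)" using u by (simp add: diff_add)
    then show "a \<oplus> b \<in> dg_boundaries B" unfolding dg_boundaries_def using u by blast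
  qed
  have Z: "subgroup (dg_cycles B) (add_monoid B)"
    using subring.axioms(1)[OF dg_cycles_subring] by (simp add: additive_subgroup_def)
  show "subgroup (dg_boundaries B) (add_monoid (B\<lparr>carrier := dg_cycles B\<rparr>))"
    using add.subgroup_incl[OF Bd Z dg_boundaries_subset] by simp
next
  fix a x assume "a \<in> dg_boundaries B" "x \<in> carrier (B\<lparr>carrier := dg_cycles B\<rparr>)"
  then obtain u where u: "u \<in> carrier B" "a = diff B u" and x: "x \<in> carrier B" "diff B x = \<zero>"
    by (auto simp: dg_boundaries_def dg_cycles_def)
  \<comment> \<open>Inserting \<sigma> cancels the sign of the Leibniz rule, as \<sigma> is its own
    inverse; the other term vanishes because \<sigma> x is again a cycle.\<close>
  have "x \<otimes> a = diff B (\<sigma> x \<otimes> u)"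
    using u x by (simp add: diff_mult diff_\<sigma>)
  then show "x \<otimes>\<^bsub>B\<lparr>carrier := dg_cycles B\<rparr>\<^esub> a \<in> dg_boundaries B"
    unfolding dg_boundaries_def using u x by auto
  have "a \<otimes> x = diff B (u \<otimes> x)"
    using u x by (simp add: diff_mult)
  then show "a \<otimes>\<^bsub>B\<lparr>carrier := dg_cycles B\<rparr>\<^esub> x \<in> dg_boundaries B"
    unfolding dg_boundaries_def using u x by auto
qed

text \<open>Boundaries are closed under negation, so knowing the bar up to sign suffices and
  \<open>hdegree\<close> is never evaluated.\<close>

lemma dg_bar_cases:
  assumes "a \<in> carrier B"
  shows "dg_bar B a = a \<or> dg_bar B a = \<ominus> a"
proof -
  have "(\<ominus> \<one>) [^] n = \<one> \<or> (\<ominus> \<one>) [^] n = \<ominus> \<one>" for n :: nat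
    by (induct n) (auto simp: l_minus r_minus)
  then show ?thesis
    unfolding dg_bar_def using assms by (metis l_minus l_one one_closed)
qed

text \<open>For a list of length two the Massey identity says that, up to sign, the product of two
  representatives is a boundary. Basis classes thus multiply to zero, and this extends to all of the
  positive-degree homology by linearity in each factor.\<close>

lemma trivial_massey_mult_boundary:
  assumes "homogeneous_basis B \<B>" "trivial_massey_operation B \<B> \<nu>"
    and z: "z \<in> dg_cycles B" "z \<in> piece B p" "1 \<le> p"
    and z': "z' \<in> dg_cycles B" "z' \<in> piece B q" "1 \<le> q"
  shows "z \<otimes> z' \<in> dg_boundaries B"
proof -
  define Z where "Z = B\<lparr>carrier := dg_cycles B\<rparr>"
  define H where "H = dg_homology B"
  have Z_simps [simp]: "carrier Z = dg_cycles B" "monoid.mult Z = monoid.mult B" "add Z = add B" "ring.zero Z = \<zero>"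
    by (simp_all add: Z_def)
  interpret D: ideal "dg_boundaries B" Z
    unfolding Z_def by (rule dg_boundaries_ideal)
  have H_eq: "H = Z Quot dg_boundaries B" by (simp add: H_def dg_homology_def Z_def)
  have cls_eq: "homology_class B a = dg_boundaries B +>\<^bsub>Z\<^esub> a" for a
    unfolding homology_class_def a_r_coset_def r_coset_def by simp
  interpret H: ring H unfolding H_eq by (rule D.quotient_is_ring)
  interpret \<pi>: ring_hom_ring Z H "homology_class B"
    using D.rcos_ring_hom_ring unfolding H_eq cls_eq[abs_def] .
  have cls_zero: "a \<in> dg_boundaries B" if "a \<in> dg_cycles B" "homology_class B a = \<zero>\<^bsub>H\<^esub>" for a
    using D.rcos_const_imp_mem[of a] that unfolding cls_eq H_eq by (simp add: FactRing_def)
  have cls_bd: "homology_class B a = \<zero>\<^bsub>H\<^esub>" if "a \<in> dg_boundaries B" for a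
    using D.a_coset_join2[of a] that dg_boundaries_subset unfolding cls_eq H_eq
    by (metis D.a_rcos_zero D.ideal_axioms FactRing_def partial_object.select_convs(1) ring.select_convs(1) monoid.select_convs(1))
  have B_sub: "\<B> \<subseteq> (\<Union>i\<in>{1..}. homology_piece B i)"
    and B_span: "homology_pos B = (\<Union>hs\<in>lists \<B>. ring.Span H (homology_piece B 0) hs)"
    using assms(1) by (auto simp: homogeneous_basis_def H_def)
  have nu: "\<nu> [h] \<in> dg_cycles B" "homology_class B (\<nu> [h]) = h" if "h \<in> \<B>" for h
    using assms(2) that by (auto simp: trivial_massey_operation_def)
  have piece_H: "homology_piece B i \<subseteq> carrier H" for i
    by (auto simp: homology_piece_def)
  have h_carrier: "h \<in> carrier H" if "h \<in> \<B>" for h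
    using B_sub piece_H that by blast
  have basis_mult: "h \<otimes>\<^bsub>H\<^esub> h' = \<zero>\<^bsub>H\<^esub>" if h: "h \<in> \<B>" "h' \<in> \<B>" for h h'
  proof -
    have c: "\<nu> [h] \<in> carrier B" "\<nu> [h'] \<in> carrier B"
      using nu h by (auto simp: dg_cycles_def)
    have hh: "\<nu> [h, h'] \<in> (\<Union>i. piece B i)"
      "\<forall>hs. 2 \<le> length hs \<and> set hs \<subseteq> \<B> \<longrightarrow>
        diff B (\<nu> hs) = (\<Oplus>j\<in>{1..<length hs}. dg_bar B (\<nu> (take j hs)) \<otimes> \<nu> (drop j hs))"
      using assms(2) h unfolding trivial_massey_operation_def by auto
    then have n: "\<nu> [h, h'] \<in> carrier B" using piece_closed by blast
    have b: "dg_bar B (\<nu> [h]) \<in> carrier B" using dg_bar_cases[OF c(1)] c by auto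
    have "{1..<2} = {1::nat}" by auto
    then have "diff B (\<nu> [h, h']) = dg_bar B (\<nu> [h]) \<otimes> \<nu> [h']"
      using hh(2)[rule_format, of "[h, h']"] h b c by (simp add: numeral_2_eq_2)
    then have "\<nu> [h] \<otimes> \<nu> [h'] = diff B (\<nu> [h, h']) \<or> \<nu> [h] \<otimes> \<nu> [h'] = diff B (\<ominus> \<nu> [h, h'])"
      using dg_bar_cases[OF c(1)] c n by (auto simp: diff_minus l_minus)
    then have "\<nu> [h] \<otimes> \<nu> [h'] \<in> dg_boundaries B"
      unfolding dg_boundaries_def using n by auto
    then have "homology_class B (\<nu> [h] \<otimes> \<nu> [h']) = \<zero>\<^bsub>H\<^esub>" by (rule cls_bd)
    then show ?thesis
      using \<pi>.hom_mult[of "\<nu> [h]" "\<nu> [h']"] nu h by simp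
  qed
  \<comment> \<open>\<open>Span\<close> puts coefficients on the left. To extract them from the
    second factor of a product they must commute with basis classes.\<close>
  have central: "k \<otimes>\<^bsub>H\<^esub> x = x \<otimes>\<^bsub>H\<^esub> k" if k: "k \<in> homology_piece B 0" and x: "x \<in> \<B>" for k x
  proof -
    obtain a where a: "k = homology_class B a" "a \<in> dg_cycles B" "a \<in> piece B 0"
      using k by (auto simp: homology_piece_def)
    have "a \<otimes> \<nu> [x] = \<nu> [x] \<otimes> a"
      using a nu[OF x] by (intro piece_0_central) (auto simp: dg_cycles_def)
    then show ?thesis
      using \<pi>.hom_mult[of a "\<nu> [x]"] \<pi>.hom_mult[of "\<nu> [x]" a] a nu[OF x] by simp
  qed
  have Span_simps: "ring.Span H k [] = {\<zero>\<^bsub>H\<^esub>}"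
    "ring.Span H k (u # us) = {c \<otimes>\<^bsub>H\<^esub> u \<oplus>\<^bsub>H\<^esub> v | c v. c \<in> k \<and> v \<in> ring.Span H k us}" for k u us
    by (simp_all add: set_eq_iff H.line_extension_mem_iff) blast
  have K0: "homology_piece B 0 \<subseteq> carrier H" by (rule piece_H)
  \<comment> \<open>Linearity in the first factor: every element of a span of basis classes
    annihilates the basis from the left. The fact \<open>both\<close> then does the same for the
    second factor.\<close>
  have left: "v \<in> carrier H \<and> (\<forall>h\<in>\<B>. v \<otimes>\<^bsub>H\<^esub> h = \<zero>\<^bsub>H\<^esub>)"
    if "set hs \<subseteq> \<B>" "v \<in> ring.Span H (homology_piece B 0) hs" for hs v
    using that
  proof (induct hs arbitrary: v)
    case (Cons u us)
    then obtain c w where cw: "c \<in> homology_piece B 0" "w \<in> ring.Span H (homology_piece B 0) us" "v = c \<otimes>\<^bsub>H\<^esub> u \<oplus>\<^bsub>H\<^esub> w"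
      using Cons.prems(2) unfolding Span_simps by blast
    have w: "w \<in> carrier H" "\<And>h. h \<in> \<B> \<Longrightarrow> w \<otimes>\<^bsub>H\<^esub> h = \<zero>\<^bsub>H\<^esub>"
      using Cons.hyps[of w] Cons.prems cw by auto
    have u: "u \<in> \<B>" "u \<in> carrier H" using Cons.prems h_carrier by auto
    have c: "c \<in> carrier H" using cw K0 by auto
    show ?case
      using cw(3) w u c by (auto simp: H.l_distr H.m_assoc h_carrier basis_mult)
  qed (auto simp: Span_simps h_carrier)
  have both: "v \<otimes>\<^bsub>H\<^esub> w = \<zero>\<^bsub>H\<^esub> \<and> w \<in> carrier H"
    if v: "v \<in> carrier H" "\<And>h. h \<in> \<B> \<Longrightarrow> v \<otimes>\<^bsub>H\<^esub> h = \<zero>\<^bsub>H\<^esub>"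
      and "set hs \<subseteq> \<B>" "w \<in> ring.Span H (homology_piece B 0) hs" for hs v w
    using that(3,4)
  proof (induct hs arbitrary: w)
    case Nil
    then show ?case using v by (auto simp: Span_simps)
  next
    case (Cons u us)
    then obtain c x where cx: "c \<in> homology_piece B 0" "x \<in> ring.Span H (homology_piece B 0) us" "w = c \<otimes>\<^bsub>H\<^esub> u \<oplus>\<^bsub>H\<^esub> x"
      using Cons.prems(2) unfolding Span_simps by blast
    have x: "x \<in> carrier H" "v \<otimes>\<^bsub>H\<^esub> x = \<zero>\<^bsub>H\<^esub>"
      using Cons.hyps[of x] Cons.prems cx by auto
    have u: "u \<in> \<B>" "u \<in> carrier H" using Cons.prems h_carrier by auto
    have c: "c \<in> carrier H" using cx K0 by auto
    have "v \<otimes>\<^bsub>H\<^esub> (c \<otimes>\<^bsub>H\<^esub> u) = v \<otimes>\<^bsub>H\<^esub> u \<otimes>\<^bsub>H\<^esub> c"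
      by (simp only: central[OF cx(1) u(1)] H.m_assoc[OF v(1) u(2) c])
    then show ?case
      using cx(3) x u c v by (simp add: H.r_distr)
  qed
  have pos: "homology_class B a \<in> homology_pos B" if a: "a \<in> dg_cycles B" "a \<in> piece B i" "1 \<le> i" for a i
  proof -
    \<comment> \<open>\<open>homology_pos\<close> consists of sums with one term per degree; the
      class sits in degree i and all lower terms are zero.\<close>
    define c where "c j = (if j = i then homology_class B a else \<zero>\<^bsub>H\<^esub>)" for j
    have a': "homology_class B a \<in> carrier H" using a by auto
    have zero: "\<zero>\<^bsub>H\<^esub> \<in> homology_piece B j" for j
    proof -
      have "\<zero> = diff B \<zero>" by simp
      then have "\<zero> \<in> dg_boundaries B" unfolding dg_boundaries_def by (rule image_eqI) simp
      then have "homology_class B \<zero> = \<zero>\<^bsub>H\<^esub>" by (rule cls_bd)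
      moreover have "\<zero> \<in> dg_cycles B \<inter> piece B j" using piece_zero by (simp add: dg_cycles_def)
      ultimately show ?thesis unfolding homology_piece_def by (metis imageI)
    qed
    have "finsum H c {1..i} = (\<Oplus>\<^bsub>H\<^esub>j\<in>{1..i}. if i = j then homology_class B a else \<zero>\<^bsub>H\<^esub>)"
      by (rule H.finsum_cong'[OF refl]) (use a' in \<open>auto simp: c_def\<close>)
    also have "\<dots> = homology_class B a"
      by (rule H.finsum_singleton) (use a a' in auto)
    finally have "homology_class B a = finsum (dg_homology B) c {1..i}" by (simp add: H_def)
    moreover have "\<forall>j\<in>{1..i}. c j \<in> homology_piece B j"
      using a zero by (auto simp: c_def homology_piece_def)
    ultimately show ?thesis unfolding homology_pos_def by blast
  qed
  obtain hs where hs: "set hs \<subseteq> \<B>" "homology_class B z \<in> ring.Span H (homology_piece B 0) hs"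
    using pos[OF z] unfolding B_span by auto
  obtain hs' where hs': "set hs' \<subseteq> \<B>" "homology_class B z' \<in> ring.Span H (homology_piece B 0) hs'"
    using pos[OF z'] unfolding B_span by auto
  have "homology_class B z \<otimes>\<^bsub>H\<^esub> homology_class B z' = \<zero>\<^bsub>H\<^esub>"
    using left[OF hs] both[OF _ _ hs'] by blast
  then have "homology_class B (z \<otimes> z') = \<zero>\<^bsub>H\<^esub>"
    using \<pi>.hom_mult[of z z'] z z' by simp
  moreover have "z \<otimes> z' \<in> dg_cycles B"
    using z z' subringE(6)[OF dg_cycles_subring] by blast
  ultimately show ?thesis by (intro cls_zero)
qed

end

section \<open>Change of the base ring of the Koszul complex\<close>

definition koszul_map :: "'a list \<Rightarrow> ('a \<Rightarrow> 'c) \<Rightarrow> (nat set \<Rightarrow> 'a) \<Rightarrow> nat set \<Rightarrow> 'c"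
  where "koszul_map xs h f = (\<lambda>S\<in>Pow {..<length xs}. h (f S))"

locale koszul_hom = koszul_complex A xs + h: ring_hom_cring A B h
  for A :: "('a, 'm) ring_scheme" and xs and B :: "('c, 'n) ring_scheme" (structure) and h
begin

abbreviation "\<phi> \<equiv> koszul_map xs h"
abbreviation "L \<equiv> koszul B (map h xs)"

sublocale target: koszul_complex B "map h xs"
  by unfold_locales (use xs_closed h.hom_closed in auto)

lemma target_V: "target.V = V"
  by (simp add: V_def target.V_def)

lemma koszul_map_coeff: "S \<subseteq> V \<Longrightarrow> \<phi> f S = h (f S)"
  by (simp add: koszul_map_def V_def)

lemma koszul_map_closed: "f \<in> carrier K \<Longrightarrow> \<phi> f \<in> carrier L"
  unfolding koszul_map_def using target.koszul_carrierI[of "\<lambda>S. h (f S)"]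
  by (simp add: target_V V_def[symmetric] coeff_closed)

lemma hom_koszul_sign: "h (koszul_sign A S T) = koszul_sign B S T"
proof -
  have "h ((\<ominus>\<^bsub>A\<^esub> \<one>\<^bsub>A\<^esub>) [^]\<^bsub>A\<^esub> n) = (\<ominus>\<^bsub>B\<^esub> \<one>\<^bsub>B\<^esub>) [^]\<^bsub>B\<^esub> n" for n :: nat
    by (induct n) simp_all
  then show ?thesis by (simp add: koszul_sign_def)
qed

lemma koszul_map_mult:
  assumes f: "f \<in> carrier K" and g: "g \<in> carrier K"
  shows "\<phi> (f \<otimes>\<^bsub>K\<^esub> g) = \<phi> f \<otimes>\<^bsub>L\<^esub> \<phi> g"
proof (rule target.koszul_ext)
  fix S assume "S \<subseteq> target.V"
  then have S: "S \<subseteq> V" by (simp add: target_V)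
  have cl: "f U \<in> carrier A" "g U \<in> carrier A" "U \<subseteq> V" if "U \<subseteq> S" for U
    using that S f g coeff_closed by auto
  have "\<phi> (f \<otimes>\<^bsub>K\<^esub> g) S = h (\<Oplus>\<^bsub>A\<^esub>T\<in>Pow S. koszul_sign A T (S - T) \<otimes>\<^bsub>A\<^esub> (f T \<otimes>\<^bsub>A\<^esub> g (S - T)))"
    using S by (simp add: koszul_map_coeff koszul_mult_coeff)
  also have "\<dots> = (\<Oplus>\<^bsub>B\<^esub>T\<in>Pow S. h (koszul_sign A T (S - T) \<otimes>\<^bsub>A\<^esub> (f T \<otimes>\<^bsub>A\<^esub> g (S - T))))"
    using cl by (subst h.hom_finsum) (auto simp: comp_def Diff_subset)
  also have "\<dots> = (\<Oplus>\<^bsub>B\<^esub>T\<in>Pow S. koszul_sign B T (S - T) \<otimes>\<^bsub>B\<^esub> (\<phi> f T \<otimes>\<^bsub>B\<^esub> \<phi> g (S - T)))"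
    by (rule h.S.finsum_congI) (use cl in \<open>auto simp: hom_koszul_sign koszul_map_coeff Diff_subset\<close>)
  finally show "\<phi> (f \<otimes>\<^bsub>K\<^esub> g) S = (\<phi> f \<otimes>\<^bsub>L\<^esub> \<phi> g) S"
    using S by (simp add: target.koszul_mult_coeff target_V)
qed (use f g in \<open>auto intro!: koszul_map_closed target.koszul_mult_closed koszul_mult_closed\<close>)

lemma koszul_map_diff:
  assumes f: "f \<in> carrier K"
  shows "\<phi> (diff K f) = diff L (\<phi> f)"
proof (rule target.koszul_ext)
  fix S assume "S \<subseteq> target.V"
  then have S: "S \<subseteq> V" by (simp add: target_V)
  have cl: "f (insert i S) \<in> carrier A" "insert i S \<subseteq> V" if "i \<in> V - S" for i
    using that S f coeff_closed by auto
  have "\<phi> (diff K f) S = h (\<Oplus>\<^bsub>A\<^esub>i\<in>V - S. koszul_sign A {i} S \<otimes>\<^bsub>A\<^esub> (xs ! i \<otimes>\<^bsub>A\<^esub> f (insert i S)))"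
    using S by (simp add: koszul_map_coeff koszul_diff)
  also have "\<dots> = (\<Oplus>\<^bsub>B\<^esub>i\<in>V - S. h (koszul_sign A {i} S \<otimes>\<^bsub>A\<^esub> (xs ! i \<otimes>\<^bsub>A\<^esub> f (insert i S))))"
    using cl by (subst h.hom_finsum) (auto simp: comp_def)
  also have "\<dots> = (\<Oplus>\<^bsub>B\<^esub>i\<in>V - S. koszul_sign B {i} S \<otimes>\<^bsub>B\<^esub> (map h xs ! i \<otimes>\<^bsub>B\<^esub> \<phi> f (insert i S)))"
    by (rule h.S.finsum_congI) (use cl S in \<open>auto simp: hom_koszul_sign koszul_map_coeff V_def\<close>)
  finally show "\<phi> (diff K f) S = diff L (\<phi> f) S"
    using S by (simp add: target.koszul_diff target_V)
qed (use f in \<open>auto intro!: koszul_map_closed target.koszul_diff_closed\<close>)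

end

section \<open>Regular sequences and Nakayama's lemma\<close>

lemma (in ring) add_minus_cancel:
  assumes "a \<in> carrier R" "b \<in> carrier R"
  shows "b \<oplus> (a \<ominus> b) = a"
proof -
  have "b \<oplus> (a \<oplus> \<ominus> b) = a \<oplus> (b \<oplus> \<ominus> b)" using assms by (intro a_lcomm) auto
  then show ?thesis using assms by (simp add: minus_eq r_neg)
qed

context cring
begin

text \<open>The sum of the ideal of S and the principal ideal of g is an ideal that contains all the
  generators.\<close>

lemma Idl_insert_decomp:
  assumes "S \<subseteq> carrier R" "g \<in> carrier R" "y \<in> Idl (insert g S)"
  obtains s t where "s \<in> Idl S" "t \<in> carrier R" "y = s \<oplus> g \<otimes> t"
proof -
  have "ideal (Idl S <+> PIdl g) R"
    by (intro add_ideals genideal_ideal cgenideal_ideal assms)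
  moreover have "insert g S \<subseteq> Idl S <+> PIdl g"
  proof (rule insert_subsetI)
    have "\<zero> \<in> Idl S" using genideal_ideal[OF assms(1)] by (simp add: additive_subgroup.zero_closed ideal_def)
    then show "g \<in> Idl S <+> PIdl g"
      using cgenideal_self[OF assms(2)] assms(2) unfolding set_add_def' by force
    have "\<zero> \<in> PIdl g" using cgenideal_ideal[OF assms(2)] by (simp add: additive_subgroup.zero_closed ideal_def)
    then show "S \<subseteq> Idl S <+> PIdl g"
      using genideal_self[OF assms(1)] assms(1) unfolding set_add_def' by force
  qed
  ultimately have "y \<in> Idl S <+> PIdl g"
    using genideal_minimal assms(3) by blast
  then obtain s t where "s \<in> Idl S" "t \<in> carrier R" "y = s \<oplus> t \<otimes> g"
    unfolding set_add_def' cgenideal_def by blast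
  then show ?thesis using that assms(2) by (simp add: m_comm)
qed

text \<open>Only regularity in the given order is available, as a regular sequence need not stay
  regular when permuted. The induction therefore removes the last element g. If p is its index,
  regularity applies directly. Otherwise the coefficient t of g in the relation lies in the ideal of
  the earlier elements, and can be exchanged for a multiple of the p-th element.\<close>

lemma regular_sequence_syzygy:
  assumes "set fs \<subseteq> carrier R"
    and "\<And>i r. i < length fs \<Longrightarrow> r \<in> carrier R \<Longrightarrow>
      fs ! i \<otimes> r \<in> Idl (set (take i fs)) \<Longrightarrow> r \<in> Idl (set (take i fs))"
    and "p < length fs" "r \<in> carrier R" "fs ! p \<otimes> r \<in> Idl {fs ! i | i. i < length fs \<and> i \<noteq> p}"
  shows "r \<in> Idl (set fs)"
  using assms
proof (induct fs arbitrary: r rule: rev_induct)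
  case Nil
  then show ?case by simp
next
  case (snoc g fs)
  have g: "g \<in> carrier R" and fs: "set fs \<subseteq> carrier R" using snoc.prems(1) by auto
  let ?O = "{fs ! i | i. i < length fs \<and> i \<noteq> p}"
  have O: "?O \<subseteq> carrier R" using fs by (auto simp: subset_iff)
  have Ofs: "?O \<subseteq> set fs" by auto
  have reg: "r \<in> Idl (set (take i fs))"
    if "i < length fs" "r \<in> carrier R" "fs ! i \<otimes> r \<in> Idl (set (take i fs))" for i r
    using snoc.prems(2)[of i r] that by (simp add: nth_append)
  have top: "t \<in> Idl (set fs)" if "t \<in> carrier R" "g \<otimes> t \<in> Idl (set fs)" for t
    using snoc.prems(2)[of "length fs" t] that by simp
  have ins: "set (fs @ [g]) = insert g (set fs)" by simp
  have sub: "Idl (set fs) \<subseteq> Idl (insert g (set fs))"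
    by (rule subset_Idl_subset) (use g fs in auto)
  interpret a: ideal "Idl (set fs)" R by (rule genideal_ideal[OF fs])
  interpret b: ideal "Idl (insert g (set fs))" R by (rule genideal_ideal) (use g fs in auto)
  interpret o: ideal "Idl ?O" R by (rule genideal_ideal[OF O])
  show ?case
  proof (cases "p = length fs")
    case True
    have "{(fs @ [g]) ! i | i. i < length (fs @ [g]) \<and> i \<noteq> p} = set fs"
      using True by (auto simp: set_conv_nth nth_append)
    then have "r \<in> Idl (set fs)" using snoc.prems(4,5) True top by simp
    then show ?thesis using sub ins by auto
  next
    case False
    then have p: "p < length fs" using snoc.prems(3) by simp
    have fp: "fs ! p \<in> carrier R" using p fs by auto
    have eq: "{(fs @ [g]) ! i | i. i < length (fs @ [g]) \<and> i \<noteq> p} = insert g ?O"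
    proof (intro equalityI subsetI)
      fix y assume "y \<in> insert g ?O"
      then consider "y = g" | i where "i < length fs" "i \<noteq> p" "y = fs ! i" by auto
      then show "y \<in> {(fs @ [g]) ! i | i. i < length (fs @ [g]) \<and> i \<noteq> p}"
      proof cases
        case 1
        then show ?thesis using p by (intro CollectI exI[of _ "length fs"]) simp
      next
        case (2 i)
        then show ?thesis by (intro CollectI exI[of _ i]) (simp add: nth_append)
      qed
    qed (auto simp: nth_append split: if_splits)
    have "(fs @ [g]) ! p \<otimes> r = fs ! p \<otimes> r" using p by (simp add: nth_append)
    then have "fs ! p \<otimes> r \<in> Idl (insert g ?O)" using snoc.prems(5) eq by simp
    then obtain s t where st: "s \<in> Idl ?O" "t \<in> carrier R" "fs ! p \<otimes> r = s \<oplus> g \<otimes> t"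
      by (rule Idl_insert_decomp[OF O g])
    have r: "r \<in> carrier R" by fact
    have s: "s \<in> carrier R" "s \<in> Idl (set fs)"
      using st o.Icarr subset_Idl_subset[OF fs Ofs] by auto
    have "g \<otimes> t = fs ! p \<otimes> r \<ominus> s"
      unfolding st(3) using st(2) s(1) g by algebra
    moreover have "fs ! p \<in> Idl (set fs)" using genideal_self[OF fs] p by auto
    ultimately have "g \<otimes> t \<in> Idl (set fs)"
      using s r by (simp add: minus_eq a.I_r_closed)
    then have "t \<in> Idl (set fs)" using top st by blast
    moreover have "set fs = insert (fs ! p) ?O"
      using p by (auto simp: set_conv_nth)
    ultimately have "t \<in> Idl (insert (fs ! p) ?O)" by simp
    then obtain s' t' where st': "s' \<in> Idl ?O" "t' \<in> carrier R" "t = s' \<oplus> fs ! p \<otimes> t'"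
      by (rule Idl_insert_decomp[OF O fp])
    have s': "s' \<in> carrier R" using st' o.Icarr by auto
    \<comment> \<open>Subtracting t' times the Koszul relation between \<open>fs ! p\<close> and g
      replaces t by s', whose product with g lies in \<open>Idl ?O\<close>. What remains is a
      relation among the shorter list.\<close>
    have "fs ! p \<otimes> (r \<ominus> g \<otimes> t') = fs ! p \<otimes> r \<ominus> g \<otimes> (fs ! p \<otimes> t')"
      using fp r g st' by algebra
    also have "\<dots> = s \<oplus> g \<otimes> s'"
      unfolding st(3) st'(3) using fp s(1) s' g st'(2) by algebra
    finally have "fs ! p \<otimes> (r \<ominus> g \<otimes> t') \<in> Idl ?O"
      using st st' g by (simp add: o.I_l_closed)
    then have "r \<ominus> g \<otimes> t' \<in> Idl (set fs)"
      using snoc.hyps[OF fs reg p, of "r \<ominus> g \<otimes> t'"] r g st' by blast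
    then have "r \<ominus> g \<otimes> t' \<in> Idl (insert g (set fs))" using sub by blast
    moreover have "g \<otimes> t' \<in> Idl (insert g (set fs))"
      using genideal_self[of "insert g (set fs)"] g fs st' by (intro b.I_r_closed) auto
    moreover have "r = (r \<ominus> g \<otimes> t') \<oplus> g \<otimes> t'" using r g st' by algebra
    ultimately show ?thesis unfolding ins by (metis b.a_closed)
  qed
qed

text \<open>Splits off one generator g with its coefficient in N, so that the term n g can be
  absorbed into the multiplier of g in the elimination below.\<close>

lemma ideal_prod_insert_decomp:
  assumes N: "ideal N R" and S: "S \<subseteq> carrier R" and g: "g \<in> carrier R"
    and y: "y \<in> ideal_prod R N (Idl (insert g S))"
  shows "\<exists>y1 n. y1 \<in> ideal_prod R N (Idl S) \<and> n \<in> N \<and> y = y1 \<oplus> n \<otimes> g"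
proof -
  interpret N: ideal N R by (rule N)
  interpret P: ideal "ideal_prod R N (Idl S)" R
    by (rule ideal_prod_is_ideal[OF N genideal_ideal[OF S]])
  interpret I: ideal "Idl S" R by (rule genideal_ideal[OF S])
  show ?thesis
    using y
  proof (induct rule: ideal_prod.induct)
    case (prod n j)
    then obtain s t where st: "s \<in> Idl S" "t \<in> carrier R" "j = s \<oplus> g \<otimes> t"
      using Idl_insert_decomp[OF S g prod(2)] by blast
    have "n \<otimes> j = n \<otimes> s \<oplus> (n \<otimes> t) \<otimes> g"
      unfolding st(3) using st prod(1) g N.Icarr I.Icarr by algebra
    moreover have "n \<otimes> s \<in> ideal_prod R N (Idl S)" using prod st by (intro ideal_prod.prod)
    moreover have "n \<otimes> t \<in> N" using prod st by (simp add: N.I_r_closed)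
    ultimately show ?case by blast
  next
    case (sum a b)
    then obtain y1 n y2 m where h: "y1 \<in> ideal_prod R N (Idl S)" "n \<in> N" "a = y1 \<oplus> n \<otimes> g"
      "y2 \<in> ideal_prod R N (Idl S)" "m \<in> N" "b = y2 \<oplus> m \<otimes> g" by blast
    have "a \<oplus> b = (y1 \<oplus> y2) \<oplus> (n \<oplus> m) \<otimes> g"
      unfolding h(3) h(6) using h(1,2,4,5) g N.Icarr P.Icarr by algebra
    then show ?case using h N.a_closed P.a_closed by blast
  qed
qed

text \<open>Multipliers congruent to 1 modulo an ideal accumulate as products, both in the
  elimination of generators and in the descent along the regular sequence.\<close>

lemma one_minus_mult_mem:
  assumes "ideal N R" "u \<in> carrier R" "v \<in> carrier R" "\<one> \<ominus> u \<in> N" "\<one> \<ominus> v \<in> N"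
  shows "\<one> \<ominus> u \<otimes> v \<in> N"
proof -
  interpret N: ideal N R by fact
  have "\<one> \<ominus> u \<otimes> v = (\<one> \<ominus> u) \<oplus> u \<otimes> (\<one> \<ominus> v)" using assms by algebra
  then show ?thesis using assms by (simp add: N.I_l_closed)
qed

lemma a_rearrange:
  "\<lbrakk>a \<in> carrier R; b \<in> carrier R; c \<in> carrier R; d \<in> carrier R\<rbrakk> \<Longrightarrow>
    a \<oplus> (b \<oplus> (c \<oplus> d)) = (a \<oplus> c) \<oplus> (b \<oplus> d)"
  by algebra

text \<open>The element \<open>u\<close> replaces the determinant in Nakayama's lemma; the generators are eliminated
  one at a time.\<close>

lemma nakayama_unit:
  assumes "ideal L R" "ideal N R" "set fs \<subseteq> carrier R" "w \<in> carrier R" "\<one> \<ominus> w \<in> N"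
    and "\<And>f. f \<in> set fs \<Longrightarrow> \<exists>l\<in>L. \<exists>y\<in>ideal_prod R N (Idl (set fs)). w \<otimes> f = l \<oplus> y"
  shows "\<exists>u\<in>carrier R. \<one> \<ominus> u \<in> N \<and> (\<forall>f\<in>set fs. u \<otimes> f \<in> L)"
  using assms(3-)
proof (induct fs arbitrary: w)
  case Nil
  then show ?case by auto
next
  case (Cons g fs)
  interpret L: ideal L R by fact
  interpret N: ideal N R by fact
  have g: "g \<in> carrier R" and fs: "set fs \<subseteq> carrier R" using Cons.prems(1) by auto
  have w: "w \<in> carrier R" by fact
  let ?P = "ideal_prod R N (Idl (set fs))"
  interpret P: ideal ?P R by (rule ideal_prod_is_ideal[OF assms(2) genideal_ideal[OF fs]])
  have dec: "\<exists>l\<in>L. \<exists>y\<in>?P. \<exists>n\<in>N. w \<otimes> f = l \<oplus> (y \<oplus> n \<otimes> g)" if f: "f \<in> set (g # fs)" for f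
  proof -
    obtain l y where "l \<in> L" "y \<in> ideal_prod R N (Idl (insert g (set fs)))" "w \<otimes> f = l \<oplus> y"
      using Cons.prems(4)[OF f] by auto
    then show ?thesis using ideal_prod_insert_decomp[OF assms(2) fs g, of y] by blast
  qed
  obtain l y n where lyn: "l \<in> L" "y \<in> ?P" "n \<in> N" "w \<otimes> g = l \<oplus> (y \<oplus> n \<otimes> g)"
    using dec[of g] by auto
  note lyc = L.Icarr[OF lyn(1)] P.Icarr[OF lyn(2)] N.Icarr[OF lyn(3)]
  \<comment> \<open>The relation for g contains g on both sides. Moving n g to the left leaves the
    multiplier w - n, still congruent to 1 modulo N.\<close>
  define v where "v = w \<ominus> n"
  have v: "v \<in> carrier R" using w lyc by (simp add: v_def)
  have vg: "v \<otimes> g = l \<oplus> y"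
  proof -
    have "v \<otimes> g = w \<otimes> g \<ominus> n \<otimes> g" unfolding v_def using w g lyc by algebra
    also have "\<dots> = l \<oplus> y" unfolding lyn(4) using g lyc by algebra
    finally show ?thesis .
  qed
  have vN: "\<one> \<ominus> v \<in> N"
  proof -
    have "\<one> \<ominus> v = (\<one> \<ominus> w) \<oplus> n" unfolding v_def using w lyc by algebra
    then show ?thesis using Cons.prems(3) lyn by simp
  qed
  have "\<exists>u\<in>carrier R. \<one> \<ominus> u \<in> N \<and> (\<forall>f\<in>set fs. u \<otimes> f \<in> L)"
  proof (rule Cons.hyps[of "v \<otimes> w"])
    show "\<one> \<ominus> v \<otimes> w \<in> N"
      by (rule one_minus_mult_mem) (use assms v w vN Cons.prems in auto)
  next
    fix f assume f: "f \<in> set fs"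
    then have fc: "f \<in> carrier R" using fs by auto
    obtain l' y' n' where h: "l' \<in> L" "y' \<in> ?P" "n' \<in> N" "w \<otimes> f = l' \<oplus> (y' \<oplus> n' \<otimes> g)"
      using dec[of f] f by auto
    note hc = L.Icarr[OF h(1)] P.Icarr[OF h(2)] N.Icarr[OF h(3)]
    \<comment> \<open>Multiplying the relation for f by v turns its g-term into n' v g, where v g is
      known without g. The induction hypothesis then applies to the remaining generators with
      multiplier v w.\<close>
    have e: "n' \<otimes> (v \<otimes> g) = n' \<otimes> l \<oplus> n' \<otimes> y"
      unfolding vg using hc lyc by (simp add: r_distr)
    have "v \<otimes> w \<otimes> f = v \<otimes> (l' \<oplus> (y' \<oplus> n' \<otimes> g))"
      using v w fc h(4) by (simp add: m_assoc)
    also have "\<dots> = v \<otimes> l' \<oplus> (v \<otimes> y' \<oplus> n' \<otimes> (v \<otimes> g))"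
      using v g hc by (simp add: r_distr m_lcomm)
    also have "\<dots> = (v \<otimes> l' \<oplus> n' \<otimes> l) \<oplus> (v \<otimes> y' \<oplus> n' \<otimes> y)"
      unfolding e by (rule a_rearrange) (use v hc lyc in simp_all)
    finally have "v \<otimes> w \<otimes> f = (v \<otimes> l' \<oplus> n' \<otimes> l) \<oplus> (v \<otimes> y' \<oplus> n' \<otimes> y)" .
    moreover have "v \<otimes> l' \<oplus> n' \<otimes> l \<in> L"
      using v h(1) lyn(1) hc by (intro L.a_closed L.I_l_closed)
    moreover have "v \<otimes> y' \<oplus> n' \<otimes> y \<in> ?P"
      using v h(2) lyn(2) hc by (intro P.a_closed P.I_l_closed)
    ultimately show "\<exists>l\<in>L. \<exists>y\<in>?P. v \<otimes> w \<otimes> f = l \<oplus> y" by blast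
  qed (use fs v w in auto)
  then obtain u where u: "u \<in> carrier R" "\<one> \<ominus> u \<in> N" "\<And>f. f \<in> set fs \<Longrightarrow> u \<otimes> f \<in> L" by blast
  \<comment> \<open>The elements that u sends into L form an ideal. It contains \<open>fs\<close>,
    hence the ideal generated by it and all its products with N. This handles g, for which v g = l +
    y.\<close>
  have uP: "u \<otimes> y \<in> L" if "y \<in> ?P" for y
    using that
  proof (induct rule: ideal_prod.induct)
    case (prod i j)
    have "ideal {j \<in> carrier R. u \<otimes> j \<in> L} R"
    proof (rule idealI)
      show "subgroup {j \<in> carrier R. u \<otimes> j \<in> L} (add_monoid R)"
        using u(1) by (intro add.subgroupI) (auto simp: r_distr r_minus intro: exI[of _ \<zero>])
    next
      fix a x assume a: "a \<in> {j \<in> carrier R. u \<otimes> j \<in> L}" and x: "x \<in> carrier R"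
      have "u \<otimes> (x \<otimes> a) = x \<otimes> (u \<otimes> a)" "u \<otimes> (a \<otimes> x) = (u \<otimes> a) \<otimes> x" using a x u(1) by (auto simp: m_ac)
      then show "x \<otimes> a \<in> {j \<in> carrier R. u \<otimes> j \<in> L}" "a \<otimes> x \<in> {j \<in> carrier R. u \<otimes> j \<in> L}"
        using a x by (auto simp: L.I_l_closed L.I_r_closed)
    qed (rule ring_axioms)
    then have "Idl (set fs) \<subseteq> {j \<in> carrier R. u \<otimes> j \<in> L}"
      by (rule genideal_minimal) (use u fs in auto)
    then have j: "j \<in> carrier R" "u \<otimes> j \<in> L" using prod by auto
    have "u \<otimes> (i \<otimes> j) = i \<otimes> (u \<otimes> j)" using u j N.Icarr[OF prod(1)] by (simp add: m_ac)
    then show ?case using j N.Icarr[OF prod(1)] by (simp add: L.I_l_closed)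
  next
    case (sum a b)
    then show ?case using u by (simp add: r_distr P.Icarr)
  qed
  have "u \<otimes> v \<otimes> f \<in> L" if "f \<in> set (g # fs)" for f
  proof (cases "f = g")
    case True
    have "u \<otimes> v \<otimes> g = u \<otimes> l \<oplus> u \<otimes> y" using vg u v g lyc by (simp add: m_assoc r_distr)
    then show ?thesis using True lyn u uP by (simp add: L.I_l_closed)
  next
    case False
    then have f: "f \<in> set fs" "f \<in> carrier R" using that fs by auto
    have "u \<otimes> v \<otimes> f = v \<otimes> (u \<otimes> f)" using u v f by (simp add: m_ac)
    then show ?thesis using u f v by (simp add: L.I_l_closed)
  qed
  moreover have "\<one> \<ominus> u \<otimes> v \<in> N"
    by (rule one_minus_mult_mem) (use assms v u vN in auto)
  ultimately show ?case using u v by blast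
qed

lemma ideal_finsum_closed:
  assumes "ideal N R" "\<And>i. i \<in> S \<Longrightarrow> F i \<in> N"
  shows "(\<Oplus>i\<in>S. F i) \<in> N"
proof -
  interpret N: ideal N R by fact
  show ?thesis
    using assms(2)
  proof (induct S rule: infinite_finite_induct)
    case (insert i S)
    then have "(\<Oplus>i\<in>insert i S. F i) = F i \<oplus> (\<Oplus>i\<in>S. F i)"
      by (intro finsum_insert) (auto intro: N.Icarr)
    then show ?case using insert by simp
  qed (simp_all add: finsum_infinite)
qed

end

section \<open>Lifting the regular sequence to the Koszul complex\<close>

context koszul_complex
begin

interpretation D: dg_ring K involution
  by (rule koszul_dg_ring)

text \<open>For an ideal N this is the subcomplex N K; membership expresses vanishing modulo N while
  all computations stay over A.\<close>

definition coeffs_in :: "'a set \<Rightarrow> (nat set \<Rightarrow> 'a) set"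
  where "coeffs_in N = {w \<in> carrier K. \<forall>S\<subseteq>V. w S \<in> N}"

lemma coeffs_inI: "w \<in> carrier K \<Longrightarrow> (\<And>S. S \<subseteq> V \<Longrightarrow> w S \<in> N) \<Longrightarrow> w \<in> coeffs_in N"
  by (simp add: coeffs_in_def)

lemma coeffs_in_closed: "w \<in> coeffs_in N \<Longrightarrow> w \<in> carrier K"
  by (simp add: coeffs_in_def)

lemma coeffs_in_coeff: "w \<in> coeffs_in N \<Longrightarrow> S \<subseteq> V \<Longrightarrow> w S \<in> N"
  by (simp add: coeffs_in_def)

lemma coeffs_in_mono: "N \<subseteq> N' \<Longrightarrow> coeffs_in N \<subseteq> coeffs_in N'"
  by (auto simp: coeffs_in_def)

lemma coeffs_in_add:
  assumes "ideal N A" "v \<in> coeffs_in N" "w \<in> coeffs_in N"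
  shows "v \<oplus>\<^bsub>K\<^esub> w \<in> coeffs_in N"
proof -
  interpret N: ideal N A by fact
  show ?thesis using assms(2,3) by (auto simp: coeffs_in_def koszul_add_coeff)
qed

lemma coeffs_in_mult_left:
  assumes "ideal N A" "v \<in> carrier K" "w \<in> coeffs_in N"
  shows "v \<otimes>\<^bsub>K\<^esub> w \<in> coeffs_in N"
proof (rule coeffs_inI)
  interpret N: ideal N A by fact
  show "v \<otimes>\<^bsub>K\<^esub> w \<in> carrier K" using assms by (simp add: coeffs_in_closed)
  fix S assume S: "S \<subseteq> V"
  show "(v \<otimes>\<^bsub>K\<^esub> w) S \<in> N"
    unfolding koszul_mult_coeff[OF S]
  proof (rule ideal_finsum_closed[OF assms(1)])
    fix T assume "T \<in> Pow S"
    then have "v T \<in> carrier A" "w (S - T) \<in> N"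
      using S assms(2,3) by (auto intro: coeff_closed coeffs_in_coeff)
    then show "koszul_sign A T (S - T) \<otimes> (v T \<otimes> w (S - T)) \<in> N"
      by (simp add: N.I_l_closed)
  qed
qed

lemma coeffs_in_diff:
  assumes "ideal N A" "w \<in> coeffs_in N"
  shows "diff K w \<in> coeffs_in N"
proof (rule coeffs_inI)
  interpret N: ideal N A by fact
  show "diff K w \<in> carrier K" using assms by (simp add: coeffs_in_closed)
  fix S assume S: "S \<subseteq> V"
  have "diff K w S = (\<Oplus>i\<in>V - S. koszul_sign A {i} S \<otimes> (xs ! i \<otimes> w (insert i S)))"
    using S by (simp add: koszul_diff)
  also have "\<dots> \<in> N"
  proof (rule ideal_finsum_closed[OF assms(1)])
    fix i assume "i \<in> V - S"
    then have "xs ! i \<in> carrier A" "w (insert i S) \<in> N"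
      using S assms(2) by (auto intro: coeffs_in_coeff)
    then show "koszul_sign A {i} S \<otimes> (xs ! i \<otimes> w (insert i S)) \<in> N"
      by (simp add: N.I_l_closed)
  qed
  finally show "diff K w S \<in> N" .
qed

lemma diff_coeff_in_Idl:
  assumes "w \<in> carrier K" "S \<subseteq> V"
  shows "diff K w S \<in> Idl (set xs)"
proof -
  interpret N: ideal "Idl (set xs)" A by (rule genideal_ideal[OF xs_closed])
  show ?thesis
    unfolding diff_coeff_partial[OF assms]
  proof (rule ideal_finsum_closed[OF N.is_ideal])
    fix i assume i: "i \<in> V"
    have "xs ! i \<in> Idl (set xs)"
      using i genideal_self[OF xs_closed] nth_mem by (fastforce simp: V_def)
    moreover have "partial i w S \<in> carrier A"
      using i assms by (intro coeff_closed) auto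
    ultimately show "xs ! i \<otimes> partial i w S \<in> Idl (set xs)" by (rule N.I_r_closed)
  qed
qed

lemma coeffs_in_scalar_mult:
  assumes "ideal N A" "r \<in> N" "w \<in> carrier K"
  shows "scalar r \<otimes>\<^bsub>K\<^esub> w \<in> coeffs_in N"
proof -
  interpret N: ideal N A by fact
  show ?thesis
    using assms(2,3) by (intro coeffs_inI) (simp_all add: scalar_mult_coeff N.I_r_closed coeff_closed N.Icarr)
qed

text \<open>The source of the product ideal \<aa> I: in u f_i z_j the scalar lies in \<aa> and the
  coefficients of z_j lie in I.\<close>

lemma coeffs_in_scalar_prod:
  assumes "ideal N A" "ideal N' A" "r \<in> N" "w \<in> coeffs_in N'"
  shows "scalar r \<otimes>\<^bsub>K\<^esub> w \<in> coeffs_in (ideal_prod A N N')"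
proof -
  interpret N: ideal N A by fact
  have w: "w \<in> carrier K" and r: "r \<in> carrier A"
    using assms(3,4) coeffs_in_closed N.Icarr by auto
  show ?thesis
  proof (rule coeffs_inI)
    fix S assume S: "S \<subseteq> V"
    show "(scalar r \<otimes>\<^bsub>K\<^esub> w) S \<in> ideal_prod A N N'"
      unfolding scalar_mult_coeff[OF r w S] by (rule ideal_prod.prod[OF assms(3) coeffs_in_coeff[OF assms(4) S]])
  qed (use r w in simp)
qed

lemma coeffs_in_involution:
  assumes "ideal N A" "w \<in> coeffs_in N"
  shows "involution w \<in> coeffs_in N"
proof -
  interpret N: ideal N A by fact
  show ?thesis
  proof (rule coeffs_inI)
    fix S assume S: "S \<subseteq> V"
    then show "involution w S \<in> N"
      using coeffs_in_coeff[OF assms(2) S] by (simp add: involution_def N.I_l_closed)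
  qed (simp add: coeffs_in_closed[OF assms(2)])
qed

lemma coeffs_in_insert_decomp:
  assumes "S \<subseteq> carrier A" "g \<in> carrier A" "w \<in> coeffs_in (Idl (insert g S))"
  obtains w1 w2 where "w1 \<in> carrier K" "w2 \<in> coeffs_in (Idl S)" "w = scalar g \<otimes>\<^bsub>K\<^esub> w1 \<oplus>\<^bsub>K\<^esub> w2"
proof -
  interpret I: ideal "Idl S" A by (rule genideal_ideal[OF assms(1)])
  have "\<forall>T\<in>Pow V. \<exists>c. fst c \<in> Idl S \<and> snd c \<in> carrier A \<and> w T = fst c \<oplus> g \<otimes> snd c"
  proof
    fix T assume "T \<in> Pow V"
    then have "w T \<in> Idl (insert g S)" using coeffs_in_coeff[OF assms(3)] by simp
    then obtain s t where "s \<in> Idl S" "t \<in> carrier A" "w T = s \<oplus> g \<otimes> t"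
      by (rule Idl_insert_decomp[OF assms(1,2)])
    then show "\<exists>c. fst c \<in> Idl S \<and> snd c \<in> carrier A \<and> w T = fst c \<oplus> g \<otimes> snd c"
      by (intro exI[of _ "(s, t)"]) simp
  qed
  then obtain c where c: "\<And>T. T \<in> Pow V \<Longrightarrow> fst (c T) \<in> Idl S \<and> snd (c T) \<in> carrier A \<and> w T = fst (c T) \<oplus> g \<otimes> snd (c T)"
    using bchoice by metis
  define w1 where "w1 = (\<lambda>T\<in>Pow V. snd (c T))"
  define w2 where "w2 = (\<lambda>T\<in>Pow V. fst (c T))"
  have w1: "w1 \<in> carrier K" unfolding w1_def by (rule koszul_carrierI) (use c in simp)
  have w2: "w2 \<in> carrier K" unfolding w2_def by (rule koszul_carrierI) (use c I.Icarr in simp)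
  have "w2 \<in> coeffs_in (Idl S)" by (rule coeffs_inI[OF w2]) (use c in \<open>simp add: w2_def\<close>)
  moreover have "w = scalar g \<otimes>\<^bsub>K\<^esub> w1 \<oplus>\<^bsub>K\<^esub> w2"
  proof (rule koszul_ext)
    fix T assume T: "T \<subseteq> V"
    have "w T = fst (c T) \<oplus> g \<otimes> snd (c T)" "fst (c T) \<in> carrier A" "snd (c T) \<in> carrier A"
      using c[of T] T I.Icarr by auto
    then show "w T = (scalar g \<otimes>\<^bsub>K\<^esub> w1 \<oplus>\<^bsub>K\<^esub> w2) T"
      using T assms(2) w1 by (simp add: koszul_add_coeff scalar_mult_coeff w1_def w2_def a_comm)
  qed (use assms coeffs_in_closed w1 w2 in auto)
  ultimately show ?thesis using that w1 by blast
qed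

lemma scalar_mult_scalar:
  assumes "r \<in> carrier A" "s \<in> carrier A"
  shows "scalar r \<otimes>\<^bsub>K\<^esub> scalar s = scalar (r \<otimes> s)"
  using assms by (intro koszul_ext) (auto simp: scalar_mult_coeff scalar_coeff)

lemma scalar_add:
  assumes "r \<in> carrier A" "s \<in> carrier A"
  shows "scalar r \<oplus>\<^bsub>K\<^esub> scalar s = scalar (r \<oplus> s)"
  using assms by (intro koszul_ext) (auto simp: koszul_add_coeff scalar_coeff)

lemma diff_scalar_mult:
  assumes "r \<in> carrier A" "w \<in> carrier K"
  shows "diff K (scalar r \<otimes>\<^bsub>K\<^esub> w) = scalar r \<otimes>\<^bsub>K\<^esub> diff K w"
proof -
  have "involution (scalar r) = scalar r"
    using assms by (intro koszul_ext involution_closed) (auto simp: involution_def scalar_coeff)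
  moreover have "diff K (scalar r) = \<zero>\<^bsub>K\<^esub>"
  proof (rule koszul_ext)
    fix S assume S: "S \<subseteq> V"
    have "diff K (scalar r) S = (\<Oplus>i\<in>V. \<zero>)"
      unfolding diff_coeff_partial[OF scalar_closed[OF assms(1)] S]
      by (rule finsum_congI) (use S in \<open>auto simp: partial_def scalar_coeff\<close>)
    then show "diff K (scalar r) S = \<zero>\<^bsub>K\<^esub> S" using S by (simp add: koszul_zero_coeff)
  qed (use assms in auto)
  ultimately show ?thesis using assms by (simp add: D.diff_mult)
qed

text \<open>A product of a generator x_k with j in N is the differential of j e_k, and the set Q of
  scalars that can be lifted in this way is closed under addition and under multiplication by
  A.\<close>

lemma lift_scalar:
  assumes N: "ideal N A" and r: "r \<in> ideal_prod A (Idl (set xs)) N"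
  shows "\<exists>z\<in>coeffs_in N. z \<in> piece K 1 \<and> diff K z = scalar r"
proof -
  interpret N: ideal N A by (rule N)
  define Q where "Q = {r \<in> carrier A. \<exists>z\<in>coeffs_in N. z \<in> piece K 1 \<and> diff K z = scalar r}"
  have Q_add: "r \<oplus> s \<in> Q" if rs: "r \<in> Q" "s \<in> Q" for r s
  proof -
    obtain y z where yz: "y \<in> coeffs_in N" "y \<in> piece K 1" "diff K y = scalar r"
      "z \<in> coeffs_in N" "z \<in> piece K 1" "diff K z = scalar s" using rs by (auto simp: Q_def)
    have c: "y \<in> carrier K" "z \<in> carrier K" "r \<in> carrier A" "s \<in> carrier A"
      using yz rs coeffs_in_closed by (auto simp: Q_def)
    have "y \<oplus>\<^bsub>K\<^esub> z \<in> piece K 1"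
      using yz c by (auto simp: koszul_piece koszul_add_coeff)
    then show ?thesis
      unfolding Q_def using c yz coeffs_in_add[OF N yz(1,4)] by (auto simp: D.diff_add scalar_add)
  qed
  have Q_mult: "s \<otimes> r \<in> Q" if rs: "r \<in> Q" "s \<in> carrier A" for r s
  proof -
    obtain z where z: "z \<in> coeffs_in N" "z \<in> piece K 1" "diff K z = scalar r"
      using rs by (auto simp: Q_def)
    have c: "z \<in> carrier K" "r \<in> carrier A"
      using z rs coeffs_in_closed by (auto simp: Q_def)
    have "scalar s \<otimes>\<^bsub>K\<^esub> z \<in> piece K 1"
      using z c rs by (auto simp: koszul_piece scalar_mult_coeff)
    moreover have "scalar s \<otimes>\<^bsub>K\<^esub> z \<in> coeffs_in N"
      by (rule coeffs_in_mult_left[OF N]) (use z rs in auto)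
    ultimately show ?thesis
      unfolding Q_def using c rs z by (auto simp: diff_scalar_mult scalar_mult_scalar)
  qed
  have Q_gen: "xs ! k \<otimes> j \<in> Q" if k: "k \<in> V" and j: "j \<in> N" for k j
  proof -
    have jc: "j \<in> carrier A" using j by (rule N.Icarr)
    \<comment> \<open>This is j e_k.\<close>
    define z where "z = (\<lambda>S\<in>Pow V. if S = {k} then j else \<zero>)"
    have z: "z \<in> carrier K" unfolding z_def by (rule koszul_carrierI) (use jc in auto)
    have "z \<in> coeffs_in N" by (rule coeffs_inI[OF z]) (use j in \<open>auto simp: z_def\<close>)
    moreover have "z \<in> piece K 1" using z by (auto simp: koszul_piece z_def)
    moreover have "diff K z = scalar (xs ! k \<otimes> j)"
    proof (rule koszul_ext)
      fix S assume S: "S \<subseteq> V"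
      have "diff K z S = (\<Oplus>i\<in>V. if k = i then (if S = {} then xs ! i \<otimes> j else \<zero>) else \<zero>)"
        unfolding diff_coeff_partial[OF z S]
      proof (rule finsum_congI)
        fix i assume i: "i \<in> V"
        have "i \<notin> S \<Longrightarrow> insert i S = {k} \<longleftrightarrow> S = {} \<and> i = k" by auto
        then show "xs ! i \<otimes> partial i z S = (if k = i then (if S = {} then xs ! i \<otimes> j else \<zero>) else \<zero>)"
          using i S k jc by (auto simp: partial_def z_def koszul_sign_eq)
      qed (use jc in auto)
      also have "\<dots> = (if S = {} then xs ! k \<otimes> j else \<zero>)"
        by (rule finsum_singleton) (use k jc in auto)
      finally show "diff K z S = scalar (xs ! k \<otimes> j) S" using S by (simp add: scalar_coeff)
    qed (use z k jc in auto)
    ultimately show ?thesis unfolding Q_def using k jc by auto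
  qed
  have Q_zero: "\<zero> \<in> Q"
  proof -
    have "diff K \<zero>\<^bsub>K\<^esub> = scalar \<zero>"
      unfolding D.diff_zero by (simp add: koszul_zero scalar_def cong: restrict_cong)
    moreover have "\<zero>\<^bsub>K\<^esub> \<in> coeffs_in N" by (rule coeffs_inI) (auto simp: koszul_zero_coeff)
    ultimately show ?thesis unfolding Q_def using D.piece_zero by blast
  qed
  from r have "r \<in> Q"
  proof (induct rule: ideal_prod.induct)
    case (prod i j)
    have jc: "j \<in> carrier A" using prod N.Icarr by auto
    \<comment> \<open>The first factor is an arbitrary element of \<open>Idl (set xs)\<close>,
      whereas liftability is known for the generators only. With j fixed, the admissible first
      factors form an ideal containing them.\<close>
    have "ideal {i \<in> carrier A. i \<otimes> j \<in> Q} A"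
    proof (rule idealI)
      show "subgroup {i \<in> carrier A. i \<otimes> j \<in> Q} (add_monoid A)"
      proof (rule add.subgroupI)
        show "{i \<in> carrier A. i \<otimes> j \<in> Q} \<noteq> {}" using Q_zero jc by (auto intro!: exI[of _ \<zero>])
      next
        fix a assume a: "a \<in> {i \<in> carrier A. i \<otimes> j \<in> Q}"
        have "(\<ominus> a) \<otimes> j = (\<ominus> \<one>) \<otimes> (a \<otimes> j)" using a jc by (simp add: l_minus)
        then show "\<ominus> a \<in> {i \<in> carrier A. i \<otimes> j \<in> Q}" using a jc Q_mult[of "a \<otimes> j" "\<ominus> \<one>"] by simp
      next
        fix a b assume "a \<in> {i \<in> carrier A. i \<otimes> j \<in> Q}" "b \<in> {i \<in> carrier A. i \<otimes> j \<in> Q}"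
        then show "a \<oplus> b \<in> {i \<in> carrier A. i \<otimes> j \<in> Q}" using jc Q_add by (simp add: l_distr)
      qed auto
    next
      fix a x assume a: "a \<in> {i \<in> carrier A. i \<otimes> j \<in> Q}" and x: "x \<in> carrier A"
      have "x \<otimes> a \<otimes> j = x \<otimes> (a \<otimes> j)" "a \<otimes> x \<otimes> j = x \<otimes> (a \<otimes> j)"
        using a x jc by (simp_all add: m_ac)
      then show "x \<otimes> a \<in> {i \<in> carrier A. i \<otimes> j \<in> Q}" "a \<otimes> x \<in> {i \<in> carrier A. i \<otimes> j \<in> Q}"
        using a x Q_mult[of "a \<otimes> j" x] by auto
    qed (rule ring_axioms)
    moreover have "set xs \<subseteq> {i \<in> carrier A. i \<otimes> j \<in> Q}"
      using Q_gen[OF _ prod(2)] xs_closed by (auto simp: set_conv_nth V_def subset_iff)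
    ultimately have "Idl (set xs) \<subseteq> {i \<in> carrier A. i \<otimes> j \<in> Q}" by (rule genideal_minimal)
    then show ?case using prod by auto
  next
    case (sum a b)
    then show ?case using Q_add by simp
  qed
  then show ?thesis by (simp add: Q_def)
qed

text \<open>New factors go on the left, so that the first Leibniz term is the scalar d(z_p) times
  the shorter chain, with no sign.\<close>

fun chain :: "(nat \<Rightarrow> nat set \<Rightarrow> 'a) \<Rightarrow> nat \<Rightarrow> nat set \<Rightarrow> 'a"
  where "chain z 0 = \<one>\<^bsub>K\<^esub>"
  | "chain z (Suc p) = z p \<otimes>\<^bsub>K\<^esub> chain z p"

lemma chain_closed: "(\<And>i. i < p \<Longrightarrow> z i \<in> carrier K) \<Longrightarrow> chain z p \<in> carrier K"
  by (induct p) auto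

text \<open>The differential of \<open>z\<^sub>p z\<^bsub>p-1\<^esub> \<cdots> z\<^sub>0\<close> is \<open>u f\<^sub>p z\<^bsub>p-1\<^esub> \<cdots> z\<^sub>0\<close> modulo the other \<open>f\<^sub>i\<close>. If the product
  were a boundary modulo the ideal generated by the regular sequence, comparing the coefficients of \<open>f\<^sub>p\<close> would show the same for
  \<open>z\<^bsub>p-1\<^esub> \<cdots> z\<^sub>0\<close>, and finally for a unit modulo \<open>M\<close>.\<close>

lemma chain_not_boundary:
  assumes M: "ideal M A" "\<one> \<notin> M" "set xs \<subseteq> M"
    and fs: "set fs \<subseteq> M"
    and syz: "\<And>p r. p < length fs \<Longrightarrow> r \<in> carrier A \<Longrightarrow>
      fs ! p \<otimes> r \<in> Idl {fs ! i | i. i < length fs \<and> i \<noteq> p} \<Longrightarrow> r \<in> Idl (set fs)"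
    and u: "u \<in> carrier A" "\<one> \<ominus> u \<in> M"
    and z: "\<And>i. i < length fs \<Longrightarrow> z i \<in> carrier K \<and> diff K (z i) = scalar (u \<otimes> fs ! i)"
    and p: "p \<le> length fs"
    and v: "v \<in> carrier A" "\<one> \<ominus> v \<in> M"
    and w: "w \<in> carrier K" and y: "y \<in> coeffs_in (Idl (set fs))"
  shows "scalar v \<otimes>\<^bsub>K\<^esub> chain z p \<noteq> diff K w \<oplus>\<^bsub>K\<^esub> y"
proof -
  interpret M: ideal M A by (rule M(1))
  have fsc: "set fs \<subseteq> carrier A" using fs M.Icarr by auto
  have nth: "fs ! i \<in> carrier A" if "i < length fs" for i using fsc that by auto
  have cc: "chain z p \<in> carrier K" if "p \<le> length fs" for p
    using z that by (intro chain_closed) auto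
  \<comment> \<open>Every term of the differential of a chain carries some f_i of index below its
    length. For the next factor z_p this means that the second Leibniz term avoids f_p.\<close>
  have dchain: "diff K (chain z p) \<in> coeffs_in (Idl {fs ! i | i. i < p})" if "p \<le> length fs" for p
    using that
  proof (induct p)
    case 0
    have "ideal (Idl {}) A" by (rule genideal_ideal) simp
    then have "\<zero> \<in> Idl {}" by (simp add: additive_subgroup.zero_closed ideal_def)
    then show ?case by (auto intro!: coeffs_inI simp: koszul_zero_coeff)
  next
    case (Suc p)
    let ?I = "Idl {fs ! i | i. i < Suc p}"
    have sub: "{fs ! i | i. i < Suc p} \<subseteq> carrier A" using nth Suc.prems by auto
    have I: "ideal ?I A" by (rule genideal_ideal[OF sub])
    interpret I: ideal ?I A by (rule I)
    have zp: "z p \<in> carrier K" "diff K (z p) = scalar (u \<otimes> fs ! p)" using z Suc.prems by auto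
    have "fs ! p \<in> ?I" using genideal_self[OF sub] by auto
    then have 1: "scalar (u \<otimes> fs ! p) \<otimes>\<^bsub>K\<^esub> chain z p \<in> coeffs_in ?I"
      using u cc Suc.prems by (intro coeffs_in_scalar_mult[OF I]) (auto intro: I.I_l_closed)
    have "Idl {fs ! i | i. i < p} \<subseteq> ?I"
      by (rule subset_Idl_subset[OF sub]) auto
    then have "diff K (chain z p) \<in> coeffs_in ?I"
      using Suc coeffs_in_mono by (meson Suc_leD subsetD)
    then have "involution (z p) \<otimes>\<^bsub>K\<^esub> diff K (chain z p) \<in> coeffs_in ?I"
      using zp by (intro coeffs_in_mult_left[OF I]) auto
    then show ?case
      using coeffs_in_add[OF I 1] zp cc[of p] Suc.prems by (simp add: D.diff_mult)
  qed
  show ?thesis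
    using p v w y
  proof (induct p arbitrary: v w y)
    \<comment> \<open>The coefficient at the empty set is v on the left. On the right it is an
      element of (x) plus one of \<aa>, hence lies in M, against v being congruent to 1.\<close>
    case 0
    show ?case
    proof
      assume eq: "scalar v \<otimes>\<^bsub>K\<^esub> chain z 0 = diff K w \<oplus>\<^bsub>K\<^esub> y"
      have "v = (diff K w \<oplus>\<^bsub>K\<^esub> y) {}"
        using 0 arg_cong[OF eq, of "\<lambda>x. x {}"] by (simp add: scalar_mult_coeff koszul_one_coeff scalar_coeff)
      then have "v = diff K w {} \<oplus> y {}" by (simp add: koszul_add_coeff)
      moreover have "diff K w {} \<in> M"
        using diff_coeff_in_Idl[OF 0(4), of "{}"] genideal_minimal[OF M(1,3)] by auto
      moreover have "y {} \<in> M"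
        using coeffs_in_coeff[OF 0(5), of "{}"] genideal_minimal[OF M(1) fs] by auto
      ultimately have "v \<in> M" by simp
      moreover have "\<one> = (\<one> \<ominus> v) \<oplus> v" using 0(2) by algebra
      ultimately show False using 0(3) M(2) M.a_closed by metis
    qed
  next
    case (Suc p)
    show ?case
    proof
      assume eq: "scalar v \<otimes>\<^bsub>K\<^esub> chain z (Suc p) = diff K w \<oplus>\<^bsub>K\<^esub> y"
      have p: "p < length fs" using Suc.prems by simp
      let ?O = "{fs ! i | i. i < length fs \<and> i \<noteq> p}"
      have Oc: "?O \<subseteq> carrier A" using nth by auto
      have O: "ideal (Idl ?O) A" by (rule genideal_ideal[OF Oc])
      interpret O: ideal "Idl ?O" A by (rule O)
      have fp: "fs ! p \<in> carrier A" using nth p by auto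
      have "set fs = insert (fs ! p) ?O" using p by (auto simp: set_conv_nth)
      then have "y \<in> coeffs_in (Idl (insert (fs ! p) ?O))" using Suc.prems by simp
      then obtain y1 y2 where y12: "y1 \<in> carrier K" "y2 \<in> coeffs_in (Idl ?O)"
        "y = scalar (fs ! p) \<otimes>\<^bsub>K\<^esub> y1 \<oplus>\<^bsub>K\<^esub> y2"
        by (rule coeffs_in_insert_decomp[OF Oc fp])
      have y2: "y2 \<in> carrier K" using y12 coeffs_in_closed by auto
      have zp: "z p \<in> carrier K" "diff K (z p) = scalar (u \<otimes> fs ! p)" using z p by auto
      have cp: "chain z p \<in> carrier K" using cc p by auto
      define t where "t = involution (z p) \<otimes>\<^bsub>K\<^esub> diff K (chain z p)"
      have tc: "t \<in> carrier K" using zp cp by (simp add: t_def)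
      have "Idl {fs ! i | i. i < p} \<subseteq> Idl ?O"
        by (rule subset_Idl_subset[OF Oc]) (use p in auto)
      then have "diff K (chain z p) \<in> coeffs_in (Idl ?O)"
        using dchain[of p] coeffs_in_mono p by (meson less_imp_le subsetD)
      then have t: "t \<in> coeffs_in (Idl ?O)"
        unfolding t_def using zp by (intro coeffs_in_mult_left[OF O]) auto
      \<comment> \<open>Differentiating the assumed equation removes the boundary d w. What is left
        compares the f_p-part of the chain with that of y, up to terms \<open>t\<close> and
        \<open>diff K y2\<close> with coefficients in \<open>Idl ?O\<close>.\<close>
      have "diff K (scalar v \<otimes>\<^bsub>K\<^esub> chain z (Suc p)) = scalar v \<otimes>\<^bsub>K\<^esub> (scalar (u \<otimes> fs ! p) \<otimes>\<^bsub>K\<^esub> chain z p \<oplus>\<^bsub>K\<^esub> t)"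
      proof -
        have "diff K (chain z (Suc p)) = scalar (u \<otimes> fs ! p) \<otimes>\<^bsub>K\<^esub> chain z p \<oplus>\<^bsub>K\<^esub> t"
          using zp cp by (simp add: D.diff_mult t_def)
        moreover have "chain z (Suc p) \<in> carrier K" using zp cp by simp
        ultimately show ?thesis using diff_scalar_mult[OF Suc.prems(2)] by metis
      qed
      moreover have "diff K (diff K w \<oplus>\<^bsub>K\<^esub> y) = scalar (fs ! p) \<otimes>\<^bsub>K\<^esub> diff K y1 \<oplus>\<^bsub>K\<^esub> diff K y2"
        using Suc.prems(4) y12 y2 fp by (simp add: D.diff_add diff_scalar_mult)
      ultimately have deq: "scalar v \<otimes>\<^bsub>K\<^esub> (scalar (u \<otimes> fs ! p) \<otimes>\<^bsub>K\<^esub> chain z p \<oplus>\<^bsub>K\<^esub> t) =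
          scalar (fs ! p) \<otimes>\<^bsub>K\<^esub> diff K y1 \<oplus>\<^bsub>K\<^esub> diff K y2"
        using eq by simp
      have dy2: "diff K y2 \<in> coeffs_in (Idl ?O)" by (rule coeffs_in_diff[OF O y12(2)])
      have vu: "v \<otimes> u \<in> carrier A" using Suc.prems(2) u by simp
      \<comment> \<open>This error term makes the shorter chain, with multiplier v u, equal to d y1
        + y'. Each coefficient of y' times f_p lies in \<open>Idl ?O\<close>, so by
        \<open>syz\<close> the coefficients are in the ideal of the whole sequence, as the induction
        hypothesis requires.\<close>
      define y' where "y' = scalar (v \<otimes> u) \<otimes>\<^bsub>K\<^esub> chain z p \<ominus>\<^bsub>K\<^esub> diff K y1"
      have y'c: "y' \<in> carrier K" using vu cp y12 by (simp add: y'_def)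
      have "y' \<in> coeffs_in (Idl (set fs))"
      proof (rule coeffs_inI[OF y'c])
        fix S assume S: "S \<subseteq> V"
        have cl: "chain z p S \<in> carrier A" "t S \<in> carrier A" "diff K y1 S \<in> carrier A" "diff K y2 S \<in> carrier A"
          using S cp tc y12(1) y2 by (auto intro: coeff_closed)
        have e: "v \<otimes> (u \<otimes> fs ! p \<otimes> chain z p S \<oplus> t S) = fs ! p \<otimes> diff K y1 S \<oplus> diff K y2 S"
          using arg_cong[OF deq, of "\<lambda>x. x S"] S Suc.prems(2) u fp cp tc y12(1) y2
          by (simp add: koszul_add_coeff scalar_mult_coeff)
        have "y' S = v \<otimes> u \<otimes> chain z p S \<ominus> diff K y1 S"
          unfolding y'_def a_minus_def using S vu cp y12(1)
          by (simp add: koszul_add_coeff scalar_mult_coeff koszul_a_inv_coeff)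
        then have "fs ! p \<otimes> y' S = v \<otimes> (u \<otimes> fs ! p \<otimes> chain z p S \<oplus> t S) \<ominus> fs ! p \<otimes> diff K y1 S \<ominus> v \<otimes> t S"
          using cl fp Suc.prems(2) u by (simp only:) algebra
        also have "\<dots> = diff K y2 S \<ominus> v \<otimes> t S"
          unfolding e using cl fp Suc.prems(2) by algebra
        also have "\<dots> \<in> Idl ?O"
          using coeffs_in_coeff[OF dy2 S] coeffs_in_coeff[OF t S] Suc.prems(2)
          by (simp add: a_minus_def O.I_l_closed)
        finally show "y' S \<in> Idl (set fs)"
          using syz[OF p] coeff_closed[OF y'c S] by blast
      qed
      moreover have "\<one> \<ominus> v \<otimes> u \<in> M"
        by (rule one_minus_mult_mem) (use M(1) Suc.prems u in auto)
      moreover have "scalar (v \<otimes> u) \<otimes>\<^bsub>K\<^esub> chain z p = diff K y1 \<oplus>\<^bsub>K\<^esub> y'"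
        unfolding y'_def using vu cp y12(1) by (intro D.add_minus_cancel[symmetric]) auto
      ultimately show False
        using Suc.hyps[of "v \<otimes> u" y1 y'] p vu y12(1) by auto
    qed
  qed
qed

end

section \<open>Quotients by products of ideals\<close>

context koszul_hom
begin

lemma koszul_map_surj:
  assumes "carrier B \<subseteq> h ` carrier A" and w: "w \<in> carrier L"
  obtains w' where "w' \<in> carrier K" "\<phi> w' = w"
proof -
  have "\<forall>S\<in>Pow V. \<exists>a. a \<in> carrier A \<and> h a = w S"
  proof
    fix S assume "S \<in> Pow V"
    then have "w S \<in> carrier B" using w by (intro target.coeff_closed) (auto simp: target_V)
    then show "\<exists>a. a \<in> carrier A \<and> h a = w S" using assms(1) by (metis imageE subsetD)
  qed
  then obtain a where a: "\<And>S. S \<in> Pow V \<Longrightarrow> a S \<in> carrier A \<and> h (a S) = w S"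
    using bchoice by metis
  define w' where "w' = (\<lambda>S\<in>Pow V. a S)"
  have w': "w' \<in> carrier K" unfolding w'_def by (rule koszul_carrierI) (use a in simp)
  moreover have "\<phi> w' = w"
    by (rule target.koszul_ext) (use w w' a in \<open>auto intro!: koszul_map_closed simp: koszul_map_coeff target_V w'_def\<close>)
  ultimately show ?thesis using that by blast
qed

lemma koszul_map_piece: "w \<in> piece K p \<Longrightarrow> \<phi> w \<in> piece L p"
  by (auto simp: koszul_piece target.koszul_piece target_V koszul_map_coeff intro: koszul_map_closed)

end

lemma (in koszul_complex) piece_mult:
  assumes f: "f \<in> piece K p" and g: "g \<in> piece K q"
  shows "f \<otimes>\<^bsub>K\<^esub> g \<in> piece K (p + q)"
proof -
  have c: "f \<in> carrier K" "g \<in> carrier K" using f g by (auto simp: koszul_piece)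
  have "(f \<otimes>\<^bsub>K\<^esub> g) S = \<zero>" if S: "S \<subseteq> V" "card S \<noteq> p + q" for S
  proof -
    have "(f \<otimes>\<^bsub>K\<^esub> g) S = (\<Oplus>T\<in>Pow S. \<zero>)"
      unfolding koszul_mult_coeff[OF S(1)]
    proof (rule finsum_congI)
      fix T assume "T \<in> Pow S"
      then have T: "T \<subseteq> V" "S - T \<subseteq> V" "card S = card T + card (S - T)"
        using S finite_subset_V[OF S(1)] by (auto simp: card_Diff_subset finite_subset card_mono)
      then have "f T = \<zero> \<or> g (S - T) = \<zero>"
        using f g S by (cases "card T = p") (auto simp: koszul_piece)
      then show "koszul_sign A T (S - T) \<otimes> (f T \<otimes> g (S - T)) = \<zero>"
        using coeff_closed[OF c(1) T(1)] coeff_closed[OF c(2) T(2)] by auto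
    qed simp
    then show ?thesis by simp
  qed
  then show ?thesis using koszul_mult_closed[OF c] by (auto simp: koszul_piece)
qed

context cring
begin

lemma quotient_eq_iff:
  assumes "ideal J R" "a \<in> carrier R" "b \<in> carrier R"
  shows "J +> a = J +> b \<longleftrightarrow> a \<ominus> b \<in> J"
  using quotient_eq_iff_same_a_r_cos[OF assms] by auto

text \<open>The argument common to the local and the graded case; M stands for the maximal or the
  irrelevant ideal and enters as a proper ideal containing I.\<close>

lemma koszul_not_golod:
  assumes fs: "set fs \<subseteq> carrier R"
    and reg: "\<And>i r. i < length fs \<Longrightarrow> r \<in> carrier R \<Longrightarrow>
      fs ! i \<otimes> r \<in> Idl (set (take i fs)) \<Longrightarrow> r \<in> Idl (set (take i fs))"
    and four: "4 \<le> length fs"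
    and I: "ideal I R" and M: "ideal M R" "\<one> \<notin> M" "I \<subseteq> M"
    and aMI: "Idl (set fs) \<subseteq> ideal_prod R M I"
    and J: "J = ideal_prod R (Idl (set fs)) I"
    and ys: "set ys \<subseteq> carrier (R Quot J)" "Idl\<^bsub>R Quot J\<^esub> (set ys) = (+>) J ` M"
  shows "\<not> admits_trivial_massey_operation (koszul (R Quot J) ys)"
proof
  assume "admits_trivial_massey_operation (koszul (R Quot J) ys)"
  then obtain \<B> \<nu> where massey: "homogeneous_basis (koszul (R Quot J) ys) \<B>"
    "trivial_massey_operation (koszul (R Quot J) ys) \<B> \<nu>"
    by (auto simp: admits_trivial_massey_operation_def)
  let ?a = "Idl (set fs)"
  interpret I: ideal I R by (rule I)
  interpret M: ideal M R by (rule M(1))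
  interpret a: ideal ?a R by (rule genideal_ideal[OF fs])
  interpret J: ideal J R unfolding J by (rule ideal_prod_is_ideal[OF a.is_ideal I])
  have aM: "?a \<subseteq> M" using aMI ideal_prod_inter[OF M(1) I] by auto
  have Ja: "J \<subseteq> ?a" unfolding J using ideal_prod_inter[OF a.is_ideal I] by auto
  let ?h = "(+>) J"
  interpret h: ring_hom_cring R "R Quot J" ?h
    by (rule J.rcos_ring_hom_cring[OF is_cring])
  have surj: "carrier (R Quot J) \<subseteq> ?h ` carrier R"
    unfolding FactRing_def A_RCOSETS_def' by auto
  \<comment> \<open>The regular sequence lives in R, so the Koszul generators are lifted there. The
    complex over R maps coefficientwise onto the one over the quotient.\<close>
  obtain lift where lift: "\<And>y. y \<in> set ys \<Longrightarrow> lift y \<in> carrier R \<and> ?h (lift y) = y"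
  proof -
    have "\<forall>y\<in>set ys. \<exists>x. x \<in> carrier R \<and> ?h x = y" using ys(1) surj by blast
    then show ?thesis using that bchoice by metis
  qed
  define xs where "xs = map lift ys"
  have xs: "set xs \<subseteq> carrier R" "map ?h xs = ys"
    using lift by (auto simp: xs_def intro: map_idI)
  have xsM: "set xs \<subseteq> M"
  proof
    fix x assume x: "x \<in> set xs"
    have "ring (R Quot J)" by (rule J.quotient_is_ring)
    then have "set ys \<subseteq> ?h ` M" using ring.genideal_self[of "R Quot J" "set ys"] ys by simp
    moreover have "?h x \<in> set ys" using x unfolding xs(2)[symmetric] by simp
    ultimately obtain m where m: "m \<in> M" "?h x = ?h m" by auto
    then have "x \<ominus> m \<in> J" using quotient_eq_iff[OF J.is_ideal, of x m] x xs(1) M.Icarr by auto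
    then have "x \<ominus> m \<in> M" using Ja aM by auto
    moreover have "x = (x \<ominus> m) \<oplus> m" using x xs(1) M.Icarr[OF m(1)] by (auto simp: minus_eq a_assoc l_neg)
    ultimately show "x \<in> M" using m M.a_closed by metis
  qed
  let ?X = "Idl (set xs)"
  interpret X: ideal ?X R by (rule genideal_ideal[OF xs(1)])
  \<comment> \<open>In other words M is contained in (x) + J, because the lifts generate M in the
    quotient.\<close>
  have Mdec: "\<exists>l\<in>?X. m \<ominus> l \<in> J" if m: "m \<in> M" for m
  proof -
    have id: "ideal (?h ` ?X) (R Quot J)"
      by (rule ring_ideal_imp_quot_ideal[OF J.is_ideal X.is_ideal])
    have "set ys \<subseteq> ?h ` ?X"
      using genideal_self[OF xs(1)] unfolding xs(2)[symmetric] by auto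
    then have "Idl\<^bsub>R Quot J\<^esub> (set ys) \<subseteq> ?h ` ?X"
      by (rule ring.genideal_minimal[OF J.quotient_is_ring id])
    then have "?h ` M \<subseteq> ?h ` ?X" unfolding ys(2) .
    then obtain l where "l \<in> ?X" "?h m = ?h l" using m by auto
    then show ?thesis using quotient_eq_iff[OF J.is_ideal, of m l] X.Icarr M.Icarr m by auto
  qed
  \<comment> \<open>Nakayama with L = (x) I and N = I. Since \<aa> lies in M I, and M lies in (x) +
    J with J inside \<aa>, each f is in (x) I + I \<aa>.\<close>
  have "\<exists>u\<in>carrier R. \<one> \<ominus> u \<in> I \<and> (\<forall>f\<in>set fs. u \<otimes> f \<in> ideal_prod R ?X I)"
  proof (rule nakayama_unit[where w = \<one>])
    show "\<one> \<ominus> \<one> \<in> I" by (simp add: minus_eq r_neg)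
    fix f assume f: "f \<in> set fs"
    interpret L: ideal "ideal_prod R ?X I" R by (rule ideal_prod_is_ideal[OF X.is_ideal I])
    interpret P: ideal "ideal_prod R I ?a" R by (rule ideal_prod_is_ideal[OF I a.is_ideal])
    have "f \<in> ideal_prod R M I" using f aMI genideal_self[OF fs] by auto
    then have "\<exists>l\<in>ideal_prod R ?X I. \<exists>y\<in>ideal_prod R I ?a. f = l \<oplus> y"
    proof (induct rule: ideal_prod.induct)
      case (prod m i)
      then obtain l where l: "l \<in> ?X" "m \<ominus> l \<in> J" using Mdec by blast
      have c: "m \<in> carrier R" "l \<in> carrier R" "i \<in> carrier R"
        using prod l M.Icarr X.Icarr I.Icarr by auto
      have "m \<otimes> i = l \<otimes> i \<oplus> i \<otimes> (m \<ominus> l)" using c by algebra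
      moreover have "l \<otimes> i \<in> ideal_prod R ?X I" "i \<otimes> (m \<ominus> l) \<in> ideal_prod R I ?a"
        using l prod Ja by (auto intro: ideal_prod.prod)
      ultimately show ?case by blast
    next
      case (sum s t)
      then obtain l y l' y' where h: "l \<in> ideal_prod R ?X I" "y \<in> ideal_prod R I ?a" "s = l \<oplus> y"
        "l' \<in> ideal_prod R ?X I" "y' \<in> ideal_prod R I ?a" "t = l' \<oplus> y'" by blast
      have "s \<oplus> t = (l \<oplus> l') \<oplus> (y \<oplus> y')"
        unfolding h(3,6) using h L.Icarr P.Icarr by (simp add: a_ac)
      then show ?case using h L.a_closed P.a_closed by blast
    qed
    moreover have "\<one> \<otimes> f = f" using f fs by (intro l_one) auto
    ultimately show "\<exists>l\<in>ideal_prod R ?X I. \<exists>y\<in>ideal_prod R I ?a. \<one> \<otimes> f = l \<oplus> y"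
      by (simp only:)
  qed (use fs I ideal_prod_is_ideal[OF X.is_ideal I] in auto)
  then obtain u where u: "u \<in> carrier R" "\<one> \<ominus> u \<in> I" "\<And>f. f \<in> set fs \<Longrightarrow> u \<otimes> f \<in> ideal_prod R ?X I"
    by blast
  interpret K: koszul_hom R xs "R Quot J" ?h
    by unfold_locales (rule xs(1))
  interpret D: dg_ring K.K K.involution by (rule K.koszul_dg_ring)
  interpret E: dg_ring K.L K.target.involution by (rule K.target.koszul_dg_ring)
  have "\<forall>f\<in>set fs. \<exists>z. z \<in> K.coeffs_in I \<and> z \<in> piece K.K 1 \<and> diff K.K z = K.scalar (u \<otimes> f)"
    using K.lift_scalar[OF I] u(3) by blast
  then obtain \<zeta> where \<zeta>: "\<And>f. f \<in> set fs \<Longrightarrow>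
      \<zeta> f \<in> K.coeffs_in I \<and> \<zeta> f \<in> piece K.K 1 \<and> diff K.K (\<zeta> f) = K.scalar (u \<otimes> f)"
    using bchoice by metis
  have pair: "K.\<phi> (\<zeta> f \<otimes>\<^bsub>K.K\<^esub> \<zeta> g) \<in> dg_cycles K.L \<and> K.\<phi> (\<zeta> f \<otimes>\<^bsub>K.K\<^esub> \<zeta> g) \<in> piece K.L 2"
    if fg: "f \<in> set fs" "g \<in> set fs" for f g
  proof
    let ?w = "\<zeta> f \<otimes>\<^bsub>K.K\<^esub> \<zeta> g"
    have c: "\<zeta> f \<in> carrier K.K" "\<zeta> g \<in> carrier K.K" "f \<in> carrier R" "g \<in> carrier R"
      using \<zeta> fg fs K.coeffs_in_closed by auto
    have af: "u \<otimes> f \<in> ?a" "u \<otimes> g \<in> ?a"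
      using fg genideal_self[OF fs] u(1) by (auto intro: a.I_l_closed)
    have ufg: "u \<otimes> f \<in> carrier R" "u \<otimes> g \<in> carrier R" using u c by auto
    have w: "?w \<in> carrier K.K" using c by simp
    have "diff K.K ?w = K.scalar (u \<otimes> f) \<otimes>\<^bsub>K.K\<^esub> \<zeta> g \<oplus>\<^bsub>K.K\<^esub> K.scalar (u \<otimes> g) \<otimes>\<^bsub>K.K\<^esub> K.involution (\<zeta> f)"
      using c \<zeta> fg ufg by (simp add: D.diff_mult K.scalar_comm)
    moreover have "K.scalar (u \<otimes> f) \<otimes>\<^bsub>K.K\<^esub> \<zeta> g \<in> K.coeffs_in J"
      unfolding J by (rule K.coeffs_in_scalar_prod[OF a.is_ideal I af(1)]) (use \<zeta> fg in auto)
    moreover have "K.scalar (u \<otimes> g) \<otimes>\<^bsub>K.K\<^esub> K.involution (\<zeta> f) \<in> K.coeffs_in J"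
      unfolding J by (rule K.coeffs_in_scalar_prod[OF a.is_ideal I af(2)])
        (use \<zeta> fg in \<open>auto intro: K.coeffs_in_involution[OF I]\<close>)
    ultimately have dw: "diff K.K ?w \<in> K.coeffs_in J"
      by (simp add: K.coeffs_in_add[OF J.is_ideal])
    have "K.\<phi> (diff K.K ?w) = \<zero>\<^bsub>K.L\<^esub>"
    proof (rule K.target.koszul_ext)
      fix S assume S': "S \<subseteq> K.target.V"
      then have S: "S \<subseteq> K.V" by (simp add: K.target_V)
      have dJ: "diff K.K ?w S \<in> J" by (rule K.coeffs_in_coeff[OF dw S])
      have 1: "?h (diff K.K ?w S) = J" using a_rcos_zero[OF J.is_ideal dJ] .
      have "\<zero>\<^bsub>R Quot J\<^esub> = J" unfolding FactRing_def by simp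
      with 1 show "K.\<phi> (diff K.K ?w) S = \<zero>\<^bsub>K.L\<^esub> S"
        unfolding K.koszul_map_coeff[OF S] K.target.koszul_zero_coeff[OF S'] by (rule trans[OF _ sym])
    qed (use w in \<open>auto intro!: K.koszul_map_closed\<close>)
    then show "K.\<phi> ?w \<in> dg_cycles K.L"
      unfolding dg_cycles_def using w K.koszul_map_closed[OF w] K.koszul_map_diff[OF w] by simp
    have "?w \<in> piece K.K (1 + 1)" by (rule K.piece_mult) (use \<zeta> fg in auto)
    then show "K.\<phi> ?w \<in> piece K.L 2" by (intro K.koszul_map_piece) (simp add: numeral_2_eq_2)
  qed
  define z where "z i = \<zeta> (fs ! i)" for i
  have zc: "z i \<in> carrier K.K" if "i < length fs" for i
    using K.coeffs_in_closed[of "\<zeta> (fs ! i)" I] \<zeta>[of "fs ! i"] that by (simp add: z_def)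
  have zs: "z 0 \<in> carrier K.K" "z 1 \<in> carrier K.K" "z 2 \<in> carrier K.K" "z 3 \<in> carrier K.K"
    by (rule zc, use four in linarith)+
  let ?Z = "K.chain z 4"
  have Z: "?Z \<in> carrier K.K" using zc four by (intro K.chain_closed) auto
  \<comment> \<open>The chain regrouped into two pairs, each of which maps to a cycle of degree 2
    over the quotient.\<close>
  have Zeq: "?Z = (z 3 \<otimes>\<^bsub>K.K\<^esub> z 2) \<otimes>\<^bsub>K.K\<^esub> (z 1 \<otimes>\<^bsub>K.K\<^esub> z 0)"
    using zs by (simp add: eval_nat_numeral D.m_assoc)
  have "fs ! i \<in> set fs" if "i < 4" for i using four that by simp
  then have p: "K.\<phi> (z i \<otimes>\<^bsub>K.K\<^esub> z j) \<in> dg_cycles K.L \<and> K.\<phi> (z i \<otimes>\<^bsub>K.K\<^esub> z j) \<in> piece K.L 2"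
    if "i < 4" "j < 4" for i j
    unfolding z_def using that by (intro pair) auto
  have "K.\<phi> (z 3 \<otimes>\<^bsub>K.K\<^esub> z 2) \<otimes>\<^bsub>K.L\<^esub> K.\<phi> (z 1 \<otimes>\<^bsub>K.K\<^esub> z 0) \<in> dg_boundaries K.L"
    by (rule E.trivial_massey_mult_boundary[where p = 2 and q = 2, OF massey[folded xs(2)]])
      (use p[of 3 2] p[of 1 0] in simp_all)
  then have "K.\<phi> ?Z \<in> dg_boundaries K.L"
    unfolding Zeq using zs by (simp add: K.koszul_map_mult)
  then obtain w0 where w0: "w0 \<in> carrier K.L" "K.\<phi> ?Z = diff K.L w0"
    by (auto simp: dg_boundaries_def)
  obtain w where w: "w \<in> carrier K.K" "K.\<phi> w = w0"
    using K.koszul_map_surj[OF surj w0(1)] by blast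
  have eq: "K.\<phi> ?Z = K.\<phi> (diff K.K w)" using w0 w by (simp add: K.koszul_map_diff)
  \<comment> \<open>After lifting w0 to R, the fourfold product and d w agree modulo J, so their
    difference has coefficients in J and therefore in \<aa>.\<close>
  define y where "y = ?Z \<ominus>\<^bsub>K.K\<^esub> diff K.K w"
  have yc: "y \<in> carrier K.K" using Z w by (simp add: y_def)
  have "y \<in> K.coeffs_in ?a"
  proof (rule K.coeffs_inI[OF yc])
    fix S assume S: "S \<subseteq> K.V"
    have c: "?Z S \<in> carrier R" "diff K.K w S \<in> carrier R"
      using S Z w by (auto intro: K.coeff_closed)
    have "?h (?Z S) = ?h (diff K.K w S)"
      using arg_cong[OF eq, of "\<lambda>x. x S"] S by (simp add: K.koszul_map_coeff)
    then have "?Z S \<ominus> diff K.K w S \<in> J" using quotient_eq_iff[OF J.is_ideal c] by simp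
    then show "y S \<in> ?a"
      using Ja S Z w by (auto simp: y_def a_minus_def K.koszul_add_coeff K.koszul_a_inv_coeff)
  qed
  \<comment> \<open>The descent starts with all four factors and multiplier 1; each of its steps
    multiplies the multiplier by u.\<close>
  then have "K.scalar \<one> \<otimes>\<^bsub>K.K\<^esub> K.chain z 4 \<noteq> diff K.K w \<oplus>\<^bsub>K.K\<^esub> y"
  proof (intro K.chain_not_boundary[where fs = fs and M = M and u = u])
    show "set fs \<subseteq> M" using genideal_self[OF fs] aM by auto
    show "r \<in> Idl (set fs)" if "p < length fs" "r \<in> carrier R"
      "fs ! p \<otimes> r \<in> Idl {fs ! i | i. i < length fs \<and> i \<noteq> p}" for p r
      using regular_sequence_syzygy[OF fs reg that] .
    show "\<one> \<ominus> u \<in> M" using u M(3) by auto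
    show "\<one> \<ominus> \<one> \<in> M" by (simp add: minus_eq r_neg)
    show "z i \<in> carrier K.K \<and> diff K.K (z i) = K.scalar (u \<otimes> fs ! i)" if "i < length fs" for i
      using zc \<zeta> that by (auto simp: z_def)
  qed (use M xsM four u w in auto)
  moreover have "K.scalar \<one> \<otimes>\<^bsub>K.K\<^esub> K.chain z 4 = diff K.K w \<oplus>\<^bsub>K.K\<^esub> y"
    unfolding K.koszul_one_scalar[symmetric] y_def
    using Z w by (simp add: D.add_minus_cancel)
  ultimately show False by blast
qed

end

section \<open>Local and graded rings\<close>

context cring
begin

text \<open>Zorn's lemma for the ideals that avoid 1, a condition inherited by unions of chains.
  With a unique maximal ideal it places every proper ideal inside that one.\<close>

lemma exists_maximalideal_superset:
  assumes "ideal I R" "\<one> \<notin> I"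
  shows "\<exists>M. maximalideal M R \<and> I \<subseteq> M"
proof -
  define C where "C = {N. ideal N R \<and> I \<subseteq> N \<and> \<one> \<notin> N}"
  have "\<exists>M\<in>C. \<forall>N\<in>C. M \<subseteq> N \<longrightarrow> N = M"
  proof (rule subset_Zorn_nonempty)
    show "C \<noteq> {}" using assms by (auto simp: C_def)
  next
    fix \<C> assume ne: "\<C> \<noteq> {}" and chain: "subset.chain C \<C>"
    have id: "ideal N R" "I \<subseteq> N" "\<one> \<notin> N" if "N \<in> \<C>" for N
      using chain that by (auto simp: subset_chain_def C_def)
    have "ideal (\<Union>\<C>) R"
    proof (rule idealI)
      show "subgroup (\<Union>\<C>) (add_monoid R)"
      proof (rule add.subgroupI)
        show "\<Union>\<C> \<subseteq> carrier R" using id ideal.Icarr by fastforce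
        obtain N where N: "N \<in> \<C>" using ne by blast
        then have "\<zero> \<in> N" using id by (simp add: additive_subgroup.zero_closed ideal_def)
        then show "\<Union>\<C> \<noteq> {}" using N by auto
      next
        fix a assume "a \<in> \<Union>\<C>"
        then obtain N where N: "N \<in> \<C>" "a \<in> N" by blast
        interpret N: ideal N R by (rule id[OF N(1)])
        show "\<ominus> a \<in> \<Union>\<C>" using N N.a_inv_closed by auto
      next
        fix a b assume "a \<in> \<Union>\<C>" "b \<in> \<Union>\<C>"
        then obtain N N' where N: "N \<in> \<C>" "a \<in> N" "N' \<in> \<C>" "b \<in> N'" by blast
        then have "N \<subseteq> N' \<or> N' \<subseteq> N" using chain by (auto simp: subset_chain_def)
        then obtain N'' where N'': "N'' \<in> \<C>" "a \<in> N''" "b \<in> N''" using N by blast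
        interpret N: ideal N'' R by (rule id[OF N''(1)])
        show "a \<oplus> b \<in> \<Union>\<C>" using N'' N.a_closed by blast
      qed
    next
      fix a x assume "a \<in> \<Union>\<C>" and x: "x \<in> carrier R"
      then obtain N where N: "N \<in> \<C>" "a \<in> N" by blast
      interpret N: ideal N R by (rule id[OF N(1)])
      show "x \<otimes> a \<in> \<Union>\<C>" "a \<otimes> x \<in> \<Union>\<C>"
        using UnionI[OF N(1) N.I_l_closed[OF N(2) x]] UnionI[OF N(1) N.I_r_closed[OF N(2) x]] .
    qed (rule ring_axioms)
    moreover have "I \<subseteq> \<Union>\<C>" using ne id by blast
    ultimately show "\<Union>\<C> \<in> C" using id by (auto simp: C_def)
  qed
  then obtain M where M: "M \<in> C" "\<And>N. N \<in> C \<Longrightarrow> M \<subseteq> N \<Longrightarrow> N = M" by blast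
  have "maximalideal M R"
  proof (rule maximalidealI)
    show "ideal M R" "carrier R \<noteq> M" using M(1) by (auto simp: C_def)
    fix N assume N: "ideal N R" "M \<subseteq> N" "N \<subseteq> carrier R"
    show "N = M \<or> N = carrier R"
    proof (cases "\<one> \<in> N")
      case True
      then show ?thesis using ideal.one_imp_carrier[OF N(1)] by simp
    next
      case False
      then have "N \<in> C" using N M(1) by (auto simp: C_def)
      then show ?thesis using M(2) N by blast
    qed
  qed
  then show ?thesis using M(1) by (auto simp: C_def)
qed

lemma quotient_vimage_ideal:
  assumes "ideal J R" "ideal N (R Quot J)"
  shows "ideal {r \<in> carrier R. J +> r \<in> N} R"
    and "N = (+>) J ` {r \<in> carrier R. J +> r \<in> N}"
proof -
  show "ideal {r \<in> carrier R. J +> r \<in> N} R"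
    by (rule ring_hom_ring.ideal_vimage[OF ideal.rcos_ring_hom_ring[OF assms(1)] assms(2)])
  have "N \<subseteq> (+>) J ` carrier R"
    using ideal.Icarr[OF assms(2)] unfolding FactRing_def A_RCOSETS_def' by auto
  then show "N = (+>) J ` {r \<in> carrier R. J +> r \<in> N}" by auto
qed

lemma quotient_image_one:
  assumes J: "ideal J R" and M: "ideal M R" "J \<subseteq> M" "\<one> \<notin> M"
  shows "\<one>\<^bsub>R Quot J\<^esub> \<notin> (+>) J ` M"
proof
  interpret M: ideal M R by (rule M(1))
  assume "\<one>\<^bsub>R Quot J\<^esub> \<in> (+>) J ` M"
  then obtain m where m: "m \<in> M" "J +> \<one> = J +> m" by (auto simp: FactRing_def)
  have mc: "m \<in> carrier R" using m(1) by (rule M.Icarr)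
  have "\<one> \<ominus> m \<in> J" using quotient_eq_iff[OF J _ mc, of \<one>] m(2) by simp
  then have "\<one> \<ominus> m \<in> M" using M by auto
  then have "m \<oplus> (\<one> \<ominus> m) \<in> M" using m by (intro M.a_closed)
  then show False using M(3) mc add_minus_cancel[of \<one> m] by simp
qed

text \<open>A proper ideal of the quotient pulls back to an ideal without 1, hence lies below the
  image of the maximal ideal; so that image is the only maximal ideal. Golodness of the quotient
  refers to its own \<open>max_ideal\<close>, which is hereby expressed through R.\<close>

lemma max_ideal_quotient:
  assumes uniq: "\<exists>!M. maximalideal M R" and J: "ideal J R" "J \<subseteq> max_ideal R"
  shows "max_ideal (R Quot J) = (+>) J ` max_ideal R"
proof -
  let ?M = "max_ideal R" and ?A = "R Quot J"
  have M: "maximalideal ?M R" unfolding max_ideal_def by (rule theI'[OF uniq])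
  have Mid: "ideal ?M R" using M by (rule maximalideal.axioms)
  have M1: "\<one> \<notin> ?M"
    using maximalideal.I_notcarr[OF M] ideal.one_imp_carrier[OF Mid] by auto
  have MU: "N \<subseteq> ?M" if N: "ideal N R" "\<one> \<notin> N" for N
    using exists_maximalideal_superset[OF N] uniq M by blast
  have hM: "ideal ((+>) J ` ?M) ?A" by (rule ring_ideal_imp_quot_ideal[OF J(1) Mid])
  have h1: "\<one>\<^bsub>?A\<^esub> \<notin> (+>) J ` ?M" by (rule quotient_image_one[OF J(1) Mid J(2) M1])
  interpret A: ring ?A by (rule ideal.quotient_is_ring[OF J(1)])
  have below: "N \<subseteq> (+>) J ` ?M" if N: "ideal N ?A" "\<one>\<^bsub>?A\<^esub> \<notin> N" for N
  proof -
    have "\<one> \<notin> {r \<in> carrier R. J +> r \<in> N}" using N(2) by (auto simp: FactRing_def)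
    then have "{r \<in> carrier R. J +> r \<in> N} \<subseteq> ?M"
      by (rule MU[OF quotient_vimage_ideal(1)[OF J(1) N(1)]])
    then show ?thesis using quotient_vimage_ideal(2)[OF J(1) N(1)] by blast
  qed
  have one: "N = carrier ?A" if "ideal N ?A" "\<one>\<^bsub>?A\<^esub> \<in> N" for N
    using ideal.one_imp_carrier[OF that] .
  show ?thesis
    unfolding max_ideal_def[of ?A]
  proof (rule the_equality)
    show "maximalideal ((+>) J ` ?M) ?A"
      by (rule maximalidealI[OF hM]) (use h1 below one in blast)+
  next
    fix N assume N: "maximalideal N ?A"
    then have id: "ideal N ?A" by (rule maximalideal.axioms)
    have "\<one>\<^bsub>?A\<^esub> \<notin> N" using maximalideal.I_notcarr[OF N] one[OF id] by auto
    then have "N \<subseteq> (+>) J ` ?M" by (rule below[OF id])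
    moreover have "(+>) J ` ?M \<subseteq> carrier ?A" using ideal.Icarr[OF hM] by blast
    ultimately show "N = (+>) J ` ?M"
      using maximalideal.I_maximal[OF N hM] h1 by auto
  qed
qed

text \<open>Identifies the irrelevant ideal of a graded quotient with the image of the irrelevant
  ideal of the polynomial ring.\<close>

lemma quotient_genideal_image:
  assumes J: "ideal J R" and S: "S \<subseteq> carrier R"
  shows "Idl\<^bsub>R Quot J\<^esub> ((+>) J ` S) = (+>) J ` (Idl S)"
proof
  let ?A = "R Quot J"
  interpret A: ring ?A by (rule ideal.quotient_is_ring[OF J])
  have hS: "(+>) J ` S \<subseteq> carrier ?A"
    using S unfolding FactRing_def A_RCOSETS_def' by auto
  show "Idl\<^bsub>?A\<^esub> ((+>) J ` S) \<subseteq> (+>) J ` (Idl S)"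
    by (rule A.genideal_minimal[OF ring_ideal_imp_quot_ideal[OF J genideal_ideal[OF S]]])
      (use genideal_self[OF S] in auto)
  have "Idl S \<subseteq> {r \<in> carrier R. J +> r \<in> Idl\<^bsub>?A\<^esub> ((+>) J ` S)}"
    by (rule genideal_minimal[OF quotient_vimage_ideal(1)[OF J A.genideal_ideal[OF hS]]])
      (use S A.genideal_self[OF hS] in auto)
  then show "(+>) J ` (Idl S) \<subseteq> Idl\<^bsub>?A\<^esub> ((+>) J ` S)" by auto
qed

text \<open>Converts the bound on the number of generators into the presence of at least four
  members in whichever regular sequence generates the ideal.\<close>

lemma num_generators_le_length:
  "set fs \<subseteq> carrier R \<Longrightarrow> num_generators R (Idl (set fs)) \<le> length fs"
  unfolding num_generators_def
  by (rule order_trans[OF Least_le card_length[of fs]]) auto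

lemma quotient_not_golod:
  assumes ci: "complete_intersection_ideal R \<aa>" "4 \<le> num_generators R \<aa>"
    and I: "ideal I R" and M: "ideal M R" "\<one> \<notin> M" "I \<subseteq> M"
    and sub: "\<aa> \<subseteq> ideal_prod R M I"
    and J: "J = ideal_prod R \<aa> I"
    and ys: "minimal_generators (R Quot J) ((+>) J ` M) ys"
  shows "\<not> admits_trivial_massey_operation (koszul (R Quot J) ys)"
proof -
  obtain fs where fs: "regular_sequence R fs" "\<aa> = Idl (set fs)"
    using ci(1) by (auto simp: complete_intersection_ideal_def)
  have c: "set fs \<subseteq> carrier R" using fs(1) by (simp add: regular_sequence_def)
  show ?thesis
  proof (rule koszul_not_golod[OF c _ _ I M])
    show "4 \<le> length fs" using num_generators_le_length[OF c] ci(2) fs(2) by simp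
  qed (use fs sub J ys in \<open>auto simp: regular_sequence_def minimal_generators_def\<close>)
qed

end

lemma local_not_golod:
  fixes R :: "('a, 'b) ring_scheme"
  assumes "local_ring R" and I: "ideal I R" "I \<noteq> carrier R"
    and ci: "complete_intersection_ideal R \<aa>" "4 \<le> num_generators R \<aa>"
    and sub: "\<aa> \<subseteq> ideal_prod R (max_ideal R) I"
  shows "\<not> golod_local (R Quot (ideal_prod R \<aa> I))"
proof -
  interpret cring R using assms(1) by (simp add: local_ring_def)
  have uniq: "\<exists>!M. maximalideal M R" using assms(1) by (simp add: local_ring_def)
  let ?M = "max_ideal R"
  have M: "maximalideal ?M R" unfolding max_ideal_def by (rule theI'[OF uniq])
  have Mid: "ideal ?M R" using M by (rule maximalideal.axioms)
  have M1: "\<one>\<^bsub>R\<^esub> \<notin> ?M"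
    using maximalideal.I_notcarr[OF M] ideal.one_imp_carrier[OF Mid] by auto
  have "\<one>\<^bsub>R\<^esub> \<notin> I" using I ideal.one_imp_carrier by blast
  then have IM: "I \<subseteq> ?M" using exists_maximalideal_superset[OF I(1)] uniq M by blast
  obtain fs where fs: "set fs \<subseteq> carrier R" "\<aa> = Idl\<^bsub>R\<^esub> (set fs)"
    using ci(1) by (auto simp: complete_intersection_ideal_def regular_sequence_def)
  have a: "ideal \<aa> R" unfolding fs(2) by (rule genideal_ideal[OF fs(1)])
  have J: "ideal (ideal_prod R \<aa> I) R" by (rule ideal_prod_is_ideal[OF a I(1)])
  have JM: "ideal_prod R \<aa> I \<subseteq> ?M" using ideal_prod_inter[OF a I(1)] IM by auto
  show ?thesis
    unfolding golod_local_def max_ideal_quotient[OF uniq J JM]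
    using quotient_not_golod[OF ci I(1) Mid M1 IM sub refl] by blast
qed

section \<open>The polynomial ring and the graded case\<close>

lemma std_poly_ring_simps:
  fixes P :: "((nat \<Rightarrow>\<^sub>0 nat) \<Rightarrow>\<^sub>0 'k::field) ring"
  assumes "P = std_poly_ring n"
  shows "carrier P = {p. \<forall>m\<in>Poly_Mapping.keys p. Poly_Mapping.keys m \<subseteq> {..<n}}"
    "monoid.mult P = (*)" "\<one>\<^bsub>P\<^esub> = 1" "\<zero>\<^bsub>P\<^esub> = 0" "ring.add P = (+)"
  by (simp_all add: assms std_poly_ring_def)

lemma std_poly_ring_cring: "cring (std_poly_ring n :: ((nat \<Rightarrow>\<^sub>0 nat) \<Rightarrow>\<^sub>0 'k::field) ring)"
proof (rule cringI)
  let ?P = "std_poly_ring n :: ((nat \<Rightarrow>\<^sub>0 nat) \<Rightarrow>\<^sub>0 'k) ring"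
  note S = std_poly_ring_simps[of ?P n, OF refl]
  have add: "p + q \<in> carrier ?P" if "p \<in> carrier ?P" "q \<in> carrier ?P" for p q
    using that Poly_Mapping.keys_add[of p q] unfolding S by blast
  have uminus: "- p \<in> carrier ?P" if "p \<in> carrier ?P" for p
    using that unfolding S by simp
  have mult: "p * q \<in> carrier ?P" if "p \<in> carrier ?P" "q \<in> carrier ?P" for p q
    unfolding S
  proof (intro CollectI ballI)
    fix m assume "m \<in> Poly_Mapping.keys (p * q)"
    then obtain a b where ab: "m = a + b" "a \<in> Poly_Mapping.keys p" "b \<in> Poly_Mapping.keys q"
      using Poly_Mapping.keys_mult[of p q] by blast
    have "Poly_Mapping.keys m \<subseteq> Poly_Mapping.keys a \<union> Poly_Mapping.keys b"
      unfolding ab(1) by (rule Poly_Mapping.keys_add)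
    then show "Poly_Mapping.keys m \<subseteq> {..<n}"
      using ab that unfolding S by blast
  qed
  show "abelian_group ?P"
  proof (rule abelian_groupI)
    fix p assume p: "p \<in> carrier ?P"
    show "\<exists>q\<in>carrier ?P. q \<oplus>\<^bsub>?P\<^esub> p = \<zero>\<^bsub>?P\<^esub>"
      by (rule bexI[OF _ uminus[OF p]]) (simp add: S)
  qed (use add in \<open>auto simp: S(2-) add.assoc add.commute\<close>, simp add: S)
  show "comm_monoid ?P"
    by (rule comm_monoidI) (use mult in \<open>auto simp: S(2-) mult.assoc mult.commute\<close>, simp add: S)
qed (simp add: std_poly_ring_simps(2-)[OF refl] distrib_right)

text \<open>Beyond the common argument, two facts are checked: the irrelevant ideal is proper, as
  its elements have no constant term, and it contains I, as a homogeneous generator of degree zero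
  is a constant and a nonzero constant would be a unit in I.\<close>

lemma graded_not_golod:
  fixes n :: nat
  defines "P \<equiv> std_poly_ring n :: ((nat \<Rightarrow>\<^sub>0 nat) \<Rightarrow>\<^sub>0 'k::field) ring"
    and "gr \<equiv> std_poly_grading n"
  assumes I: "homogeneous_ideal P gr I" "I \<noteq> carrier P"
    and ci: "complete_intersection_ideal P \<aa>" "4 \<le> num_generators P \<aa>"
    and sub: "\<aa> \<subseteq> ideal_prod P (irrelevant_ideal P gr) I"
  shows "\<not> golod_graded (P Quot (ideal_prod P \<aa> I)) (quotient_grading P gr (ideal_prod P \<aa> I))"
proof -
  interpret cring P unfolding P_def by (rule std_poly_ring_cring)
  have P_eq: "P = std_poly_ring n" by (simp add: P_def)
  note P_simps = std_poly_ring_simps[of P n, OF P_eq]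
  let ?G = "\<Union>d\<in>{1..}. gr d" and ?M = "irrelevant_ideal P gr"
  have grP: "gr d \<subseteq> carrier P" for d by (auto simp: gr_def P_def std_poly_grading_def)
  have G: "?G \<subseteq> carrier P" using grP by blast
  have Mid: "ideal ?M P" unfolding irrelevant_ideal_def by (rule genideal_ideal[OF G])
  have key0: "m = 0" if "(\<Sum>i\<in>Poly_Mapping.keys m. Poly_Mapping.lookup m i) = 0" for m :: "nat \<Rightarrow>\<^sub>0 nat"
  proof -
    have "\<forall>i\<in>Poly_Mapping.keys m. Poly_Mapping.lookup m i = 0" using that by simp
    then have "Poly_Mapping.keys m = {}" unfolding in_keys_iff[symmetric] by (meson equals0I in_keys_iff)
    then show "m = 0" by simp
  qed
  \<comment> \<open>Exponents are natural numbers, so the constant monomial factors only through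
    itself. Hence a multiple of a polynomial without constant term has none either.\<close>
  have zero_sum: "a = 0" if "a + b = 0" for a b :: "nat \<Rightarrow>\<^sub>0 nat"
    using that by (metis add_is_0 lookup_add lookup_zero poly_mapping_eqI)
  \<comment> \<open>The exponent vector 0 is the constant monomial, so Z is the set of polynomials
    with zero constant term.\<close>
  define Z where "Z = {p \<in> carrier P. 0 \<notin> Poly_Mapping.keys p}"
  have Zmult: "p * q \<in> Z" if p: "p \<in> Z" and q: "q \<in> carrier P" for p q
  proof -
    have "0 \<notin> Poly_Mapping.keys (p * q)"
    proof
      assume "0 \<in> Poly_Mapping.keys (p * q)"
      then obtain a b where "0 = a + b" "a \<in> Poly_Mapping.keys p"
        using Poly_Mapping.keys_mult[of p q] by blast
      then show False using zero_sum[of a b] p by (auto simp: Z_def)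
    qed
    moreover have "p \<otimes>\<^bsub>P\<^esub> q \<in> carrier P" using p q by (intro m_closed) (auto simp: Z_def)
    ultimately show ?thesis by (simp add: Z_def P_simps(2))
  qed
  have "ideal Z P"
  proof (rule idealI)
    show "subgroup Z (add_monoid P)"
    proof (rule add.subgroupI)
      have "\<zero>\<^bsub>P\<^esub> \<in> Z" unfolding Z_def using zero_closed by (simp add: P_simps(4))
      then show "Z \<noteq> {}" by auto
    next
      fix p assume p: "p \<in> Z"
      have "(- p) \<oplus>\<^bsub>P\<^esub> p = \<zero>\<^bsub>P\<^esub>" "- p \<in> carrier P" using p by (simp_all add: P_simps Z_def)
      then have "\<ominus>\<^bsub>P\<^esub> p = - p" using p by (intro minus_equality) (auto simp: Z_def)
      then show "\<ominus>\<^bsub>P\<^esub> p \<in> Z" using p \<open>- p \<in> carrier P\<close> by (simp add: Z_def)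
    next
      fix p q assume pq: "p \<in> Z" "q \<in> Z"
      then have "p \<oplus>\<^bsub>P\<^esub> q \<in> carrier P" by (intro a_closed) (auto simp: Z_def)
      then show "p \<oplus>\<^bsub>P\<^esub> q \<in> Z" using pq Poly_Mapping.keys_add[of p q] by (auto simp: Z_def P_simps(5))
    qed (auto simp: Z_def)
  next
    fix p q assume pq: "p \<in> Z" "q \<in> carrier P"
    then show "p \<otimes>\<^bsub>P\<^esub> q \<in> Z" "q \<otimes>\<^bsub>P\<^esub> p \<in> Z"
      using Zmult[OF pq] by (simp_all add: P_simps(2) mult.commute)
  qed (rule ring_axioms)
  moreover have "?G \<subseteq> Z"
    using G by (force simp: Z_def gr_def std_poly_grading_def)
  ultimately have "?M \<subseteq> Z" unfolding irrelevant_ideal_def by (rule genideal_minimal)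
  then have M1: "\<one>\<^bsub>P\<^esub> \<notin> ?M" by (auto simp: Z_def P_simps(3))
  obtain S where S: "S \<subseteq> (\<Union>d. gr d)" "I = Idl\<^bsub>P\<^esub> S"
    using I(1) by (auto simp: homogeneous_ideal_def)
  have SP: "S \<subseteq> carrier P" using S(1) grP by blast
  have Iid: "ideal I P" unfolding S(2) by (rule genideal_ideal[OF SP])
  interpret I: ideal I P by (rule Iid)
  have "S \<subseteq> ?M"
  proof
    fix s assume s: "s \<in> S"
    then obtain d where d: "s \<in> gr d" using S(1) by blast
    show "s \<in> ?M"
    proof (cases "d = 0")
      case False
      then have "s \<in> ?G" using d by force
      then show ?thesis using genideal_self[OF G] by (auto simp: irrelevant_ideal_def)
    next
      \<comment> \<open>Total degree zero leaves only the exponent vector 0, so s is a constant.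
        Were it nonzero, its inverse would put 1 into I.\<close>
      case True
      have keys: "Poly_Mapping.keys s \<subseteq> {0}"
        using d True key0 by (auto simp: gr_def std_poly_grading_def)
      define c where "c = Poly_Mapping.lookup s 0"
      have sc: "s = Poly_Mapping.single 0 c"
        using keys by (intro poly_mapping_eqI) (auto simp: c_def lookup_single when_def in_keys_iff)
      have "c = 0"
      proof (rule ccontr)
        assume c: "c \<noteq> 0"
        have "Poly_Mapping.single 0 (inverse c) \<in> carrier P" by (simp add: P_simps(1))
        moreover have "s \<in> I" using s genideal_self[OF SP] S(2) by auto
        ultimately have "Poly_Mapping.single 0 (inverse c) \<otimes>\<^bsub>P\<^esub> s \<in> I" by (intro I.I_l_closed)
        moreover have "Poly_Mapping.single 0 (inverse c) \<otimes>\<^bsub>P\<^esub> s = \<one>\<^bsub>P\<^esub>"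
          unfolding sc P_simps(2,3) using c by (simp add: mult_single)
        ultimately show False using I(2) I.one_imp_carrier by simp
      qed
      then have "s = \<zero>\<^bsub>P\<^esub>" by (simp add: sc P_simps(4))
      then show ?thesis using Mid by (simp add: additive_subgroup.zero_closed ideal_def)
    qed
  qed
  then have IM: "I \<subseteq> ?M" unfolding S(2) by (rule genideal_minimal[OF Mid])
  obtain fs where fs: "set fs \<subseteq> carrier P" "\<aa> = Idl\<^bsub>P\<^esub> (set fs)"
    using ci(1) by (auto simp: complete_intersection_ideal_def regular_sequence_def)
  have a: "ideal \<aa> P" unfolding fs(2) by (rule genideal_ideal[OF fs(1)])
  let ?J = "ideal_prod P \<aa> I"
  have J: "ideal ?J P" by (rule ideal_prod_is_ideal[OF a Iid])
  have "irrelevant_ideal (P Quot ?J) (quotient_grading P gr ?J) = Idl\<^bsub>P Quot ?J\<^esub> ((+>\<^bsub>P\<^esub>) ?J ` ?G)"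
    unfolding irrelevant_ideal_def quotient_grading_def by (simp add: image_UN)
  also have "\<dots> = (+>\<^bsub>P\<^esub>) ?J ` ?M"
    unfolding irrelevant_ideal_def by (rule quotient_genideal_image[OF J G])
  finally show ?thesis
    unfolding golod_graded_def
    using quotient_not_golod[OF ci Iid Mid M1 IM sub refl] by auto
qed

theorem proposition4p9:
  fixes R :: "('a, 'b) ring_scheme"
    and P :: "((nat \<Rightarrow>\<^sub>0 nat) \<Rightarrow>\<^sub>0 'k::field) ring"
  shows
    "(\<forall>I \<aa>.
        regular_local_ring R \<and>
        ideal I R \<and> I \<noteq> carrier R \<and>
        complete_intersection_ideal R \<aa> \<and>
        \<aa> \<subseteq> ideal_prod R (max_ideal R) I \<and>
        4 \<le> num_generators R \<aa>
        \<longrightarrow> \<not> golod_local (R Quot (ideal_prod R \<aa> I)))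
     \<and>
     (\<forall>n I \<aa>.
        P = std_poly_ring n \<and>
        homogeneous_ideal P (std_poly_grading n) I \<and> I \<noteq> carrier P \<and>
        homogeneous_ideal P (std_poly_grading n) \<aa> \<and> complete_intersection_ideal P \<aa> \<and>
        \<aa> \<subseteq> ideal_prod P (irrelevant_ideal P (std_poly_grading n)) I \<and>
        4 \<le> num_generators P \<aa>
        \<longrightarrow> \<not> golod_graded (P Quot (ideal_prod P \<aa> I))
                (quotient_grading P (std_poly_grading n) (ideal_prod P \<aa> I)))"
  using local_not_golod[of R] graded_not_golod unfolding regular_local_ring_def by blast

end
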